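(* Let $E$ be the directed graph with $E^0=\{1,2\}$ and edges $e_{1,1,0},e_{1,1,1},e_{1,2,0},e_{2,1,0},e_{2,1,1},e_{2,2,0},e_{2,2,1}$, where $r(e_{i,j,m})=i$ and $s(e_{i,j,m})=j$. Let $f_{a_1}:1E^*\to1E^*$ and $f_{a_2}:2E^*\to2E^*$ be the partial isomorphisms of $E^*$ determined recursively by the relations (for $\mu\in1E^*$, $\nu\in2E^*$) $$f_{a_1}\cdot e_{1,1,0}\mu=e_{1,1,1}\mu,\quad f_{a_1}\cdot e_{1,1,1}\mu=e_{1,1,0}(f_{a_1}\cdot\mu),\quad f_{a_1}\cdot e_{1,2,0}\nu=e_{1,2,0}\nu,$$ $$f_{a_2}\cdot e_{2,1,0}\mu=e_{2,1,0}(f_{a_1}\cdot\mu),\quad f_{a_2}\cdot e_{2,1,1}\mu=e_{2,1,1}(f_{a_1}\cdot\mu),$$ $$f_{a_2}\cdot e_{2,2,0}\nu=e_{2,2,1}\nu,\quad f_{a_2}\cdot e_{2,2,1}\nu=e_{2,2,0}(f_{a_2}\cdot\nu),$$ with $f_{a_i}\cdot i=i$. Let $G$ be the subgroupoid of $\mathrm{PIso}(E^* )$ generated by $f_{a_1},f_{a_2}$ and the identities $\mathrm{id}_1,\mathrm{id}_2$, acting self-similarly on $E$. Then $(\mathcal{O}(G,E),\sigma)$ has a unique KMS$_{\ln(2+\sqrt2)}$ state $\psi$, and its values on $u_g$ for $g\in\{\mathrm{id}_1,\mathrm{id}_2,f_{a_1},f_{a_1}^{-1},f_{a_2},f_{a_2}^{-1}\}$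 are $$\psi(u_g)=\begin{cases}\sqrt2-1&\text{for }g=\mathrm{id}_1,\\2-\sqrt2&\text{for }g=\mathrm{id}_2,\\3-2\sqrt2&\text{for }g=f_{a_1}\text{ and }g=f_{a_1}^{-1},\\10-7\sqrt2&\text{for }g=f_{a_2}\text{ and }g=f_{a_2}^{-1}.\end{cases}$$
   Context: Graphs: $E^k$ is the set of paths $\mu=\mu_1\cdots\mu_k$ with $\mu_i\in E^1$, $s(\mu_i)=r(\mu_{i+1})$; $r(\mu)=r(\mu_1)$, $s(\mu)=s(\mu_k)$, $|\mu|=k$; vertices are paths of length $0$; $E^*=\bigsqcup_{k\ge0}E^k$; $vE^k=\{\mu\in E^k:r(\mu)=v\}$, $vE^*=\bigsqcup_kvE^k$. Self-similar actions: a partial isomorphism of $E^*$ is a bijection $g:vE^*\to wE^*$ that maps $vE^k$ bijectively onto $wE^k$ for all $k\ge0$ and satisfies $g(\mu e)\in g(\mu)E^1$ for $\mu e\in vE^*$, $e\in E^1$; $d(g)=v$, $c(g)=w$. Under composition these form a groupoid $\mathrm{PIso}(E^* )$ with unit space $E^0$. A subgroupoid $G$ (with unit space $E^0$) acts self-similarly if for all $g\in G$, $e\in d(g)E^1$ there is a (unique) $g|_e\in G$ with $g\cdot(e\mu)=(g\cdot e)(g|_e\cdot\mu)$ for all $\mu\in s(e)E^*$. Algebras: a unitary representation $U$ of $G$ in a $C^*$-algebra assigns to each $v\in E^0$ a projection $U_v$ and to each $g$ a partial isometry $U_g$ with initial projection $U_{d(g)}$ and final projection $U_{c(g)}$, with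 $U_gU_h=U_{gh}$ if $d(g)=c(h)$ and $0$ otherwise (units $\mathrm{id}_v$ are identified with $v$). A Toeplitz-Cuntz-Krieger $E$-family $(p,s)$ consists of mutually orthogonal projections $p_v$ and partial isometries $s_e$ with $s_e^*s_e=p_{s(e)}$ and $p_v\ge\sum_{e\in vE^1}s_es_e^*$. $\mathcal{T}(G,E)$ is the universal unital $C^*$-algebra generated by a unitary representation $u$ of $G$ and a Toeplitz-Cuntz-Krieger $E$-family $(p,s)$ with $u_v=p_v$, $\sum_vp_v=1$, and $u_gs_e=s_{g\cdot e}u_{g|_e}$ if $d(g)=r(e)$, $u_gs_e=0$ otherwise. $\mathcal{O}(G,E)$ is the quotient of $\mathcal{T}(G,E)$ by the ideal generated by $\{p_v-\sum_{e\in vE^1}s_es_e^*:v\in E^0\}$, with images of generators denoted by the same symbols. The dynamics $\sigma:\mathbb{R}\to\operatorname{Aut}\mathcal{O}(G,E)$ satisfies $\sigma_t(s_\mu u_gs_\nu^* )=e^{it(|\mu|-|\nu|)}s_\mu u_gs_\nu^*$, where $s_\mu=s_{\mu_1}\cdots s_{\mu_k}$, $s_v=p_v$. KMS states: a state $\phi$ is a KMS$_\beta$ state if $\phi(ab)=\phi(b\sigma_{i\beta}(a))$ for all $a,b$ in a set of analytic elements (those $a$ for which $t\mapsto\sigma_t(a)$ extends to an entire function on $\mathbb{C}$) spanning a dense $\sigma$-invariant subspace. *)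

theory Defs
  imports
    "Graph_Theory.Digraph"
    "HOL-Algebra.Module"
    "HOL-Algebra.QuotRing"
    "HOL-Algebra.Subrings"
    "HOL-Analysis.Abstract_Metric_Spaces"
    Complex_Main
begin

section \<open>Unital $C^*$-algebras\<close>

record 'a cstar = "(complex, 'a) module" +
  adj :: "'a \<Rightarrow> 'a"
  nrm :: "'a \<Rightarrow> real"

text \<open>The cut-off outside the carrier is needed because \<^locale>\<open>Metric_space\<close> requires
  symmetry and nonnegativity on the whole type.\<close>

definition ndist :: "'a cstar \<Rightarrow> 'a \<Rightarrow> 'a \<Rightarrow> real" where
  "ndist A x y = (if x \<in> carrier A \<and> y \<in> carrier A then nrm A (x \<ominus>\<^bsub>A\<^esub> y) else 0)"

abbreviation ntop :: "'a cstar \<Rightarrow> 'a topology" where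
  "ntop A \<equiv> Metric_space.mtopology (carrier A) (ndist A)"

text \<open>The zero algebra is allowed, so \<open>nrm A \<one> = 1\<close> is not required.\<close>

locale cstar_algebra =
  ring A for A :: "'a cstar" (structure) +
  assumes smult_closed: "\<And>c x. x \<in> carrier A \<Longrightarrow> c \<odot>\<^bsub>A\<^esub> x \<in> carrier A"
    and smult_add_left:
      "\<And>c d x. x \<in> carrier A \<Longrightarrow> (c + d) \<odot>\<^bsub>A\<^esub> x = c \<odot>\<^bsub>A\<^esub> x \<oplus>\<^bsub>A\<^esub> d \<odot>\<^bsub>A\<^esub> x"
    and smult_add_right:
      "\<And>c x y. \<lbrakk>x \<in> carrier A; y \<in> carrier A\<rbrakk> \<Longrightarrow> c \<odot>\<^bsub>A\<^esub> (x \<oplus>\<^bsub>A\<^esub> y) = c \<odot>\<^bsub>A\<^esub> x \<oplus>\<^bsub>A\<^esub> c \<odot>\<^bsub>A\<^esub> y"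
    and smult_assoc: "\<And>c d x. x \<in> carrier A \<Longrightarrow> (c * d) \<odot>\<^bsub>A\<^esub> x = c \<odot>\<^bsub>A\<^esub> (d \<odot>\<^bsub>A\<^esub> x)"
    and smult_one: "\<And>x. x \<in> carrier A \<Longrightarrow> 1 \<odot>\<^bsub>A\<^esub> x = x"
    and smult_mult_left:
      "\<And>c x y. \<lbrakk>x \<in> carrier A; y \<in> carrier A\<rbrakk> \<Longrightarrow> (c \<odot>\<^bsub>A\<^esub> x) \<otimes>\<^bsub>A\<^esub> y = c \<odot>\<^bsub>A\<^esub> (x \<otimes>\<^bsub>A\<^esub> y)"
    and smult_mult_right:
      "\<And>c x y. \<lbrakk>x \<in> carrier A; y \<in> carrier A\<rbrakk> \<Longrightarrow> x \<otimes>\<^bsub>A\<^esub> (c \<odot>\<^bsub>A\<^esub> y) = c \<odot>\<^bsub>A\<^esub> (x \<otimes>\<^bsub>A\<^esub> y)"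
    and adj_closed: "\<And>x. x \<in> carrier A \<Longrightarrow> adj A x \<in> carrier A"
    and adj_adj: "\<And>x. x \<in> carrier A \<Longrightarrow> adj A (adj A x) = x"
    and adj_add: "\<And>x y. \<lbrakk>x \<in> carrier A; y \<in> carrier A\<rbrakk> \<Longrightarrow> adj A (x \<oplus>\<^bsub>A\<^esub> y) = adj A x \<oplus>\<^bsub>A\<^esub> adj A y"
    and adj_smult: "\<And>c x. x \<in> carrier A \<Longrightarrow> adj A (c \<odot>\<^bsub>A\<^esub> x) = cnj c \<odot>\<^bsub>A\<^esub> adj A x"
    and adj_mult: "\<And>x y. \<lbrakk>x \<in> carrier A; y \<in> carrier A\<rbrakk> \<Longrightarrow> adj A (x \<otimes>\<^bsub>A\<^esub> y) = adj A y \<otimes>\<^bsub>A\<^esub> adj A x"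
    and nrm_nonneg: "\<And>x. x \<in> carrier A \<Longrightarrow> 0 \<le> nrm A x"
    and nrm_eq_0: "\<And>x. x \<in> carrier A \<Longrightarrow> nrm A x = 0 \<longleftrightarrow> x = \<zero>\<^bsub>A\<^esub>"
    and nrm_triangle: "\<And>x y. \<lbrakk>x \<in> carrier A; y \<in> carrier A\<rbrakk> \<Longrightarrow> nrm A (x \<oplus>\<^bsub>A\<^esub> y) \<le> nrm A x + nrm A y"
    and nrm_smult: "\<And>c x. x \<in> carrier A \<Longrightarrow> nrm A (c \<odot>\<^bsub>A\<^esub> x) = cmod c * nrm A x"
    and nrm_mult: "\<And>x y. \<lbrakk>x \<in> carrier A; y \<in> carrier A\<rbrakk> \<Longrightarrow> nrm A (x \<otimes>\<^bsub>A\<^esub> y) \<le> nrm A x * nrm A y"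
    and cstar_identity: "\<And>x. x \<in> carrier A \<Longrightarrow> nrm A (adj A x \<otimes>\<^bsub>A\<^esub> x) = (nrm A x)\<^sup>2"
    and complete: "Metric_space.mcomplete (carrier A) (ndist A)"

definition cpositive :: "'a cstar \<Rightarrow> 'a \<Rightarrow> bool" where
  "cpositive A x \<longleftrightarrow> (\<exists>y\<in>carrier A. x = adj A y \<otimes>\<^bsub>A\<^esub> y)"

definition cle :: "'a cstar \<Rightarrow> 'a \<Rightarrow> 'a \<Rightarrow> bool" where
  "cle A x y \<longleftrightarrow> cpositive A (y \<ominus>\<^bsub>A\<^esub> x)"

definition projection :: "'a cstar \<Rightarrow> 'a \<Rightarrow> bool" where
  "projection A x \<longleftrightarrow> x \<in> carrier A \<and> adj A x = x \<and> x \<otimes>\<^bsub>A\<^esub> x = x"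

definition partial_isometry :: "'a cstar \<Rightarrow> 'a \<Rightarrow> bool" where
  "partial_isometry A x \<longleftrightarrow> x \<in> carrier A \<and> x \<otimes>\<^bsub>A\<^esub> adj A x \<otimes>\<^bsub>A\<^esub> x = x"

definition star_hom :: "'a cstar \<Rightarrow> 'b cstar \<Rightarrow> ('a \<Rightarrow> 'b) set" where
  "star_hom A B = {\<pi> \<in> ring_hom A B.
     (\<forall>c. \<forall>x\<in>carrier A. \<pi> (c \<odot>\<^bsub>A\<^esub> x) = c \<odot>\<^bsub>B\<^esub> \<pi> x) \<and>
     (\<forall>x\<in>carrier A. \<pi> (adj A x) = adj B (\<pi> x))}"

definition generates :: "'a cstar \<Rightarrow> 'a set \<Rightarrow> bool" where
  "generates A X \<longleftrightarrow> X \<subseteq> carrier A \<and>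
     (\<forall>C. subring C A \<and> (\<forall>c. \<forall>x\<in>C. c \<odot>\<^bsub>A\<^esub> x \<in> C) \<and> (\<forall>x\<in>C. adj A x \<in> C) \<and>
          closedin (ntop A) C \<and> X \<subseteq> C \<longrightarrow> C = carrier A)"

text \<open>In a unital algebra ring ideals are automatically closed under scalar multiplication, and
  closed ideals of \<open>C\<^sup>*\<close>-algebras are automatically self-adjoint.\<close>

definition closed_ideal :: "'a cstar \<Rightarrow> 'a set \<Rightarrow> 'a set" where
  "closed_ideal A X = \<Inter>{I. ideal I A \<and> closedin (ntop A) I \<and> X \<subseteq> I}"

definition cstar_quot :: "'a cstar \<Rightarrow> 'a set \<Rightarrow> 'a set cstar" where
  "cstar_quot A J =
     \<lparr>carrier = carrier (A Quot J), mult = mult (A Quot J), one = one (A Quot J),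
      zero = zero (A Quot J), add = add (A Quot J),
      smult = (\<lambda>c X. \<Union>x\<in>X. J +>\<^bsub>A\<^esub> (c \<odot>\<^bsub>A\<^esub> x)),
      adj = (\<lambda>X. \<Union>x\<in>X. J +>\<^bsub>A\<^esub> adj A x),
      nrm = (\<lambda>X. INF x\<in>X. nrm A x)\<rparr>"


section \<open>Dynamics and KMS states\<close>

definition dynamics :: "'a cstar \<Rightarrow> (real \<Rightarrow> 'a \<Rightarrow> 'a) \<Rightarrow> bool" where
  "dynamics A \<sigma> \<longleftrightarrow>
     (\<forall>t. \<sigma> t \<in> star_hom A A \<and> bij_betw (\<sigma> t) (carrier A) (carrier A)) \<and>
     (\<forall>s t. \<forall>a\<in>carrier A. \<sigma> (s + t) a = \<sigma> s (\<sigma> t a)) \<and>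
     (\<forall>a\<in>carrier A. continuous_map euclidean (ntop A) (\<lambda>t. \<sigma> t a))"

text \<open>Functionals are taken to be undefined outside the carrier, so that uniqueness is equality.
  In a unital algebra a positive functional has norm one iff it maps the unit to 1.\<close>

definition cstate :: "'a cstar \<Rightarrow> ('a \<Rightarrow> complex) \<Rightarrow> bool" where
  "cstate A \<phi> \<longleftrightarrow> \<phi> \<in> extensional (carrier A) \<and>
     (\<forall>x\<in>carrier A. \<forall>y\<in>carrier A. \<phi> (x \<oplus>\<^bsub>A\<^esub> y) = \<phi> x + \<phi> y) \<and>
     (\<forall>c. \<forall>x\<in>carrier A. \<phi> (c \<odot>\<^bsub>A\<^esub> x) = c * \<phi> x) \<and>
     (\<forall>x\<in>carrier A. cpositive A x \<longrightarrow> \<phi> x \<in> \<real> \<and> 0 \<le> Re (\<phi> x)) \<and>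
     \<phi> \<one>\<^bsub>A\<^esub> = 1"

definition entire :: "'a cstar \<Rightarrow> (complex \<Rightarrow> 'a) \<Rightarrow> bool" where
  "entire A F \<longleftrightarrow> range F \<subseteq> carrier A \<and>
     (\<forall>z. \<exists>D. limitin (ntop A) (\<lambda>h. (1 / h) \<odot>\<^bsub>A\<^esub> (F (z + h) \<ominus>\<^bsub>A\<^esub> F z)) D (at 0))"

text \<open>\<open>F z\<close> is what is usually written \<open>\<sigma>\<^sub>z(a)\<close>; the extension is unique when it exists.\<close>

definition entire_extension ::
    "'a cstar \<Rightarrow> (real \<Rightarrow> 'a \<Rightarrow> 'a) \<Rightarrow> 'a \<Rightarrow> (complex \<Rightarrow> 'a) \<Rightarrow> bool" where
  "entire_extension A \<sigma> a F \<longleftrightarrow> entire A F \<and> (\<forall>t. F (complex_of_real t) = \<sigma> t a)"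

definition analytic_elements :: "'a cstar \<Rightarrow> (real \<Rightarrow> 'a \<Rightarrow> 'a) \<Rightarrow> 'a set" where
  "analytic_elements A \<sigma> = {a \<in> carrier A. \<exists>F. entire_extension A \<sigma> a F}"

definition linear_subspace :: "'a cstar \<Rightarrow> 'a set \<Rightarrow> bool" where
  "linear_subspace A V \<longleftrightarrow> V \<subseteq> carrier A \<and> \<zero>\<^bsub>A\<^esub> \<in> V \<and>
     (\<forall>x\<in>V. \<forall>y\<in>V. x \<oplus>\<^bsub>A\<^esub> y \<in> V) \<and> (\<forall>c. \<forall>x\<in>V. c \<odot>\<^bsub>A\<^esub> x \<in> V)"

definition linear_span :: "'a cstar \<Rightarrow> 'a set \<Rightarrow> 'a set" where
  "linear_span A S = \<Inter>{V. linear_subspace A V \<and> S \<subseteq> V}"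

definition KMS_state ::
    "'a cstar \<Rightarrow> (real \<Rightarrow> 'a \<Rightarrow> 'a) \<Rightarrow> real \<Rightarrow> ('a \<Rightarrow> complex) \<Rightarrow> bool" where
  "KMS_state A \<sigma> \<beta> \<phi> \<longleftrightarrow> cstate A \<phi> \<and>
     (\<exists>S. S \<subseteq> analytic_elements A \<sigma> \<and>
          ntop A closure_of linear_span A S = carrier A \<and>
          (\<forall>t. \<sigma> t ` linear_span A S \<subseteq> linear_span A S) \<and>
          (\<forall>a\<in>S. \<forall>b\<in>S. \<forall>F. entire_extension A \<sigma> a F \<longrightarrow>
             \<phi> (a \<otimes>\<^bsub>A\<^esub> b) = \<phi> (b \<otimes>\<^bsub>A\<^esub> F (\<i> * complex_of_real \<beta>))))"


section \<open>Path spaces\<close>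

text \<open>For an edge, \<^const>\<open>head\<close> is its range and \<^const>\<open>tail\<close> its source.
  A path \<open>\<mu> = \<mu>\<^sub>1\<cdots>\<mu>\<^sub>k\<close> is encoded as \<open>(r(\<mu>), [\<mu>\<^sub>1, \<dots>, \<mu>\<^sub>k])\<close>, and a vertex
  \<open>v\<close>, regarded as a path of length 0, as \<open>(v, [])\<close>.\<close>

type_synonym ('v, 'e) epath = "'v \<times> 'e list"

fun is_epath :: "('v, 'e) pre_digraph \<Rightarrow> ('v, 'e) epath \<Rightarrow> bool" where
  "is_epath E (v, []) \<longleftrightarrow> v \<in> verts E"
| "is_epath E (v, e # es) \<longleftrightarrow> e \<in> arcs E \<and> head E e = v \<and> is_epath E (tail E e, es)"

abbreviation prange :: "('v, 'e) epath \<Rightarrow> 'v" where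
  "prange \<mu> \<equiv> fst \<mu>"

definition psource :: "('v, 'e) pre_digraph \<Rightarrow> ('v, 'e) epath \<Rightarrow> 'v" where
  "psource E \<mu> = (if snd \<mu> = [] then fst \<mu> else tail E (last (snd \<mu>)))"

abbreviation plen :: "('v, 'e) epath \<Rightarrow> nat" where
  "plen \<mu> \<equiv> length (snd \<mu>)"

definition edge_path :: "('v, 'e) pre_digraph \<Rightarrow> 'e \<Rightarrow> ('v, 'e) epath" where
  "edge_path E e = (head E e, [e])"

text \<open>Concatenation \<open>\<mu>\<nu>\<close>; meaningful only when \<open>s(\<mu>) = r(\<nu>)\<close>.\<close>

definition pconcat :: "('v, 'e) epath \<Rightarrow> ('v, 'e) epath \<Rightarrow> ('v, 'e) epath" where
  "pconcat \<mu> \<nu> = (fst \<mu>, snd \<mu> @ snd \<nu>)"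

definition paths_len :: "('v, 'e) pre_digraph \<Rightarrow> 'v \<Rightarrow> nat \<Rightarrow> ('v, 'e) epath set" where
  "paths_len E v k = {\<mu>. is_epath E \<mu> \<and> prange \<mu> = v \<and> plen \<mu> = k}"

definition paths :: "('v, 'e) pre_digraph \<Rightarrow> 'v \<Rightarrow> ('v, 'e) epath set" where
  "paths E v = (\<Union>k. paths_len E v k)"


section \<open>Partial isomorphisms and self-similar groupoid actions\<close>

record ('v, 'e) piso =
  pdom :: 'v
  pcod :: 'v
  pact :: "('v, 'e) epath \<Rightarrow> ('v, 'e) epath"

text \<open>The underlying map is extensional, so that equality of records is equality of partial
  isomorphisms.\<close>

definition PIso :: "('v, 'e) pre_digraph \<Rightarrow> ('v, 'e) piso set" where
  "PIso E = {g. pdom g \<in> verts E \<and> pcod g \<in> verts E \<and>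
     pact g \<in> extensional (paths E (pdom g)) \<and>
     bij_betw (pact g) (paths E (pdom g)) (paths E (pcod g)) \<and>
     (\<forall>k. bij_betw (pact g) (paths_len E (pdom g) k) (paths_len E (pcod g) k)) \<and>
     (\<forall>\<mu>\<in>paths E (pdom g). \<forall>e\<in>arcs E. head E e = psource E \<mu> \<longrightarrow>
        (\<exists>f\<in>arcs E. head E f = psource E (pact g \<mu>) \<and>
           pact g (pconcat \<mu> (edge_path E e)) = pconcat (pact g \<mu>) (edge_path E f)))}"

definition piso_id :: "('v, 'e) pre_digraph \<Rightarrow> 'v \<Rightarrow> ('v, 'e) piso" where
  "piso_id E v = \<lparr>pdom = v, pcod = v, pact = (\<lambda>\<mu>\<in>paths E v. \<mu>)\<rparr>"

definition piso_comp ::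
    "('v, 'e) pre_digraph \<Rightarrow> ('v, 'e) piso \<Rightarrow> ('v, 'e) piso \<Rightarrow> ('v, 'e) piso" where
  "piso_comp E g h =
     \<lparr>pdom = pdom h, pcod = pcod g, pact = compose (paths E (pdom h)) (pact g) (pact h)\<rparr>"

definition piso_inv :: "('v, 'e) pre_digraph \<Rightarrow> ('v, 'e) piso \<Rightarrow> ('v, 'e) piso" where
  "piso_inv E g = \<lparr>pdom = pcod g, pcod = pdom g,
     pact = (\<lambda>\<mu>\<in>paths E (pcod g). inv_into (paths E (pdom g)) (pact g) \<mu>)\<rparr>"

definition subgroupoid :: "('v, 'e) pre_digraph \<Rightarrow> ('v, 'e) piso set \<Rightarrow> bool" where
  "subgroupoid E G \<longleftrightarrow> G \<subseteq> PIso E \<and> (\<forall>v\<in>verts E. piso_id E v \<in> G) \<and>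
     (\<forall>g\<in>G. piso_inv E g \<in> G) \<and>
     (\<forall>g\<in>G. \<forall>h\<in>G. pdom g = pcod h \<longrightarrow> piso_comp E g h \<in> G)"

definition generated_subgroupoid ::
    "('v, 'e) pre_digraph \<Rightarrow> ('v, 'e) piso set \<Rightarrow> ('v, 'e) piso set" where
  "generated_subgroupoid E X = \<Inter>{H. subgroupoid E H \<and> X \<subseteq> H}"

definition is_restriction ::
    "('v, 'e) pre_digraph \<Rightarrow> ('v, 'e) piso set \<Rightarrow> ('v, 'e) piso \<Rightarrow> 'e \<Rightarrow> ('v, 'e) piso \<Rightarrow> bool" where
  "is_restriction E G g e h \<longleftrightarrow> h \<in> G \<and> pdom h = tail E e \<and>
     pcod h = psource E (pact g (edge_path E e)) \<and>
     (\<forall>\<mu>\<in>paths E (tail E e).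
        pact g (pconcat (edge_path E e) \<mu>) = pconcat (pact g (edge_path E e)) (pact h \<mu>))"

definition acts_self_similarly :: "('v, 'e) pre_digraph \<Rightarrow> ('v, 'e) piso set \<Rightarrow> bool" where
  "acts_self_similarly E G \<longleftrightarrow> subgroupoid E G \<and>
     (\<forall>g\<in>G. \<forall>e\<in>arcs E. head E e = pdom g \<longrightarrow> (\<exists>!h. is_restriction E G g e h))"

definition restriction ::
    "('v, 'e) pre_digraph \<Rightarrow> ('v, 'e) piso set \<Rightarrow> ('v, 'e) piso \<Rightarrow> 'e \<Rightarrow> ('v, 'e) piso" where
  "restriction E G g e = (THE h. is_restriction E G g e h)"

text \<open>The edge \<open>g\<cdot>e\<close>, extracted from the path \<open>g\<cdot>e\<close> of length 1.\<close>

definition edge_act :: "('v, 'e) pre_digraph \<Rightarrow> ('v, 'e) piso \<Rightarrow> 'e \<Rightarrow> 'e" where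
  "edge_act E g e = hd (snd (pact g (edge_path E e)))"


section \<open>The algebras $\mathcal{T}(G,E)$ and $\mathcal{O}(G,E)$\<close>

definition groupoid_rep ::
    "('v, 'e) pre_digraph \<Rightarrow> ('v, 'e) piso set \<Rightarrow> 'a cstar \<Rightarrow> (('v, 'e) piso \<Rightarrow> 'a) \<Rightarrow> bool" where
  "groupoid_rep E G A u \<longleftrightarrow>
     (\<forall>v\<in>verts E. projection A (u (piso_id E v))) \<and>
     (\<forall>g\<in>G. partial_isometry A (u g) \<and>
        adj A (u g) \<otimes>\<^bsub>A\<^esub> u g = u (piso_id E (pdom g)) \<and>
        u g \<otimes>\<^bsub>A\<^esub> adj A (u g) = u (piso_id E (pcod g))) \<and>
     (\<forall>g\<in>G. \<forall>h\<in>G. u g \<otimes>\<^bsub>A\<^esub> u h =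
        (if pdom g = pcod h then u (piso_comp E g h) else \<zero>\<^bsub>A\<^esub>))"

definition range_sum ::
    "('v, 'e) pre_digraph \<Rightarrow> 'a cstar \<Rightarrow> ('e \<Rightarrow> 'a) \<Rightarrow> 'v \<Rightarrow> 'a" where
  "range_sum E A s v = (\<Oplus>\<^bsub>A\<^esub>e\<in>{e \<in> arcs E. head E e = v}. s e \<otimes>\<^bsub>A\<^esub> adj A (s e))"

definition TCK_family ::
    "('v, 'e) pre_digraph \<Rightarrow> 'a cstar \<Rightarrow> ('v \<Rightarrow> 'a) \<Rightarrow> ('e \<Rightarrow> 'a) \<Rightarrow> bool" where
  "TCK_family E A p s \<longleftrightarrow>
     (\<forall>v\<in>verts E. projection A (p v)) \<and>
     (\<forall>v\<in>verts E. \<forall>w\<in>verts E. v \<noteq> w \<longrightarrow> p v \<otimes>\<^bsub>A\<^esub> p w = \<zero>\<^bsub>A\<^esub>) \<and>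
     (\<forall>e\<in>arcs E. partial_isometry A (s e) \<and> adj A (s e) \<otimes>\<^bsub>A\<^esub> s e = p (tail E e)) \<and>
     (\<forall>v\<in>verts E. cle A (range_sum E A s v) (p v))"

definition toeplitz_family ::
    "('v, 'e) pre_digraph \<Rightarrow> ('v, 'e) piso set \<Rightarrow> 'a cstar \<Rightarrow>
     (('v, 'e) piso \<Rightarrow> 'a) \<Rightarrow> ('v \<Rightarrow> 'a) \<Rightarrow> ('e \<Rightarrow> 'a) \<Rightarrow> bool" where
  "toeplitz_family E G A u p s \<longleftrightarrow> groupoid_rep E G A u \<and> TCK_family E A p s \<and>
     (\<forall>v\<in>verts E. u (piso_id E v) = p v) \<and>
     (\<Oplus>\<^bsub>A\<^esub>v\<in>verts E. p v) = \<one>\<^bsub>A\<^esub> \<and>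
     (\<forall>g\<in>G. \<forall>e\<in>arcs E. u g \<otimes>\<^bsub>A\<^esub> s e =
        (if pdom g = head E e then s (edge_act E g e) \<otimes>\<^bsub>A\<^esub> u (restriction E G g e) else \<zero>\<^bsub>A\<^esub>))"

text \<open>\<open>T\<close>, with the family \<open>(u, p, s)\<close>, is the universal unital \<open>C\<^sup>*\<close>-algebra \<open>\<T>(G, E)\<close>.
  A formula cannot quantify over types, so the competing algebras \<open>B\<close> have their carriers in a
  type \<open>'b\<close>.  This is no restriction if \<open>E\<close> and \<open>G\<close> are countable and \<open>'b\<close> has at least the
  cardinality of the continuum, such as \<^typ>\<open>nat \<Rightarrow> nat \<Rightarrow> complex\<close>: the \<open>C\<^sup>*\<close>-algebra generated by a
  countable family is separable, hence has at most continuum many elements, and so is isomorphic to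
  one whose carrier is a subset of \<open>'b\<close>.  The homomorphism \<open>\<pi>\<close> is unique because \<open>T\<close> is generated
  by the family.\<close>

definition toeplitz_algebra ::
    "'b itself \<Rightarrow> ('v, 'e) pre_digraph \<Rightarrow> ('v, 'e) piso set \<Rightarrow> 'a cstar \<Rightarrow>
     (('v, 'e) piso \<Rightarrow> 'a) \<Rightarrow> ('v \<Rightarrow> 'a) \<Rightarrow> ('e \<Rightarrow> 'a) \<Rightarrow> bool" where
  "toeplitz_algebra (_ :: 'b itself) E G T u p s \<longleftrightarrow>
     cstar_algebra T \<and> toeplitz_family E G T u p s \<and>
     generates T (u ` G \<union> p ` verts E \<union> s ` arcs E) \<and>
     (\<forall>(B :: 'b cstar) U P S. cstar_algebra B \<and> toeplitz_family E G B U P S \<longrightarrow>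
        (\<exists>\<pi>\<in>star_hom T B. (\<forall>g\<in>G. \<pi> (u g) = U g) \<and> (\<forall>v\<in>verts E. \<pi> (p v) = P v) \<and>
           (\<forall>e\<in>arcs E. \<pi> (s e) = S e)))"

definition CK_ideal ::
    "('v, 'e) pre_digraph \<Rightarrow> 'a cstar \<Rightarrow> ('v \<Rightarrow> 'a) \<Rightarrow> ('e \<Rightarrow> 'a) \<Rightarrow> 'a set" where
  "CK_ideal E T p s = closed_ideal T ((\<lambda>v. p v \<ominus>\<^bsub>T\<^esub> range_sum E T s v) ` verts E)"

text \<open>\<open>CK_quot E T p s\<close> is \<open>\<O>(G, E)\<close> when \<open>T\<close> is \<open>\<T>(G, E)\<close>, and \<open>CK_map E T p s\<close> is the quotient
  map.\<close>

definition CK_quot ::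
    "('v, 'e) pre_digraph \<Rightarrow> 'a cstar \<Rightarrow> ('v \<Rightarrow> 'a) \<Rightarrow> ('e \<Rightarrow> 'a) \<Rightarrow> 'a set cstar" where
  "CK_quot E T p s = cstar_quot T (CK_ideal E T p s)"

definition CK_map ::
    "('v, 'e) pre_digraph \<Rightarrow> 'a cstar \<Rightarrow> ('v \<Rightarrow> 'a) \<Rightarrow> ('e \<Rightarrow> 'a) \<Rightarrow> 'a \<Rightarrow> 'a set" where
  "CK_map E T p s x = CK_ideal E T p s +>\<^bsub>T\<^esub> x"

definition path_elem ::
    "'a cstar \<Rightarrow> ('v \<Rightarrow> 'a) \<Rightarrow> ('e \<Rightarrow> 'a) \<Rightarrow> ('v, 'e) epath \<Rightarrow> 'a" where
  "path_elem A p s \<mu> =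
     (if snd \<mu> = [] then p (fst \<mu>) else foldr (\<lambda>e x. s e \<otimes>\<^bsub>A\<^esub> x) (snd \<mu>) \<one>\<^bsub>A\<^esub>)"

definition gauge_dynamics ::
    "('v, 'e) pre_digraph \<Rightarrow> ('v, 'e) piso set \<Rightarrow> 'a cstar \<Rightarrow>
     (('v, 'e) piso \<Rightarrow> 'a) \<Rightarrow> ('v \<Rightarrow> 'a) \<Rightarrow> ('e \<Rightarrow> 'a) \<Rightarrow> (real \<Rightarrow> 'a \<Rightarrow> 'a) \<Rightarrow> bool" where
  "gauge_dynamics E G A u p s \<sigma> \<longleftrightarrow> dynamics A \<sigma> \<and>
     (\<forall>t \<mu> \<nu>. \<forall>g\<in>G. is_epath E \<mu> \<and> is_epath E \<nu> \<longrightarrow>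
        (let a = path_elem A p s \<mu> \<otimes>\<^bsub>A\<^esub> u g \<otimes>\<^bsub>A\<^esub> adj A (path_elem A p s \<nu>)
         in \<sigma> t a = exp (\<i> * of_real (t * (real (plen \<mu>) - real (plen \<nu>)))) \<odot>\<^bsub>A\<^esub> a))"


section \<open>The example\<close>

datatype edge = e110 | e111 | e120 | e210 | e211 | e220 | e221

fun edge_r :: "edge \<Rightarrow> nat" where
  "edge_r e110 = 1" | "edge_r e111 = 1" | "edge_r e120 = 1"
| "edge_r e210 = 2" | "edge_r e211 = 2" | "edge_r e220 = 2" | "edge_r e221 = 2"

fun edge_s :: "edge \<Rightarrow> nat" where
  "edge_s e110 = 1" | "edge_s e111 = 1" | "edge_s e120 = 2"
| "edge_s e210 = 1" | "edge_s e211 = 1" | "edge_s e220 = 2" | "edge_s e221 = 2"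

definition exE :: "(nat, edge) pre_digraph" where
  "exE = \<lparr>verts = {1, 2}, arcs = UNIV, tail = edge_s, head = edge_r\<rparr>"

text \<open>The action on edge lists; \<open>act1\<close> and \<open>act2\<close> are used only on the edge lists of paths
  in \<open>1E\<^sup>*\<close> and \<open>2E\<^sup>*\<close>, respectively.\<close>

fun act1 :: "edge list \<Rightarrow> edge list" where
  "act1 [] = []"
| "act1 (e110 # es) = e111 # es"
| "act1 (e111 # es) = e110 # act1 es"
| "act1 (e120 # es) = e120 # es"

fun act2 :: "edge list \<Rightarrow> edge list" where
  "act2 [] = []"
| "act2 (e210 # es) = e210 # act1 es"
| "act2 (e211 # es) = e211 # act1 es"
| "act2 (e220 # es) = e221 # es"
| "act2 (e221 # es) = e220 # act2 es"

definition fa1 :: "(nat, edge) piso" where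
  "fa1 = \<lparr>pdom = 1, pcod = 1, pact = (\<lambda>\<mu>\<in>paths exE 1. (1, act1 (snd \<mu>)))\<rparr>"

definition fa2 :: "(nat, edge) piso" where
  "fa2 = \<lparr>pdom = 2, pcod = 2, pact = (\<lambda>\<mu>\<in>paths exE 2. (2, act2 (snd \<mu>)))\<rparr>"

text \<open>The defining relations of the two partial isomorphisms.\<close>

lemma fa1_relations:
  assumes "\<mu> \<in> paths exE 1" "\<nu> \<in> paths exE 2"
  shows "pact fa1 (1, []) = (1, [])"
    and "pact fa1 (pconcat (edge_path exE e110) \<mu>) = pconcat (edge_path exE e111) \<mu>"
    and "pact fa1 (pconcat (edge_path exE e111) \<mu>) = pconcat (edge_path exE e110) (pact fa1 \<mu>)"
    and "pact fa1 (pconcat (edge_path exE e120) \<nu>) = pconcat (edge_path exE e120) \<nu>"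
proof -
  obtain ms ns where "\<mu> = (1, ms)" "is_epath exE (1, ms)" "\<nu> = (2, ns)" "is_epath exE (2, ns)"
    using assms by (cases \<mu>, cases \<nu>) (auto simp: paths_def paths_len_def)
  then show "pact fa1 (1, []) = (1, [])"
    and "pact fa1 (pconcat (edge_path exE e110) \<mu>) = pconcat (edge_path exE e111) \<mu>"
    and "pact fa1 (pconcat (edge_path exE e111) \<mu>) = pconcat (edge_path exE e110) (pact fa1 \<mu>)"
    and "pact fa1 (pconcat (edge_path exE e120) \<nu>) = pconcat (edge_path exE e120) \<nu>"
    by (auto simp: fa1_def edge_path_def pconcat_def exE_def paths_def paths_len_def)
qed

lemma fa2_relations:
  assumes "\<mu> \<in> paths exE 1" "\<nu> \<in> paths exE 2"
  shows "pact fa2 (2, []) = (2, [])"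
    and "pact fa2 (pconcat (edge_path exE e210) \<mu>) = pconcat (edge_path exE e210) (pact fa1 \<mu>)"
    and "pact fa2 (pconcat (edge_path exE e211) \<mu>) = pconcat (edge_path exE e211) (pact fa1 \<mu>)"
    and "pact fa2 (pconcat (edge_path exE e220) \<nu>) = pconcat (edge_path exE e221) \<nu>"
    and "pact fa2 (pconcat (edge_path exE e221) \<nu>) = pconcat (edge_path exE e220) (pact fa2 \<nu>)"
proof -
  obtain ms ns where "\<mu> = (1, ms)" "is_epath exE (1, ms)" "\<nu> = (2, ns)" "is_epath exE (2, ns)"
    using assms by (cases \<mu>, cases \<nu>) (auto simp: paths_def paths_len_def)
  then show "pact fa2 (2, []) = (2, [])"
    and "pact fa2 (pconcat (edge_path exE e210) \<mu>) = pconcat (edge_path exE e210) (pact fa1 \<mu>)"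
    and "pact fa2 (pconcat (edge_path exE e211) \<mu>) = pconcat (edge_path exE e211) (pact fa1 \<mu>)"
    and "pact fa2 (pconcat (edge_path exE e220) \<nu>) = pconcat (edge_path exE e221) \<nu>"
    and "pact fa2 (pconcat (edge_path exE e221) \<nu>) = pconcat (edge_path exE e220) (pact fa2 \<nu>)"
    by (auto simp: fa1_def fa2_def edge_path_def pconcat_def exE_def paths_def paths_len_def)
qed

definition exG :: "(nat, edge) piso set" where
  "exG = generated_subgroupoid exE {fa1, fa2, piso_id exE 1, piso_id exE 2}"

end

(* A KMS_beta state psi satisfies psi(x a) = e^(beta k) psi(a x) for all x and all a of degree k. The
   definition gives this only on an unspecified dense set of analytic elements; for a of degree k it
   follows by approximating a from that set and comparing, on the two edges of the strip
   0 <= Im z <= beta, the 2 pi-periodic entire functions that extend t |-> psi(b sigma_t(a')).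

   Modulo the ideal on which psi vanishes, every product of generators is a word s_mu u_g s_nu^*, and
   the KMS relations reduce psi on words to psi(u_g). The groupoid consists of the powers f_v^n, where
   f_v = f_{a_v} is an odometer, and the Cuntz-Krieger relation gives
     (2 + sqrt 2) psi(u_g) = sum of psi(u_{g|_e}) over the edges e fixed by g,
   which expresses psi(u_{f_v^n}) by exponents n/2 and 0 and thus determines psi.

   For existence, the Toeplitz algebra acts on the l^2 space of paths by its universal property. The functionals
     tau_k(b) = sum over |lambda| = k of w(lambda) <b delta_lambda, delta_lambda>,
   with w(lambda) = (2 + sqrt 2)^(-k) psi(p_{s(lambda)}), satisfy tau_k(b u_g) = tau_k(u_g b) and
   tau_k(b s_e) = (2 + sqrt 2) tau_{k+1}(s_e b). They converge on words by the same recursion, and the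
   limit state vanishes on the Cuntz-Krieger ideal. *)

theory Submission
  imports Defs "HOL-Complex_Analysis.Complex_Analysis"
begin

text \<open>The proof uses no functional calculus. Its one fact about positive elements is that 1 -
  h has a self-adjoint square root when h is self-adjoint of norm below 1; this makes states bounded
  and Hermitian. The price is that orthogonality of the ranges s_e s_e^* is not at hand in the
  algebra itself, so the reduction to words is carried out modulo an arbitrary ideal that contains
  the products s_e^* s_f for e different from f. For functionals this is a null ideal, for operators
  on the path space it is 0.

  Uniqueness and existence meet in \<open>CK_KMS\<close>, a set of relations on the Toeplitz algebra
  in which no dynamics occurs. The path functionals satisfy them only approximately: the relation
  for s_e holds up to a change of level, and the Cuntz-Krieger defect is killed only above level 0.
  Both discrepancies disappear in the limit.

  The recursion for the exponents terminates because an even exponent is halved along each loop, an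
  odd one fixes no loop, and the edge from vertex 1 to vertex 2 resets the exponent to 0; hence
  vertex 1 is always treated before vertex 2.\<close>

section \<open>Normed star-algebras and dense subspaces\<close>

text \<open>The quotient of a \<open>C\<^sup>*\<close>-algebra by a closed ideal is needed only as a normed algebra with isometric
  involution, for which neither the \<open>C\<^sup>*\<close>-identity nor completeness has to be established.\<close>

locale nstar_algebra = ring A for A :: "'a cstar" (structure) +
  assumes scale_closed [simp, intro]: "x \<in> carrier A \<Longrightarrow> c \<odot> x \<in> carrier A"
    and scale_add_left: "x \<in> carrier A \<Longrightarrow> (c + d) \<odot> x = c \<odot> x \<oplus> d \<odot> x"
    and scale_add_right: "\<lbrakk>x \<in> carrier A; y \<in> carrier A\<rbrakk> \<Longrightarrow> c \<odot> (x \<oplus> y) = c \<odot> x \<oplus> c \<odot> y"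
    and scale_scale: "x \<in> carrier A \<Longrightarrow> c \<odot> (d \<odot> x) = (c * d) \<odot> x"
    and scale_one [simp]: "x \<in> carrier A \<Longrightarrow> 1 \<odot> x = x"
    and scale_mult_left: "\<lbrakk>x \<in> carrier A; y \<in> carrier A\<rbrakk> \<Longrightarrow> (c \<odot> x) \<otimes> y = c \<odot> (x \<otimes> y)"
    and scale_mult_right: "\<lbrakk>x \<in> carrier A; y \<in> carrier A\<rbrakk> \<Longrightarrow> x \<otimes> (c \<odot> y) = c \<odot> (x \<otimes> y)"
    and star_closed [simp, intro]: "x \<in> carrier A \<Longrightarrow> adj A x \<in> carrier A"
    and star_star [simp]: "x \<in> carrier A \<Longrightarrow> adj A (adj A x) = x"
    and star_add: "\<lbrakk>x \<in> carrier A; y \<in> carrier A\<rbrakk> \<Longrightarrow> adj A (x \<oplus> y) = adj A x \<oplus> adj A y"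
    and star_scale: "x \<in> carrier A \<Longrightarrow> adj A (c \<odot> x) = cnj c \<odot> adj A x"
    and star_mult: "\<lbrakk>x \<in> carrier A; y \<in> carrier A\<rbrakk> \<Longrightarrow> adj A (x \<otimes> y) = adj A y \<otimes> adj A x"
    and norm_nonneg [simp]: "x \<in> carrier A \<Longrightarrow> 0 \<le> nrm A x"
    and norm_eq_0: "x \<in> carrier A \<Longrightarrow> nrm A x = 0 \<longleftrightarrow> x = \<zero>"
    and norm_triangle: "\<lbrakk>x \<in> carrier A; y \<in> carrier A\<rbrakk> \<Longrightarrow> nrm A (x \<oplus> y) \<le> nrm A x + nrm A y"
    and norm_scale: "x \<in> carrier A \<Longrightarrow> nrm A (c \<odot> x) = cmod c * nrm A x"
    and norm_mult_le: "\<lbrakk>x \<in> carrier A; y \<in> carrier A\<rbrakk> \<Longrightarrow> nrm A (x \<otimes> y) \<le> nrm A x * nrm A y"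
    and norm_star [simp]: "x \<in> carrier A \<Longrightarrow> nrm A (adj A x) = nrm A x"

text \<open>The involution is isometric: the C*-identity and submultiplicativity bound the square of
  \<open>nrm A x\<close> by \<open>nrm A (adj A x) * nrm A x\<close>; cancelling gives one
  inequality, and \<open>adj A x\<close> in place of \<open>x\<close> gives the other.\<close>

sublocale cstar_algebra \<subseteq> nstar_algebra A
proof
  have le: "nrm A x \<le> nrm A (adj A x)" if x: "x \<in> carrier A" for x
  proof (cases "nrm A x = 0")
    case True
    then show ?thesis using nrm_nonneg adj_closed x by simp
  next
    case False
    then have pos: "nrm A x > 0" using nrm_nonneg[OF x] by simp
    have "nrm A x * nrm A x \<le> nrm A (adj A x) * nrm A x"
      using nrm_mult[of "adj A x" x] adj_closed[OF x] x by (simp add: cstar_identity power2_eq_square)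
    then show ?thesis using pos by simp
  qed
  show "nrm A (adj A x) = nrm A x" if "x \<in> carrier A" for x
    using le[of x] le[of "adj A x"] that by (simp add: adj_closed adj_adj)
qed (simp_all add: smult_closed smult_add_left smult_add_right smult_assoc smult_one smult_mult_left
    smult_mult_right adj_closed adj_adj adj_add adj_smult adj_mult nrm_nonneg nrm_eq_0 nrm_triangle
    nrm_smult nrm_mult)

context nstar_algebra
begin

lemma scale_zero_left [simp]:
  assumes "x \<in> carrier A" shows "0 \<odot> x = \<zero>"
proof -
  have "0 \<odot> x \<oplus> 0 \<odot> x = 0 \<odot> x" using scale_add_left[of x 0 0] assms by simp
  then show ?thesis using assms by simp
qed

lemma scale_zero_right [simp]: "c \<odot> \<zero> = \<zero>"
  using scale_scale[of \<zero> c 0] by simp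

lemma minus_eq_scale: "x \<in> carrier A \<Longrightarrow> \<ominus> x = (-1) \<odot> x"
proof -
  assume x: "x \<in> carrier A"
  have "x \<oplus> (-1) \<odot> x = \<zero>" using scale_add_left[of x 1 "-1"] x by simp
  then show ?thesis using x by (metis minus_equality scale_closed a_comm)
qed

lemma diff_eq_scale: "y \<in> carrier A \<Longrightarrow> x \<ominus> y = x \<oplus> (-1) \<odot> y"
  by (simp add: minus_eq_scale a_minus_def)

lemma scale_minus: "x \<in> carrier A \<Longrightarrow> c \<odot> (\<ominus> x) = \<ominus> (c \<odot> x)"
  by (simp add: minus_eq_scale scale_scale)

lemma scale_diff: "x \<in> carrier A \<Longrightarrow> y \<in> carrier A \<Longrightarrow> c \<odot> (x \<ominus> y) = c \<odot> x \<ominus> c \<odot> y"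
  by (simp add: a_minus_def scale_minus scale_add_right)

lemma norm_zero [simp]: "nrm A \<zero> = 0"
  by (simp add: norm_eq_0)

lemma norm_minus [simp]: "x \<in> carrier A \<Longrightarrow> nrm A (\<ominus> x) = nrm A x"
  by (simp add: minus_eq_scale norm_scale)

lemma norm_diff_commute: "x \<in> carrier A \<Longrightarrow> y \<in> carrier A \<Longrightarrow> nrm A (x \<ominus> y) = nrm A (y \<ominus> x)"
proof -
  assume xy: "x \<in> carrier A" "y \<in> carrier A"
  then have "x \<ominus> y = \<ominus> (y \<ominus> x)" by algebra
  then show ?thesis using xy by simp
qed

lemma norm_diff_triangle:
  assumes "x \<in> carrier A" "y \<in> carrier A" "z \<in> carrier A"
  shows "nrm A (x \<ominus> z) \<le> nrm A (x \<ominus> y) + nrm A (y \<ominus> z)"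
proof -
  have "x \<ominus> z = (x \<ominus> y) \<oplus> (y \<ominus> z)" using assms by algebra
  then show ?thesis using assms by (simp add: norm_triangle)
qed

lemma norm_diff_le: "x \<in> carrier A \<Longrightarrow> y \<in> carrier A \<Longrightarrow> nrm A (x \<ominus> y) \<le> nrm A x + nrm A y"
  using norm_triangle[of x "\<ominus> y"] by (simp add: a_minus_def)

lemma star_zero [simp]: "adj A \<zero> = \<zero>"
  using star_scale[of \<zero> 0] by simp

lemma star_minus: "x \<in> carrier A \<Longrightarrow> adj A (\<ominus> x) = \<ominus> (adj A x)"
  by (simp add: minus_eq_scale star_scale)

lemma star_diff: "x \<in> carrier A \<Longrightarrow> y \<in> carrier A \<Longrightarrow> adj A (x \<ominus> y) = adj A x \<ominus> adj A y"
  by (simp add: a_minus_def star_minus star_add)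

lemma star_one [simp]: "adj A \<one> = \<one>"
  by (metis l_one one_closed star_closed star_mult star_star)

lemma diff_eq_zero: "x \<in> carrier A \<Longrightarrow> y \<in> carrier A \<Longrightarrow> x \<ominus> y = \<zero> \<longleftrightarrow> x = y"
  by simp

sublocale metric: Metric_space "carrier A" "ndist A"
  by unfold_locales
    (auto simp: ndist_def norm_diff_commute norm_eq_0 norm_diff_triangle)

lemma closure_iff:
  assumes "V \<subseteq> carrier A"
  shows "x \<in> ntop A closure_of V \<longleftrightarrow> x \<in> carrier A \<and> (\<forall>e>0. \<exists>y\<in>V. nrm A (x \<ominus> y) < e)"
  using assms by (auto simp: metric.metric_closure_of metric.in_mball ndist_def subset_iff)

lemma closedin_iff:
  "closedin (ntop A) V \<longleftrightarrow> V \<subseteq> carrier A \<and>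
     (\<forall>x\<in>carrier A. (\<forall>e>0. \<exists>y\<in>V. nrm A (x \<ominus> y) < e) \<longrightarrow> x \<in> V)"
proof (cases "V \<subseteq> carrier A")
  case True
  then have "closedin (ntop A) V \<longleftrightarrow> ntop A closure_of V \<subseteq> V"
    by (metis closure_of_subset_eq metric.topspace_mtopology)
  then show ?thesis using True closure_iff[OF True] by blast
next
  case False
  then show ?thesis using closedin_subset[of "ntop A" V] by auto
qed

lemma limitin_iff:
  "limitin (ntop A) f l F \<longleftrightarrow> l \<in> carrier A \<and> (\<forall>e>0. \<forall>\<^sub>F x in F. f x \<in> carrier A \<and> nrm A (f x \<ominus> l) < e)"
proof -
  have "(f x \<in> carrier A \<and> ndist A (f x) l < e) \<longleftrightarrow> (f x \<in> carrier A \<and> nrm A (f x \<ominus> l) < e)"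
    if "l \<in> carrier A" for x e
    using that by (auto simp: ndist_def)
  then show ?thesis unfolding metric.limitin_metric by (simp cong: conj_cong)
qed

end

section \<open>Bounded functionals and monomials in a generating set\<close>

definition lin_fun :: "'a cstar \<Rightarrow> ('a \<Rightarrow> complex) \<Rightarrow> bool" where
  "lin_fun A \<phi> \<longleftrightarrow> (\<forall>x\<in>carrier A. \<forall>y\<in>carrier A. \<phi> (x \<oplus>\<^bsub>A\<^esub> y) = \<phi> x + \<phi> y) \<and>
     (\<forall>c. \<forall>x\<in>carrier A. \<phi> (c \<odot>\<^bsub>A\<^esub> x) = c * \<phi> x)"

text \<open>The bound \<open>K\<close> carries no sign condition, so estimates that enlarge the norm
  pass through its absolute value.\<close>

definition bdd_fun :: "'a cstar \<Rightarrow> real \<Rightarrow> ('a \<Rightarrow> complex) \<Rightarrow> bool" where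
  "bdd_fun A K \<phi> \<longleftrightarrow> lin_fun A \<phi> \<and> (\<forall>x\<in>carrier A. cmod (\<phi> x) \<le> K * nrm A x)"

text \<open>Words in the elements of \<open>X\<close> and their adjoints, right-nested and ending in
  the unit, so that an induction peels off the leftmost letter.\<close>

inductive_set mon :: "'a cstar \<Rightarrow> 'a set \<Rightarrow> 'a set" for A X where
  one: "\<one>\<^bsub>A\<^esub> \<in> mon A X"
| gen: "x \<in> X \<Longrightarrow> m \<in> mon A X \<Longrightarrow> x \<otimes>\<^bsub>A\<^esub> m \<in> mon A X"
| star: "x \<in> X \<Longrightarrow> m \<in> mon A X \<Longrightarrow> adj A x \<otimes>\<^bsub>A\<^esub> m \<in> mon A X"

context nstar_algebra
begin

lemma lin_fun_add: "lin_fun A \<phi> \<Longrightarrow> x \<in> carrier A \<Longrightarrow> y \<in> carrier A \<Longrightarrow> \<phi> (x \<oplus> y) = \<phi> x + \<phi> y"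
  by (simp add: lin_fun_def)

lemma lin_fun_scale: "lin_fun A \<phi> \<Longrightarrow> x \<in> carrier A \<Longrightarrow> \<phi> (c \<odot> x) = c * \<phi> x"
  by (simp add: lin_fun_def)

lemma lin_fun_zero: "lin_fun A \<phi> \<Longrightarrow> \<phi> \<zero> = 0"
  using lin_fun_scale[of \<phi> \<zero> 0] by simp

lemma lin_fun_minus: "lin_fun A \<phi> \<Longrightarrow> x \<in> carrier A \<Longrightarrow> \<phi> (\<ominus> x) = - \<phi> x"
  by (simp add: minus_eq_scale lin_fun_scale)

lemma lin_fun_diff: "lin_fun A \<phi> \<Longrightarrow> x \<in> carrier A \<Longrightarrow> y \<in> carrier A \<Longrightarrow> \<phi> (x \<ominus> y) = \<phi> x - \<phi> y"
  by (simp add: a_minus_def lin_fun_minus lin_fun_add)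

lemma lin_fun_finsum:
  assumes "lin_fun A \<phi>" "finite I" "f \<in> I \<rightarrow> carrier A"
  shows "\<phi> (\<Oplus>i\<in>I. f i) = (\<Sum>i\<in>I. \<phi> (f i))"
  using assms(2,3) by (induction I rule: finite_induct) (auto simp: assms(1) lin_fun_zero lin_fun_add)

lemma lin_fun_translate:
  assumes "lin_fun A \<phi>" "a \<in> carrier A" "b \<in> carrier A"
  shows "lin_fun A (\<lambda>x. \<phi> (a \<otimes> x \<otimes> b))"
  using assms unfolding lin_fun_def
  by (auto simp: l_distr r_distr scale_mult_left scale_mult_right)

lemma bdd_fun_lin: "bdd_fun A K \<phi> \<Longrightarrow> lin_fun A \<phi>"
  by (simp add: bdd_fun_def)

lemma bdd_fun_left:
  assumes "bdd_fun A K \<phi>" "a \<in> carrier A"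
  shows "bdd_fun A (\<bar>K\<bar> * nrm A a) (\<lambda>x. \<phi> (a \<otimes> x))"
proof -
  have "cmod (\<phi> (a \<otimes> x)) \<le> \<bar>K\<bar> * nrm A a * nrm A x" if "x \<in> carrier A" for x
  proof -
    have "cmod (\<phi> (a \<otimes> x)) \<le> K * nrm A (a \<otimes> x)" using assms that by (simp add: bdd_fun_def)
    also have "\<dots> \<le> \<bar>K\<bar> * nrm A (a \<otimes> x)" using assms that by (intro mult_right_mono) auto
    also have "\<dots> \<le> \<bar>K\<bar> * (nrm A a * nrm A x)" using assms that by (intro mult_left_mono norm_mult_le) auto
    finally show ?thesis by (simp add: mult.assoc)
  qed
  moreover have "lin_fun A (\<lambda>x. \<phi> (a \<otimes> x))"
    using assms unfolding lin_fun_def bdd_fun_def by (auto simp: r_distr scale_mult_right)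
  ultimately show ?thesis by (simp add: bdd_fun_def)
qed

lemma bdd_fun_right:
  assumes "bdd_fun A K \<phi>" "a \<in> carrier A"
  shows "bdd_fun A (\<bar>K\<bar> * nrm A a) (\<lambda>x. \<phi> (x \<otimes> a))"
proof -
  have "cmod (\<phi> (x \<otimes> a)) \<le> \<bar>K\<bar> * nrm A a * nrm A x" if "x \<in> carrier A" for x
  proof -
    have "cmod (\<phi> (x \<otimes> a)) \<le> K * nrm A (x \<otimes> a)" using assms that by (simp add: bdd_fun_def)
    also have "\<dots> \<le> \<bar>K\<bar> * nrm A (x \<otimes> a)" using assms that by (intro mult_right_mono) auto
    also have "\<dots> \<le> \<bar>K\<bar> * (nrm A x * nrm A a)" using assms that by (intro mult_left_mono norm_mult_le) auto
    finally show ?thesis by (simp add: mult_ac)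
  qed
  moreover have "lin_fun A (\<lambda>x. \<phi> (x \<otimes> a))"
    using assms unfolding lin_fun_def bdd_fun_def by (auto simp: l_distr scale_mult_left)
  ultimately show ?thesis by (simp add: bdd_fun_def)
qed

lemma linear_subspace_span: "S \<subseteq> carrier A \<Longrightarrow> linear_subspace A (linear_span A S)"
proof -
  assume S: "S \<subseteq> carrier A"
  have "linear_subspace A (carrier A)" by (auto simp: linear_subspace_def)
  with S show ?thesis unfolding linear_span_def linear_subspace_def by auto
qed

lemma span_superset: "S \<subseteq> linear_span A S"
  by (auto simp: linear_span_def)

lemma span_minimal: "linear_subspace A V \<Longrightarrow> S \<subseteq> V \<Longrightarrow> linear_span A S \<subseteq> V"
  by (auto simp: linear_span_def)

lemma span_carrier: "S \<subseteq> carrier A \<Longrightarrow> linear_span A S \<subseteq> carrier A"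
  using linear_subspace_span by (auto simp: linear_subspace_def)

lemma mon_closed: "X \<subseteq> carrier A \<Longrightarrow> mon A X \<subseteq> carrier A"
proof
  fix m assume "X \<subseteq> carrier A" "m \<in> mon A X"
  from this(2,1) show "m \<in> carrier A" by induction auto
qed

lemma mon_mult:
  assumes "X \<subseteq> carrier A" "m \<in> mon A X" "n \<in> mon A X"
  shows "m \<otimes> n \<in> mon A X"
  using assms(2,1,3)
proof (induction m rule: mon.induct)
  case one
  then show ?case using mon_closed by (metis l_one subsetD)
next
  case (gen x m)
  then have "x \<otimes> m \<otimes> n = x \<otimes> (m \<otimes> n)" using mon_closed[of X] by (intro m_assoc) auto
  with gen show ?case by (auto intro: mon.gen)
next
  case (star x m)
  then have "adj A x \<otimes> m \<otimes> n = adj A x \<otimes> (m \<otimes> n)" using mon_closed[of X] by (intro m_assoc) auto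
  with star show ?case by (auto intro: mon.star)
qed

lemma mon_gen: "X \<subseteq> carrier A \<Longrightarrow> x \<in> X \<Longrightarrow> x \<in> mon A X"
  using mon.gen[OF _ mon.one, of x X A] by auto

lemma mon_gen_star: "X \<subseteq> carrier A \<Longrightarrow> x \<in> X \<Longrightarrow> adj A x \<in> mon A X"
  using mon.star[OF _ mon.one, of x X A] by auto

lemma mon_star:
  assumes "X \<subseteq> carrier A" "m \<in> mon A X"
  shows "adj A m \<in> mon A X"
  using assms(2,1)
proof (induction m rule: mon.induct)
  case one
  then show ?case by (simp add: mon.one)
next
  case (gen x m)
  then have "adj A (x \<otimes> m) = adj A m \<otimes> adj A x" using mon_closed[of X] by (intro star_mult) auto
  with gen show ?case by (simp add: mon_mult mon_gen_star)
next
  case (star x m)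
  then have "adj A (adj A x \<otimes> m) = adj A m \<otimes> x" using mon_closed[of X] by (subst star_mult) auto
  with star show ?case by (simp add: mon_mult mon_gen)
qed

text \<open>Bilinear extension in two rounds: with one factor fixed, the elements whose product
  stays in the span form a subspace, and the span lies in it as soon as the monomials do.\<close>

lemma span_mon_mult:
  assumes X: "X \<subseteq> carrier A" and x: "x \<in> linear_span A (mon A X)" and y: "y \<in> linear_span A (mon A X)"
  shows "x \<otimes> y \<in> linear_span A (mon A X)"
proof -
  let ?L = "linear_span A (mon A X)"
  have L: "linear_subspace A ?L" using X by (intro linear_subspace_span mon_closed)
  have Lc: "?L \<subseteq> carrier A" using L by (simp add: linear_subspace_def)
  have mc: "mon A X \<subseteq> carrier A" using X by (rule mon_closed)
  have 1: "m \<otimes> y \<in> ?L" if m: "m \<in> mon A X" and y: "y \<in> ?L" for m y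
  proof -
    let ?V = "{y \<in> carrier A. m \<otimes> y \<in> ?L}"
    have "linear_subspace A ?V"
      using L m mc unfolding linear_subspace_def by (auto simp: r_distr scale_mult_right subset_iff)
    moreover have "mon A X \<subseteq> ?V"
      using m mc mon_mult[OF X m] span_superset[of "mon A X"] by blast
    ultimately show ?thesis using y span_minimal by blast
  qed
  let ?V = "{x \<in> carrier A. x \<otimes> y \<in> ?L}"
  have "linear_subspace A ?V"
    using L y Lc unfolding linear_subspace_def by (auto simp: l_distr scale_mult_left subset_iff)
  moreover have "mon A X \<subseteq> ?V" using 1 mc y by blast
  ultimately show ?thesis using x span_minimal by blast
qed

lemma span_mon_star:
  assumes X: "X \<subseteq> carrier A" and x: "x \<in> linear_span A (mon A X)"
  shows "adj A x \<in> linear_span A (mon A X)"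
proof -
  let ?L = "linear_span A (mon A X)"
  have L: "linear_subspace A ?L" using X by (intro linear_subspace_span mon_closed)
  let ?V = "{x \<in> carrier A. adj A x \<in> ?L}"
  have "linear_subspace A ?V"
    using L unfolding linear_subspace_def by (auto simp: star_add star_scale)
  moreover have "mon A X \<subseteq> ?V"
    using mon_star[OF X] mon_closed[OF X] span_superset[of "mon A X"] by blast
  ultimately show ?thesis using x span_minimal by blast
qed

text \<open>The closure of the span of the monomials is a closed unital star-subalgebra that
  contains \<open>X\<close>, so \<open>generates\<close> forces it to be the whole carrier. Most of
  the proof is continuity of the operations, phrased as closure of \<open>C\<close> under
  them.\<close>

lemma generates_dense:
  assumes "generates A X" and x: "x \<in> carrier A" and e: "e > 0"
  shows "\<exists>y\<in>linear_span A (mon A X). nrm A (x \<ominus> y) < e"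
proof -
  let ?L = "linear_span A (mon A X)"
  have X: "X \<subseteq> carrier A" using assms by (simp add: generates_def)
  have L: "linear_subspace A ?L" using X by (intro linear_subspace_span mon_closed)
  have Lc: "?L \<subseteq> carrier A" using L by (simp add: linear_subspace_def)
  note Lc' = subsetD[OF Lc]
  define C where "C = ntop A closure_of ?L"
  have C: "x \<in> C \<longleftrightarrow> x \<in> carrier A \<and> (\<forall>e>0. \<exists>y\<in>?L. nrm A (x \<ominus> y) < e)" for x
    unfolding C_def using Lc by (rule closure_iff)
  have LC: "?L \<subseteq> C"
  proof
    fix x assume "x \<in> ?L"
    then have "nrm A (x \<ominus> x) < e" if "e > 0" for e using that Lc' by (simp add: r_neg a_minus_def)
    with \<open>x \<in> ?L\<close> show "x \<in> C" using Lc' unfolding C by blast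
  qed
  have addC: "x \<oplus> y \<in> C" if "x \<in> C" "y \<in> C" for x y
  proof -
    have xy: "x \<in> carrier A" "y \<in> carrier A" using that C by auto
    have "\<exists>z\<in>?L. nrm A (x \<oplus> y \<ominus> z) < e" if "e > 0" for e
    proof -
      obtain x' y' where *: "x' \<in> ?L" "nrm A (x \<ominus> x') < e/2" "y' \<in> ?L" "nrm A (y \<ominus> y') < e/2"
        using \<open>x \<in> C\<close> \<open>y \<in> C\<close> C \<open>e > 0\<close> by (meson half_gt_zero)
      have "x \<oplus> y \<ominus> (x' \<oplus> y') = (x \<ominus> x') \<oplus> (y \<ominus> y')"
        using xy * Lc' by (simp add: a_minus_def minus_add a_ac)
      then have "nrm A (x \<oplus> y \<ominus> (x' \<oplus> y')) < e"
        using norm_triangle[of "x \<ominus> x'" "y \<ominus> y'"] xy * Lc' by fastforce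
      moreover have "x' \<oplus> y' \<in> ?L" using * L by (simp add: linear_subspace_def)
      ultimately show ?thesis by blast
    qed
    then show ?thesis using xy C by blast
  qed
  have scaleC: "c \<odot> x \<in> C" if "x \<in> C" for c x
  proof -
    have x: "x \<in> carrier A" using that C by auto
    have "\<exists>z\<in>?L. nrm A (c \<odot> x \<ominus> z) < e" if "e > 0" for e
    proof -
      obtain x' where *: "x' \<in> ?L" "nrm A (x \<ominus> x') < e / (cmod c + 1)"
        using \<open>x \<in> C\<close> C \<open>e > 0\<close> by (metis add_nonneg_pos divide_pos_pos norm_ge_zero zero_less_one)
      have "nrm A (c \<odot> x \<ominus> c \<odot> x') = cmod c * nrm A (x \<ominus> x')"
        using x * Lc' by (simp flip: scale_diff add: norm_scale)
      also have "\<dots> \<le> (cmod c + 1) * nrm A (x \<ominus> x')" using x * Lc' by (intro mult_right_mono) auto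
      also have "\<dots> < e" using *(2) by (simp add: less_divide_eq mult.commute add_nonneg_pos)
      finally show ?thesis using * L by (auto simp: linear_subspace_def)
    qed
    then show ?thesis using x C by blast
  qed
  have starC: "adj A x \<in> C" if "x \<in> C" for x
  proof -
    have x: "x \<in> carrier A" using that C by auto
    have "\<exists>z\<in>?L. nrm A (adj A x \<ominus> z) < e" if "e > 0" for e
    proof -
      obtain x' where *: "x' \<in> ?L" "nrm A (x \<ominus> x') < e"
        using \<open>x \<in> C\<close> C \<open>e > 0\<close> by blast
      have "nrm A (adj A x \<ominus> adj A x') < e"
        using x * Lc' by (simp flip: star_diff)
      then show ?thesis using * span_mon_star[OF X] by blast
    qed
    then show ?thesis using x C by blast
  qed
  have multC: "x \<otimes> y \<in> C" if "x \<in> C" "y \<in> C" for x y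
  proof -
    have xy: "x \<in> carrier A" "y \<in> carrier A" using that C by auto
    have "\<exists>z\<in>?L. nrm A (x \<otimes> y \<ominus> z) < e" if "e > 0" for e
    proof -
      \<comment> \<open>The tolerance for \<open>x'\<close> depends on \<open>y'\<close>, so
        \<open>y'\<close> has to be chosen first; the summand 1 keeps the denominators
        positive.\<close>
      have "e / (2 * (nrm A x + 1)) > 0" using \<open>e > 0\<close> xy by (simp add: add_nonneg_pos)
      then obtain y' where y': "y' \<in> ?L" "nrm A (y \<ominus> y') < e / (2 * (nrm A x + 1))"
        using \<open>y \<in> C\<close> C by blast
      have "e / (2 * (nrm A y' + 1)) > 0" using \<open>e > 0\<close> y' Lc' by (simp add: add_nonneg_pos)
      then obtain x' where x': "x' \<in> ?L" "nrm A (x \<ominus> x') < e / (2 * (nrm A y' + 1))"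
        using \<open>x \<in> C\<close> C by blast
      have c: "x' \<in> carrier A" "y' \<in> carrier A" using x' y' Lc' by auto
      have pos: "nrm A x + 1 > 0" "nrm A y' + 1 > 0" using c xy by (simp_all add: add_nonneg_pos)
      have "nrm A (x \<otimes> (y \<ominus> y')) \<le> nrm A x * nrm A (y \<ominus> y')" using xy c by (simp add: norm_mult_le)
      also have "\<dots> \<le> (nrm A x + 1) * nrm A (y \<ominus> y')" using xy c by (intro mult_right_mono) auto
      also have "\<dots> < e / 2" using y'(2) pos(1) by (simp add: field_simps)
      finally have 1: "nrm A (x \<otimes> (y \<ominus> y')) < e / 2" .
      have "nrm A ((x \<ominus> x') \<otimes> y') \<le> nrm A (x \<ominus> x') * nrm A y'" using xy c by (simp add: norm_mult_le)
      also have "\<dots> \<le> nrm A (x \<ominus> x') * (nrm A y' + 1)" using xy c by (intro mult_left_mono) auto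
      also have "\<dots> < e / 2" using x'(2) pos(2) by (simp add: field_simps)
      finally have 2: "nrm A ((x \<ominus> x') \<otimes> y') < e / 2" .
      have "x \<otimes> y \<ominus> x' \<otimes> y' = x \<otimes> (y \<ominus> y') \<oplus> (x \<ominus> x') \<otimes> y'"
        using xy c by algebra
      then have "nrm A (x \<otimes> y \<ominus> x' \<otimes> y') < e"
        using norm_triangle[of "x \<otimes> (y \<ominus> y')" "(x \<ominus> x') \<otimes> y'"] 1 2 xy c by fastforce
      then show ?thesis using span_mon_mult[OF X x'(1) y'(1)] by blast
    qed
    then show ?thesis using xy C by blast
  qed
  have "subring C A"
  proof (rule subringI)
    show "C \<subseteq> carrier A" using C by blast
    show "\<one> \<in> C" using LC span_superset[of "mon A X"] mon.one[of A X] by blast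
    show "\<ominus> h \<in> C" if "h \<in> C" for h using scaleC[OF that, of "-1"] that C by (simp add: minus_eq_scale)
  qed (auto intro: addC multC)
  moreover have "closedin (ntop A) C" by (simp add: C_def)
  moreover have "X \<subseteq> C" using LC span_superset[of "mon A X"] mon_gen[OF X] by blast
  ultimately have "C = carrier A"
    using assms(1) scaleC starC unfolding generates_def by blast
  then show ?thesis using x e C by blast
qed

text \<open>Induction along a generating set: for a property that is linear and stable under norm
  limits it suffices to check monomials.\<close>

lemma generates_induct:
  assumes "generates A X" and V: "linear_subspace A V" and M: "mon A X \<subseteq> V"
    and cl: "\<And>x. x \<in> carrier A \<Longrightarrow> (\<And>e. e > 0 \<Longrightarrow> \<exists>y\<in>V. nrm A (x \<ominus> y) < e) \<Longrightarrow> x \<in> V"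
    and x: "x \<in> carrier A"
  shows "x \<in> V"
proof (rule cl[OF x])
  fix e :: real assume "e > 0"
  then show "\<exists>y\<in>V. nrm A (x \<ominus> y) < e"
    using generates_dense[OF assms(1) x] span_minimal[OF V M] by blast
qed

lemma bdd_fun_approx:
  assumes "bdd_fun A K \<phi>" "x \<in> carrier A" "y \<in> carrier A" "nrm A (x \<ominus> y) < e"
  shows "cmod (\<phi> x - \<phi> y) \<le> \<bar>K\<bar> * e"
proof -
  have "cmod (\<phi> x - \<phi> y) = cmod (\<phi> (x \<ominus> y))"
    using assms by (simp add: lin_fun_diff bdd_fun_lin)
  also have "\<dots> \<le> K * nrm A (x \<ominus> y)" using assms by (simp add: bdd_fun_def)
  also have "\<dots> \<le> \<bar>K\<bar> * nrm A (x \<ominus> y)" using assms by (intro mult_right_mono) auto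
  also have "\<dots> \<le> \<bar>K\<bar> * e" using assms by (intro mult_left_mono) auto
  finally show ?thesis .
qed

lemma bdd_fun_eq_closure:
  assumes f: "bdd_fun A K \<phi>" and g: "bdd_fun A K' \<psi>" and x: "x \<in> carrier A"
    and d: "\<And>e. e > 0 \<Longrightarrow> \<exists>y\<in>carrier A. \<phi> y = \<psi> y \<and> nrm A (x \<ominus> y) < e"
  shows "\<phi> x = \<psi> x"
proof (rule ccontr)
  assume ne: "\<phi> x \<noteq> \<psi> x"
  \<comment> \<open>With this \<open>e\<close> the two approximation errors add up to at most half
    of the gap between the two values.\<close>
  define e where "e = cmod (\<phi> x - \<psi> x) / (2 * (\<bar>K\<bar> + \<bar>K'\<bar> + 1))"
  have "e > 0" using ne by (simp add: e_def add_nonneg_pos)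
  then obtain y where y: "y \<in> carrier A" "\<phi> y = \<psi> y" "nrm A (x \<ominus> y) < e" using d by blast
  have "cmod (\<phi> x - \<psi> x) \<le> cmod (\<phi> x - \<phi> y) + cmod (\<psi> x - \<psi> y)"
    using y(2) norm_triangle_ineq4[of "\<phi> x - \<phi> y" "\<psi> x - \<psi> y"] by simp
  also have "\<dots> \<le> \<bar>K\<bar> * e + \<bar>K'\<bar> * e"
    using bdd_fun_approx[OF f x y(1,3)] bdd_fun_approx[OF g x y(1,3)] by simp
  also have "\<dots> \<le> (\<bar>K\<bar> + \<bar>K'\<bar> + 1) * e" using \<open>e > 0\<close> by (simp add: algebra_simps)
  also have "\<dots> = cmod (\<phi> x - \<psi> x) / 2"
    unfolding e_def by (simp add: field_simps) 
  finally show False using ne by simp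
qed

lemma bdd_fun_eqI:
  assumes "generates A X" "bdd_fun A K \<phi>" "bdd_fun A K' \<psi>"
    and "\<And>m. m \<in> mon A X \<Longrightarrow> \<phi> m = \<psi> m" and x: "x \<in> carrier A"
  shows "\<phi> x = \<psi> x"
proof -
  have X: "X \<subseteq> carrier A" using assms by (simp add: generates_def)
  have "x \<in> {x \<in> carrier A. \<phi> x = \<psi> x}"
  proof (rule generates_induct[OF assms(1) _ _ _ x])
    show "linear_subspace A {x \<in> carrier A. \<phi> x = \<psi> x}"
      using assms(2,3) unfolding linear_subspace_def
      by (auto simp: lin_fun_add lin_fun_scale bdd_fun_lin lin_fun_zero)
    show "mon A X \<subseteq> {x \<in> carrier A. \<phi> x = \<psi> x}" using assms(4) mon_closed[OF X] by auto
    show "x \<in> {x \<in> carrier A. \<phi> x = \<psi> x}"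
      if "x \<in> carrier A" "\<And>e. e > 0 \<Longrightarrow> \<exists>y\<in>{x \<in> carrier A. \<phi> x = \<psi> x}. nrm A (x \<ominus> y) < e" for x
    proof -
      have "\<phi> x = \<psi> x"
        by (rule bdd_fun_eq_closure[OF assms(2,3) that(1)]) (use that(2) in blast)
      with that show ?thesis by simp
    qed
  qed
  then show ?thesis by simp
qed

end

section \<open>States of unital $C^*$-algebras\<close>

text \<open>The variant of \<open>cstate\<close> without extensionality and with positivity spelled
  out on the elements \<open>adj A y \<otimes> y\<close>, so that it is stable under composition
  with quotient maps and automorphisms.\<close>

definition state_on :: "'a cstar \<Rightarrow> ('a \<Rightarrow> complex) \<Rightarrow> bool" where
  "state_on A \<phi> \<longleftrightarrow> lin_fun A \<phi> \<and>
     (\<forall>y\<in>carrier A. \<phi> (adj A y \<otimes>\<^bsub>A\<^esub> y) \<in> \<real> \<and> 0 \<le> Re (\<phi> (adj A y \<otimes>\<^bsub>A\<^esub> y))) \<and> \<phi> \<one>\<^bsub>A\<^esub> = 1"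

lemma (in nstar_algebra) scale_half_double: "x \<in> carrier A \<Longrightarrow> (1/2) \<odot> x \<oplus> (1/2) \<odot> x = x"
  using scale_add_left[of x "1/2" "1/2"] by simp

context cstar_algebra
begin

text \<open>The square root of \<open>\<one> - h\<close> is \<open>\<one> - y\<close>, where \<open>y\<close> is the fixed point of the contraction
  \<open>y \<mapsto> (h + y\<^sup>2) / 2\<close> of the ball of radius \<open>\<parallel>h\<parallel>\<close>.\<close>

lemma ex_sqrt_one_minus:
  assumes h: "h \<in> carrier A" and sa: "adj A h = h" and r1: "nrm A h < 1"
  shows "\<exists>y\<in>carrier A. adj A y = y \<and> y \<otimes> y = \<one> \<ominus> h"
proof -
  define r where "r = nrm A h"
  have r: "0 \<le> r" "r < 1" using assms by (simp_all add: r_def)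
  define f where "f = (\<lambda>y. (1/2) \<odot> (h \<oplus> y \<otimes> y))"
  define Y where "Y = (\<lambda>n. (f ^^ n) \<zero>)"
  have Y0: "Y 0 = \<zero>" and YS: "Y (Suc n) = f (Y n)" for n by (simp_all add: Y_def)
  have fc: "f y \<in> carrier A" if "y \<in> carrier A" for y using that h by (simp add: f_def)
  have Yc [simp]: "Y n \<in> carrier A" for n by (induction n) (simp_all add: Y0 YS fc)
  have Ysa: "adj A (Y n) = Y n" for n
    by (induction n) (simp_all add: Y0 YS f_def h sa star_scale star_add star_mult)
  have Yr: "nrm A (Y n) \<le> r" for n
  proof (induction n)
    case (Suc n)
    have "nrm A (Y (Suc n)) = nrm A (h \<oplus> Y n \<otimes> Y n) / 2"
      by (simp add: YS f_def norm_scale h)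
    also have "\<dots> \<le> (r + nrm A (Y n) * nrm A (Y n)) / 2"
      using norm_triangle[of h "Y n \<otimes> Y n"] norm_mult_le[of "Y n" "Y n"] h by (simp add: r_def)
    also have "\<dots> \<le> (r + r * 1) / 2"
      using Suc r by (intro divide_right_mono add_left_mono mult_mono) auto
    finally show ?case by simp
  qed (simp add: Y0 r)
  have fdiff: "nrm A (f y \<ominus> f z) \<le> r * nrm A (y \<ominus> z)"
    if "y \<in> carrier A" "z \<in> carrier A" "nrm A y \<le> r" "nrm A z \<le> r" for y z
  proof -
    have "(h \<oplus> y \<otimes> y) \<ominus> (h \<oplus> z \<otimes> z) = y \<otimes> (y \<ominus> z) \<oplus> (y \<ominus> z) \<otimes> z"
      using that h by algebra
    then have "f y \<ominus> f z = (1/2) \<odot> (y \<otimes> (y \<ominus> z) \<oplus> (y \<ominus> z) \<otimes> z)"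
      using that h by (simp add: f_def flip: scale_diff)
    then have "nrm A (f y \<ominus> f z) = nrm A (y \<otimes> (y \<ominus> z) \<oplus> (y \<ominus> z) \<otimes> z) / 2"
      using that by (simp add: norm_scale)
    also have "\<dots> \<le> (nrm A y * nrm A (y \<ominus> z) + nrm A (y \<ominus> z) * nrm A z) / 2"
      using norm_triangle[of "y \<otimes> (y \<ominus> z)" "(y \<ominus> z) \<otimes> z"] norm_mult_le[of y "y \<ominus> z"]
        norm_mult_le[of "y \<ominus> z" z] that by simp
    also have "\<dots> \<le> (r * nrm A (y \<ominus> z) + nrm A (y \<ominus> z) * r) / 2"
      using that r by (intro divide_right_mono add_mono mult_mono) auto
    finally show ?thesis by simp
  qed
  have Yd: "nrm A (Y (n + k) \<ominus> Y n) \<le> r ^ n" for n k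
  proof (induction n)
    case 0
    have "Y k \<ominus> \<zero> = Y k" using Yc[of k] by (simp add: a_minus_def)
    then show ?case using Yr[of k] r by (simp add: Y0)
  next
    case (Suc n)
    have "nrm A (Y (Suc n + k) \<ominus> Y (Suc n)) \<le> r * nrm A (Y (n + k) \<ominus> Y n)"
      using fdiff[OF Yc Yc Yr Yr] by (simp add: YS)
    also have "\<dots> \<le> r * r ^ n" using Suc r by (intro mult_left_mono) auto
    finally show ?case by simp
  qed
  have "metric.MCauchy Y"
    unfolding metric.MCauchy_def
  proof (intro conjI allI impI)
    show "range Y \<subseteq> carrier A" by auto
    fix e :: real assume "e > 0"
    then obtain N where N: "r ^ N < e" using r real_arch_pow_inv by blast
    have "ndist A (Y n) (Y n') < e" if "N \<le> n" "N \<le> n'" "n \<le> n'" for n n'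
    proof -
      have "nrm A (Y n' \<ominus> Y n) \<le> r ^ n" using Yd[of n "n' - n"] that by simp
      also have "\<dots> \<le> r ^ N" using r that by (simp add: power_decreasing)
      finally show ?thesis using N by (simp add: ndist_def norm_diff_commute)
    qed
    then show "\<exists>N. \<forall>n n'. N \<le> n \<longrightarrow> N \<le> n' \<longrightarrow> ndist A (Y n) (Y n') < e"
      by (metis metric.commute nat_le_linear)
  qed
  then obtain y where lim: "limitin (ntop A) Y y sequentially"
    using complete by (auto simp: metric.mcomplete_def)
  then have y: "y \<in> carrier A" and ev: "\<And>e. e > 0 \<Longrightarrow> \<exists>N. \<forall>n\<ge>N. nrm A (Y n \<ominus> y) < e"
    by (auto simp: limitin_iff eventually_sequentially)
  \<comment> \<open>The factor 5 is slack that absorbs the few error terms of size \<open>e\<close>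
    in the two uses below.\<close>
  have zeroI: "x = \<zero>" if "x \<in> carrier A" "\<And>e. e > 0 \<Longrightarrow> nrm A x \<le> 5 * e" for x
  proof -
    have "nrm A x \<le> 0"
    proof (rule field_le_epsilon)
      fix e :: real assume "e > 0"
      then show "nrm A x \<le> 0 + e" using that(2)[of "e/5"] by simp
    qed
    then have "nrm A x = 0" using that(1) norm_nonneg[of x] by linarith
    then show ?thesis using that(1) by (simp add: norm_eq_0)
  qed
  have "adj A y \<ominus> y = \<zero>"
  proof (rule zeroI)
    fix e :: real assume "e > 0"
    then obtain n where n: "nrm A (Y n \<ominus> y) < e" using ev by blast
    have "nrm A (adj A y \<ominus> y) \<le> nrm A (adj A y \<ominus> Y n) + nrm A (Y n \<ominus> y)"
      using y by (intro norm_diff_triangle) auto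
    also have "nrm A (adj A y \<ominus> Y n) = nrm A (adj A (y \<ominus> Y n))"
      using y by (simp add: star_diff Ysa)
    also have "\<dots> = nrm A (Y n \<ominus> y)" using y by (simp add: norm_diff_commute)
    finally show "nrm A (adj A y \<ominus> y) \<le> 5 * e" using n \<open>e > 0\<close> by simp
  qed (use y in simp)
  then have ysa: "adj A y = y" using y by (simp add: diff_eq_zero)
  have ny: "nrm A y \<le> r"
  proof (rule field_le_epsilon)
    fix e :: real assume "e > 0"
    then obtain n where n: "nrm A (Y n \<ominus> y) < e" using ev by blast
    have "y = Y n \<ominus> (Y n \<ominus> y)" using y Yc[of n] by algebra
    then have "nrm A y \<le> nrm A (Y n) + nrm A (Y n \<ominus> y)"
      using norm_diff_le[of "Y n" "Y n \<ominus> y"] y Yc[of n] by simp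
    then show "nrm A y \<le> r + e" using Yr[of n] n by simp
  qed
  have "y \<ominus> f y = \<zero>"
  proof (rule zeroI)
    fix e :: real assume e: "e > 0"
    then obtain N where "\<forall>n\<ge>N. nrm A (Y n \<ominus> y) < e" using ev by blast
    then have n: "nrm A (Y N \<ominus> y) < e" "nrm A (Y (Suc N) \<ominus> y) < e" by auto
    have "nrm A (y \<ominus> f y) \<le> nrm A (y \<ominus> Y (Suc N)) + nrm A (Y (Suc N) \<ominus> f y)"
      using y fc by (intro norm_diff_triangle) auto
    also have "nrm A (Y (Suc N) \<ominus> f y) \<le> r * nrm A (Y N \<ominus> y)"
      unfolding YS using y by (intro fdiff Yr ny) auto
    also have "\<dots> \<le> 1 * nrm A (Y N \<ominus> y)" using y r by (intro mult_right_mono) auto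
    finally show "nrm A (y \<ominus> f y) \<le> 5 * e"
      using n y e by (simp add: norm_diff_commute)
  qed (use y fc in simp)
  then have fix': "f y = y" using y fc by (simp add: diff_eq_zero)
  have "y \<oplus> y = h \<oplus> y \<otimes> y"
  proof -
    have "y \<oplus> y = f y \<oplus> f y" by (simp add: fix')
    then show ?thesis using y h unfolding f_def by (simp add: scale_half_double)
  qed
  moreover have "(\<one> \<ominus> y) \<otimes> (\<one> \<ominus> y) = \<one> \<ominus> (y \<oplus> y) \<oplus> y \<otimes> y"
    using y by (simp add: a_minus_def l_distr r_distr r_minus l_minus minus_add a_ac)
  moreover have "\<one> \<ominus> (h \<oplus> y \<otimes> y) \<oplus> y \<otimes> y = \<one> \<ominus> h"
    using y h by algebra
  ultimately have "(\<one> \<ominus> y) \<otimes> (\<one> \<ominus> y) = \<one> \<ominus> h" by simp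
  moreover have "adj A (\<one> \<ominus> y) = \<one> \<ominus> y" using y by (simp add: star_diff ysa)
  ultimately show ?thesis using y by (intro bexI[of _ "\<one> \<ominus> y"]) auto
qed

context
  fixes \<phi> :: "'a \<Rightarrow> complex"
  assumes st: "state_on A \<phi>"
begin

lemma state_lin: "lin_fun A \<phi>"
  and state_pos: "y \<in> carrier A \<Longrightarrow> \<phi> (adj A y \<otimes> y) \<in> \<real> \<and> 0 \<le> Re (\<phi> (adj A y \<otimes> y))"
  and state_one: "\<phi> \<one> = 1"
  using st by (auto simp: state_on_def)

text \<open>By \<open>ex_sqrt_one_minus\<close> the element \<open>\<one> \<ominus> h\<close> has
  the form \<open>adj A y \<otimes> y\<close>, so \<open>1 - \<phi> h\<close> is real and
  nonnegative.\<close>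

lemma state_sa_small:
  assumes h: "h \<in> carrier A" "adj A h = h" "nrm A h < 1"
  shows "\<phi> h \<in> \<real> \<and> Re (\<phi> h) \<le> 1"
proof -
  obtain y where "y \<in> carrier A" "adj A y = y" "y \<otimes> y = \<one> \<ominus> h"
    using ex_sqrt_one_minus[OF h] by blast
  then have "\<phi> (\<one> \<ominus> h) \<in> \<real>" "0 \<le> Re (\<phi> (\<one> \<ominus> h))"
    using state_pos[of y] by auto
  moreover have "\<phi> (\<one> \<ominus> h) = 1 - \<phi> h"
    using h by (simp add: lin_fun_diff state_lin state_one)
  ultimately show ?thesis by (auto simp: complex_is_Real_iff)
qed

text \<open>Rescaling by \<open>1 / t\<close> and \<open>- 1 / t\<close> with \<open>t\<close>
  slightly above the norm reduces to \<open>state_sa_small\<close>; the two signs bound the value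
  from both sides, and \<open>t\<close> then decreases to the norm.\<close>

lemma state_sa:
  assumes h: "h \<in> carrier A" "adj A h = h"
  shows "\<phi> h \<in> \<real> \<and> cmod (\<phi> h) \<le> nrm A h"
proof -
  have *: "\<phi> h \<in> \<real> \<and> \<bar>Re (\<phi> h)\<bar> \<le> nrm A h + e" if e: "e > 0" for e
  proof -
    define t where "t = nrm A h + e"
    have t: "t > 0" "nrm A h < t" using e h norm_nonneg[of h] by (simp_all add: t_def add_nonneg_pos)
    have small: "\<phi> (complex_of_real c \<odot> h) \<in> \<real> \<and> Re (\<phi> (complex_of_real c \<odot> h)) \<le> 1"
      if c: "\<bar>c\<bar> = 1 / t" for c
    proof (rule state_sa_small)
      have "nrm A (complex_of_real c \<odot> h) = nrm A h / t" using h by (simp add: norm_scale c)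
      also have "\<dots> < 1" using t by simp
      finally show "nrm A (complex_of_real c \<odot> h) < 1" .
    qed (use h in \<open>simp_all add: star_scale\<close>)
    have lin: "\<phi> (complex_of_real c \<odot> h) = complex_of_real c * \<phi> h" for c
      using h by (simp add: lin_fun_scale state_lin)
    have abs: "\<bar>1 / t\<bar> = 1 / t" "\<bar>- 1 / t\<bar> = 1 / t" using t by simp_all
    note a = small[OF abs(1), unfolded lin] and b = small[OF abs(2), unfolded lin]
    have "Im (\<phi> h) = 0" using a t by (simp add: complex_is_Real_iff)
    then have "\<phi> h \<in> \<real>" by (simp add: complex_is_Real_iff)
    moreover have "Re (\<phi> h) / t \<le> 1" "- (Re (\<phi> h) / t) \<le> 1" using a b by auto
    then have "\<bar>Re (\<phi> h)\<bar> \<le> t" using t by (auto simp: field_simps abs_le_iff)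
    ultimately show ?thesis by (simp add: t_def)
  qed
  have real: "\<phi> h \<in> \<real>" using *[of 1] by simp
  have "\<bar>Re (\<phi> h)\<bar> \<le> nrm A h"
    by (rule field_le_epsilon) (use * in blast)
  moreover have "cmod (\<phi> h) = \<bar>Re (\<phi> h)\<bar>"
    using real by (simp add: in_Reals_norm complex_is_Real_iff cmod_eq_Re)
  ultimately show ?thesis using real by simp
qed

lemma state_decomp:
  assumes x: "x \<in> carrier A"
  obtains a b where "a \<in> carrier A" "b \<in> carrier A" "adj A a = a" "adj A b = b"
    "x = a \<oplus> \<i> \<odot> b" "nrm A a \<le> nrm A x" "nrm A b \<le> nrm A x"
proof
  let ?a = "(1/2) \<odot> (x \<oplus> adj A x)" and ?b = "(- \<i> / 2) \<odot> (x \<ominus> adj A x)"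
  show "?a \<in> carrier A" "?b \<in> carrier A" using x by auto
  show "adj A ?a = ?a" using x by (simp add: star_scale star_add a_comm)
  have "adj A x \<ominus> x = (-1) \<odot> (x \<ominus> adj A x)"
    using x by (simp add: minus_eq_scale[symmetric] a_minus_def minus_add a_comm)
  then show "adj A ?b = ?b"
    using x by (simp add: star_scale star_diff scale_scale)
  have "\<i> \<odot> ?b = (1/2) \<odot> x \<ominus> (1/2) \<odot> adj A x" using x by (simp add: scale_scale scale_diff)
  moreover have "?a = (1/2) \<odot> x \<oplus> (1/2) \<odot> adj A x" using x by (simp add: scale_add_right)
  moreover have "(u \<oplus> v) \<oplus> (u \<ominus> v) = u \<oplus> u" if "u \<in> carrier A" "v \<in> carrier A" for u v
    using that by algebra
  ultimately show "x = ?a \<oplus> \<i> \<odot> ?b" using x by (simp add: scale_half_double)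
  show "nrm A ?a \<le> nrm A x" using x norm_triangle[of x "adj A x"] by (simp add: norm_scale)
  show "nrm A ?b \<le> nrm A x" using x norm_diff_le[of x "adj A x"] by (simp add: norm_scale)
qed

text \<open>The constant 2 comes from bounding the real and the imaginary part of \<open>x\<close>
  separately.\<close>

lemma state_bdd: "bdd_fun A 2 \<phi>"
  unfolding bdd_fun_def
proof (intro conjI ballI state_lin)
  fix x assume "x \<in> carrier A"
  then obtain a b where ab: "a \<in> carrier A" "b \<in> carrier A" "adj A a = a" "adj A b = b"
    "x = a \<oplus> \<i> \<odot> b" "nrm A a \<le> nrm A x" "nrm A b \<le> nrm A x" by (rule state_decomp)
  have "\<phi> x = \<phi> a + \<i> * \<phi> b" using ab by (simp add: lin_fun_add lin_fun_scale state_lin)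
  then have "cmod (\<phi> x) \<le> cmod (\<phi> a) + cmod (\<phi> b)"
    using norm_triangle_ineq[of "\<phi> a" "\<i> * \<phi> b"] by (simp add: norm_mult)
  then show "cmod (\<phi> x) \<le> 2 * nrm A x"
    using state_sa[of a] state_sa[of b] ab by simp
qed

lemma state_star:
  assumes "x \<in> carrier A" shows "\<phi> (adj A x) = cnj (\<phi> x)"
proof -
  obtain a b where ab: "a \<in> carrier A" "b \<in> carrier A" "adj A a = a" "adj A b = b"
    "x = a \<oplus> \<i> \<odot> b" using assms by (rule state_decomp)
  have "\<phi> a \<in> \<real>" "\<phi> b \<in> \<real>" using state_sa ab by auto
  then have "cnj (\<phi> a) = \<phi> a" "cnj (\<phi> b) = \<phi> b" by (simp_all add: Reals_cnj_iff)
  then show ?thesis using ab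
    by (simp add: star_add star_scale lin_fun_add lin_fun_scale state_lin)
qed

text \<open>Cauchy-Schwarz for a null vector \<open>x\<close>: the positive value on
  \<open>y \<oplus> z \<odot> x\<close> has no quadratic term in \<open>z\<close>, and a real-affine
  function of \<open>z\<close> that is bounded below on the complex plane is constant.\<close>

lemma state_null_right:
  assumes x: "x \<in> carrier A" and null: "\<phi> (adj A x \<otimes> x) = 0" and c: "c \<in> carrier A"
  shows "\<phi> (c \<otimes> x) = 0"
proof (rule ccontr)
  assume ne: "\<phi> (c \<otimes> x) \<noteq> 0"
  define y where "y = adj A c"
  define w where "w = \<phi> (c \<otimes> x)"
  have y: "y \<in> carrier A" "adj A y = c" using c by (simp_all add: y_def)
  have ineq: "0 \<le> Re (\<phi> (adj A y \<otimes> y)) + 2 * Re (z * w)" for z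
  proof -
    have "adj A (y \<oplus> z \<odot> x) \<otimes> (y \<oplus> z \<odot> x)
        = (c \<otimes> y \<oplus> z \<odot> (c \<otimes> x)) \<oplus> (cnj z \<odot> (adj A x \<otimes> y) \<oplus> (cnj z * z) \<odot> (adj A x \<otimes> x))"
      using x y c by (simp add: star_add star_scale l_distr r_distr scale_mult_left scale_mult_right
        scale_scale scale_add_right a_ac mult.commute)
    moreover have "adj A x \<otimes> y = adj A (c \<otimes> x)" using x c by (simp add: y_def star_mult)
    then have "\<phi> (adj A x \<otimes> y) = cnj w" using x c by (simp add: state_star w_def)
    ultimately have "\<phi> (adj A (y \<oplus> z \<odot> x) \<otimes> (y \<oplus> z \<odot> x)) = \<phi> (c \<otimes> y) + z * w + cnj z * cnj w"
      using x y c null by (simp add: lin_fun_add lin_fun_scale state_lin w_def)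
    moreover have "0 \<le> Re (\<phi> (adj A (y \<oplus> z \<odot> x) \<otimes> (y \<oplus> z \<odot> x)))"
      using x y state_pos by simp
    ultimately show ?thesis using y by (simp add: mult.commute)
  qed
  define M where "M = Re (\<phi> (adj A y \<otimes> y))"
  have w: "w \<noteq> 0" using ne by (simp add: w_def)
  \<comment> \<open>Taking \<open>- (M + 1) / w\<close> for \<open>z\<close> makes the lower bound
    equal to \<open>M - 2 * (M + 1)\<close>, which is negative since \<open>M\<close> is
    nonnegative.\<close>
  have "Re (- complex_of_real (M + 1) / w * w) = - (M + 1)" using w by simp
  then have "0 \<le> M - 2 * (M + 1)" using ineq[of "- complex_of_real (M + 1) / w"] by (simp add: M_def)
  moreover have "0 \<le> M" unfolding M_def using state_pos[OF y(1)] by simp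
  ultimately show False by simp
qed

end

end

section \<open>Quotients by closed ideals\<close>

text \<open>Self-adjointness of the ideal is an assumption here;
  \<open>closed_ideal_star_quot\<close> supplies it for closed ideals generated by self-adjoint
  elements.\<close>

locale star_quot = nstar_algebra A + ideal J A for A :: "'a cstar" (structure) and J +
  assumes J_closed: "closedin (ntop A) J"
    and J_star: "x \<in> J \<Longrightarrow> adj A x \<in> J"
begin

abbreviation Q :: "'a set cstar" where "Q \<equiv> cstar_quot A J"

abbreviation q :: "'a \<Rightarrow> 'a set" where "q x \<equiv> J +> x"

lemma J_scale: "x \<in> J \<Longrightarrow> c \<odot> x \<in> J"
  using I_l_closed[of x "c \<odot> \<one>"] Icarr[of x] by (simp add: scale_mult_left)

lemma in_coset_iff: "x \<in> carrier A \<Longrightarrow> y \<in> q x \<longleftrightarrow> y \<in> carrier A \<and> y \<ominus> x \<in> J"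
proof
  assume x: "x \<in> carrier A" and "y \<in> q x"
  then obtain j where j: "j \<in> J" "y = j \<oplus> x" by (auto simp: a_r_coset_def')
  moreover have "j \<oplus> x \<ominus> x = j" using x Icarr[OF j(1)] by algebra
  ultimately show "y \<in> carrier A \<and> y \<ominus> x \<in> J" using x Icarr by auto
next
  assume x: "x \<in> carrier A" and y: "y \<in> carrier A \<and> y \<ominus> x \<in> J"
  then have "y = (y \<ominus> x) \<oplus> x" by algebra
  with y show "y \<in> q x" by (auto simp: a_r_coset_def')
qed

lemma q_eq_iff: "x \<in> carrier A \<Longrightarrow> y \<in> carrier A \<Longrightarrow> q x = q y \<longleftrightarrow> x \<ominus> y \<in> J"
  by (metis a_rcos_self a_repr_independence' in_coset_iff)

lemma in_coset_iff_q: "x \<in> carrier A \<Longrightarrow> y \<in> q x \<longleftrightarrow> y \<in> carrier A \<and> q y = q x"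
  by (metis in_coset_iff q_eq_iff)

lemma Q_carrier: "carrier Q = q ` carrier A"
  by (auto simp: cstar_quot_def FactRing_simps)

lemma Q_cases:
  assumes "x \<in> carrier Q"
  obtains a where "a \<in> carrier A" "x = q a"
  using assms by (auto simp: Q_carrier)

lemma q_closed [simp]: "x \<in> carrier A \<Longrightarrow> q x \<in> carrier Q"
  by (simp add: Q_carrier)

lemma q_mult: "x \<in> carrier A \<Longrightarrow> y \<in> carrier A \<Longrightarrow> q x \<otimes>\<^bsub>Q\<^esub> q y = q (x \<otimes> y)"
  by (simp add: cstar_quot_def FactRing_def rcoset_mult_add)

lemma q_add: "x \<in> carrier A \<Longrightarrow> y \<in> carrier A \<Longrightarrow> q x \<oplus>\<^bsub>Q\<^esub> q y = q (x \<oplus> y)"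
  by (simp add: cstar_quot_def FactRing_def a_rcos_sum)

lemma q_one: "\<one>\<^bsub>Q\<^esub> = q \<one>"
  by (simp add: cstar_quot_def FactRing_def)

lemma q_zero: "\<zero>\<^bsub>Q\<^esub> = q \<zero>"
  by (simp add: cstar_quot_def FactRing_def a_rcos_zero ideal_axioms)

text \<open>All representatives lead to the same coset, so the union over the coset in the
  definition of the quotient collapses to one term.\<close>

lemma q_scale: "x \<in> carrier A \<Longrightarrow> c \<odot>\<^bsub>Q\<^esub> q x = q (c \<odot> x)"
proof -
  assume x: "x \<in> carrier A"
  have "q (c \<odot> y) = q (c \<odot> x)" if "y \<in> q x" for y
    using that x J_scale[of "y \<ominus> x" c] by (simp add: in_coset_iff q_eq_iff scale_diff)
  then have "(\<Union>y\<in>q x. q (c \<odot> y)) = (\<Union>y\<in>q x. q (c \<odot> x))" by auto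
  then show ?thesis using a_rcos_self[OF x] by (auto simp: cstar_quot_def)
qed

lemma q_star: "x \<in> carrier A \<Longrightarrow> adj Q (q x) = q (adj A x)"
proof -
  assume x: "x \<in> carrier A"
  have "q (adj A y) = q (adj A x)" if "y \<in> q x" for y
    using that x J_star[of "y \<ominus> x"] by (simp add: in_coset_iff q_eq_iff star_diff)
  then have "(\<Union>y\<in>q x. q (adj A y)) = (\<Union>y\<in>q x. q (adj A x))" by auto
  then show ?thesis using a_rcos_self[OF x] by (auto simp: cstar_quot_def)
qed

lemma q_norm_le:
  assumes "x \<in> carrier A" "y \<in> carrier A" "q y = q x"
  shows "nrm Q (q x) \<le> nrm A y"
proof -
  have "bdd_below (nrm A ` q x)"
    by (rule bdd_belowI2[of _ 0]) (use assms in \<open>auto simp: in_coset_iff\<close>)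
  moreover have "y \<in> q x" using assms by (simp add: in_coset_iff_q)
  ultimately have "(INF z\<in>q x. nrm A z) \<le> nrm A y" by (rule cINF_lower)
  then show ?thesis by (simp add: cstar_quot_def)
qed

lemma q_norm_ex:
  assumes "x \<in> carrier A" "nrm Q (q x) < e"
  shows "\<exists>y\<in>carrier A. q y = q x \<and> nrm A y < e"
proof -
  have "q x \<noteq> {}" using a_rcos_self[OF assms(1)] by auto
  then obtain z where "z \<in> nrm A ` q x" "z < e"
    using assms cInf_lessD[of "nrm A ` q x" e] by (auto simp: cstar_quot_def)
  then show ?thesis using in_coset_iff_q[OF assms(1)] by auto
qed

lemma Q_norm_cases:
  assumes "x \<in> carrier Q" "nrm Q x < e"
  obtains a where "a \<in> carrier A" "x = q a" "nrm A a < e"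
  using assms by (metis Q_cases q_norm_ex)

lemma Q_ring: "ring Q"
proof (rule ringI)
  show "abelian_group Q"
  proof (rule abelian_groupI)
    show "\<exists>y\<in>carrier Q. y \<oplus>\<^bsub>Q\<^esub> x = \<zero>\<^bsub>Q\<^esub>" if x: "x \<in> carrier Q" for x
    proof -
      obtain a where "a \<in> carrier A" "x = q a" using x by (rule Q_cases)
      then have "q (\<ominus> a) \<oplus>\<^bsub>Q\<^esub> x = \<zero>\<^bsub>Q\<^esub>" by (simp add: q_add q_zero l_neg)
      with \<open>a \<in> carrier A\<close> show ?thesis by (intro bexI[of _ "q (\<ominus> a)"]) auto
    qed
  qed (auto simp: Q_carrier q_add q_zero a_ac)
  show "monoid Q" by (rule monoidI) (auto simp: Q_carrier q_mult q_one m_assoc)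
qed (auto simp: Q_carrier q_add q_mult l_distr r_distr)

lemma Q_nstar: "nstar_algebra Q"
proof -
  interpret Qr: ring Q by (rule Q_ring)
  show ?thesis
  proof
    fix x y c d
    show "(c + d) \<odot>\<^bsub>Q\<^esub> x = c \<odot>\<^bsub>Q\<^esub> x \<oplus>\<^bsub>Q\<^esub> d \<odot>\<^bsub>Q\<^esub> x" if "x \<in> carrier Q"
      using that by (auto simp: Q_carrier q_scale q_add scale_add_left)
    show "c \<odot>\<^bsub>Q\<^esub> (x \<oplus>\<^bsub>Q\<^esub> y) = c \<odot>\<^bsub>Q\<^esub> x \<oplus>\<^bsub>Q\<^esub> c \<odot>\<^bsub>Q\<^esub> y" if "x \<in> carrier Q" "y \<in> carrier Q"
      using that by (auto simp: Q_carrier q_scale q_add scale_add_right)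
    show "nrm Q x = 0 \<longleftrightarrow> x = \<zero>\<^bsub>Q\<^esub>" if "x \<in> carrier Q"
    proof
      obtain a where a: "a \<in> carrier A" "x = q a" using \<open>x \<in> carrier Q\<close> by (rule Q_cases)
      assume "nrm Q x = 0"
      \<comment> \<open>A coset of seminorm 0 contains elements \<open>y\<close> of arbitrarily
        small norm; then \<open>a \<ominus> y\<close> lies in \<open>J\<close> close to
        \<open>a\<close>, and closedness of \<open>J\<close> applies.\<close>
      have "\<exists>z\<in>J. nrm A (a \<ominus> z) < e" if "e > 0" for e
      proof -
        obtain y where y: "y \<in> carrier A" "q y = q a" "nrm A y < e"
          using q_norm_ex[of a e] a \<open>nrm Q x = 0\<close> \<open>e > 0\<close> by auto
        then have "a \<ominus> y \<in> J" using a by (metis q_eq_iff)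
        moreover have "a \<ominus> (a \<ominus> y) = y" using a y by algebra
        ultimately show ?thesis using y by metis
      qed
      then have "a \<in> J" using J_closed a(1) by (simp add: closedin_iff)
      then show "x = \<zero>\<^bsub>Q\<^esub>" using a by (simp add: q_zero a_rcos_zero ideal_axioms)
    next
      assume "x = \<zero>\<^bsub>Q\<^esub>"
      have "nrm Q (q \<zero>) \<le> 0" using q_norm_le[of \<zero> \<zero>] by simp
      moreover have "\<not> nrm Q (q \<zero>) < 0"
      proof
        assume "nrm Q (q \<zero>) < 0"
        then obtain y where "y \<in> carrier A" "nrm A y < 0" using q_norm_ex[of \<zero> 0] by auto
        then show False using norm_nonneg[of y] by linarith
      qed
      ultimately show "nrm Q x = 0" using \<open>x = \<zero>\<^bsub>Q\<^esub>\<close> by (simp add: q_zero)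
    qed
    show nonneg: "0 \<le> nrm Q x" if "x \<in> carrier Q" for x
    proof (rule ccontr)
      assume "\<not> 0 \<le> nrm Q x"
      then have "nrm Q x < 0" by simp
      with \<open>x \<in> carrier Q\<close> obtain y where "y \<in> carrier A" "nrm A y < 0"
        by (rule Q_norm_cases)
      then show False using norm_nonneg[of y] by linarith
    qed
    show "nrm Q (x \<oplus>\<^bsub>Q\<^esub> y) \<le> nrm Q x + nrm Q y" if "x \<in> carrier Q" "y \<in> carrier Q"
    proof (rule field_le_epsilon)
      fix e :: real assume e: "e > 0"
      obtain a' where a': "a' \<in> carrier A" "x = q a'" "nrm A a' < nrm Q x + e/2"
        using \<open>x \<in> carrier Q\<close> e by (elim Q_norm_cases[of x "nrm Q x + e/2"]) simp_all
      obtain b' where b': "b' \<in> carrier A" "y = q b'" "nrm A b' < nrm Q y + e/2"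
        using \<open>y \<in> carrier Q\<close> e by (elim Q_norm_cases[of y "nrm Q y + e/2"]) simp_all
      have "x \<oplus>\<^bsub>Q\<^esub> y = q (a' \<oplus> b')" using a' b' by (simp only: q_add)
      then have "nrm Q (x \<oplus>\<^bsub>Q\<^esub> y) \<le> nrm A (a' \<oplus> b')" using a' b' q_norm_le by simp
      also have "\<dots> \<le> nrm A a' + nrm A b'" using a' b' by (simp add: norm_triangle)
      finally show "nrm Q (x \<oplus>\<^bsub>Q\<^esub> y) \<le> nrm Q x + nrm Q y + e" using a' b' by simp
    qed
    show "nrm Q (x \<otimes>\<^bsub>Q\<^esub> y) \<le> nrm Q x * nrm Q y" if "x \<in> carrier Q" "y \<in> carrier Q"
    proof -
      have n: "0 \<le> nrm Q x" "0 \<le> nrm Q y" using that nonneg by auto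
      have *: "nrm Q (x \<otimes>\<^bsub>Q\<^esub> y) \<le> s * t" if s: "nrm Q x < s" and t: "nrm Q y < t" for s t
      proof -
        obtain a' where a': "a' \<in> carrier A" "x = q a'" "nrm A a' < s"
          using \<open>x \<in> carrier Q\<close> s by (rule Q_norm_cases)
        obtain b' where b': "b' \<in> carrier A" "y = q b'" "nrm A b' < t"
          using \<open>y \<in> carrier Q\<close> t by (rule Q_norm_cases)
        have "x \<otimes>\<^bsub>Q\<^esub> y = q (a' \<otimes> b')" using a' b' by (simp only: q_mult)
        then have "nrm Q (x \<otimes>\<^bsub>Q\<^esub> y) \<le> nrm A (a' \<otimes> b')" using a' b' q_norm_le by simp
        also have "\<dots> \<le> nrm A a' * nrm A b'" using a' b' by (simp add: norm_mult_le)
        also have "\<dots> \<le> s * t" using a' b' norm_nonneg[OF a'(1)] norm_nonneg[OF b'(1)]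
          by (intro mult_mono) linarith+
        finally show ?thesis .
      qed
      \<comment> \<open>The infimum need not be attained, so the bound is proved for all numbers
        strictly above the two norms, and these descend to the norms.\<close>
      have "((\<lambda>e. (nrm Q x + e) * (nrm Q y + e)) \<longlongrightarrow> (nrm Q x + 0) * (nrm Q y + 0)) (at_right 0)"
        by (intro tendsto_intros)
      then show ?thesis
        by (intro tendsto_lowerbound[of _ "nrm Q x * nrm Q y" "at_right (0::real)"])
          (auto simp: eventually_at_right_less intro!: * eventually_mono[OF eventually_at_right_less])
    qed
    show "nrm Q (c \<odot>\<^bsub>Q\<^esub> x) = cmod c * nrm Q x" if "x \<in> carrier Q"
    proof -
      have le: "nrm Q (c \<odot>\<^bsub>Q\<^esub> x) \<le> cmod c * nrm Q x" if x: "x \<in> carrier Q" for c x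
      proof -
        have *: "nrm Q (c \<odot>\<^bsub>Q\<^esub> x) \<le> cmod c * s" if xs: "nrm Q x < s" for s
        proof -
          obtain a' where a': "a' \<in> carrier A" "x = q a'" "nrm A a' < s"
            using x xs by (rule Q_norm_cases)
          have "c \<odot>\<^bsub>Q\<^esub> x = q (c \<odot> a')" using a' by (simp only: q_scale)
          then have "nrm Q (c \<odot>\<^bsub>Q\<^esub> x) \<le> nrm A (c \<odot> a')" using a' q_norm_le by simp
          also have "\<dots> \<le> cmod c * s" using a' by (simp add: norm_scale mult_left_mono)
          finally show ?thesis .
        qed
        have "((\<lambda>e. cmod c * (nrm Q x + e)) \<longlongrightarrow> cmod c * (nrm Q x + 0)) (at_right 0)"
          by (intro tendsto_intros)
        then show ?thesis
          by (intro tendsto_lowerbound[of _ "cmod c * nrm Q x" "at_right (0::real)"])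
            (auto simp: eventually_at_right_less intro!: * eventually_mono[OF eventually_at_right_less])
      qed
      show ?thesis
      proof (cases "c = 0")
        case True
        then show ?thesis using le[OF that, of c] nonneg[of "c \<odot>\<^bsub>Q\<^esub> x"] that
          by (auto simp: Q_carrier q_scale)
      next
        case False
        obtain a where a: "a \<in> carrier A" "x = q a" using \<open>x \<in> carrier Q\<close> by (rule Q_cases)
        \<comment> \<open>The inequality just proved, applied to \<open>inverse c\<close> and the
          scaled element, gives the converse inequality.\<close>
        have cx: "c \<odot>\<^bsub>Q\<^esub> x \<in> carrier Q" using a by (simp add: q_scale)
        have "inverse c \<odot>\<^bsub>Q\<^esub> (c \<odot>\<^bsub>Q\<^esub> x) = x" using False a by (simp add: q_scale scale_scale)
        then have "nrm Q x \<le> cmod (inverse c) * nrm Q (c \<odot>\<^bsub>Q\<^esub> x)" using le[OF cx, of "inverse c"] by simp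
        then have "cmod c * nrm Q x \<le> nrm Q (c \<odot>\<^bsub>Q\<^esub> x)" using False
          by (simp add: norm_inverse inverse_eq_divide norm_divide pos_le_divide_eq mult.commute)
        with le[OF that, of c] show ?thesis by simp
      qed
    qed
    show "nrm Q (adj Q x) = nrm Q x" if "x \<in> carrier Q"
    proof -
      have le: "nrm Q (adj Q x) \<le> nrm Q x" if x: "x \<in> carrier Q" for x
      proof (rule dense_ge)
        fix s assume s: "nrm Q x < s"
        obtain a' where a': "a' \<in> carrier A" "x = q a'" "nrm A a' < s"
          using x s by (rule Q_norm_cases)
        have "adj Q x = q (adj A a')" using a' by (simp only: q_star)
        then have "nrm Q (adj Q x) \<le> nrm A (adj A a')" using a'(1) q_norm_le[of "adj A a'" "adj A a'"] by simp
        then show "nrm Q (adj Q x) \<le> s" using a' by simp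
      qed
      obtain a where a: "a \<in> carrier A" "x = q a" using \<open>x \<in> carrier Q\<close> by (rule Q_cases)
      then have "adj Q x \<in> carrier Q" "adj Q (adj Q x) = x" by (simp_all add: q_star)
      with le[of x] le[of "adj Q x"] that show ?thesis by simp
    qed
  qed (auto simp: Q_carrier q_scale q_star q_add q_mult scale_scale scale_mult_left scale_mult_right
      star_add star_scale star_mult)
qed

end

sublocale star_quot \<subseteq> Q: nstar_algebra Q
  by (rule Q_nstar)

context star_quot
begin

lemma q_minus: "x \<in> carrier A \<Longrightarrow> \<ominus>\<^bsub>Q\<^esub> q x = q (\<ominus> x)"
  by (simp add: Q.minus_eq_scale minus_eq_scale q_scale)

lemma q_diff: "x \<in> carrier A \<Longrightarrow> y \<in> carrier A \<Longrightarrow> q x \<ominus>\<^bsub>Q\<^esub> q y = q (x \<ominus> y)"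
  by (simp add: a_minus_def q_minus q_add)

lemma Q_dense:
  assumes "generates A X" "x \<in> carrier Q" "e > 0"
  shows "\<exists>y\<in>linear_span A (mon A X). nrm Q (x \<ominus>\<^bsub>Q\<^esub> q y) < e"
proof -
  have X: "X \<subseteq> carrier A" using assms by (simp add: generates_def)
  obtain a where a: "a \<in> carrier A" "x = q a" using assms(2) by (rule Q_cases)
  obtain y where y: "y \<in> linear_span A (mon A X)" "nrm A (a \<ominus> y) < e"
    using generates_dense[OF assms(1) a(1) assms(3)] by blast
  have "y \<in> carrier A" using y span_carrier[OF mon_closed[OF X]] by blast
  then have "nrm Q (x \<ominus>\<^bsub>Q\<^esub> q y) \<le> nrm A (a \<ominus> y)"
    using a by (simp add: q_diff q_norm_le)
  with y show ?thesis by (meson le_less_trans)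
qed

lemma lin_fun_q: "lin_fun Q \<psi> \<Longrightarrow> lin_fun A (\<lambda>x. \<psi> (q x))"
  unfolding lin_fun_def by (auto simp flip: q_add q_scale)

lemma state_on_q: "state_on Q \<psi> \<Longrightarrow> state_on A (\<lambda>x. \<psi> (q x))"
  unfolding state_on_def by (auto simp: lin_fun_q q_one simp flip: q_star q_mult)

lemma bdd_fun_q:
  assumes "lin_fun Q \<psi>" "bdd_fun A K (\<lambda>x. \<psi> (q x))" "K \<ge> 0"
  shows "bdd_fun Q K \<psi>"
  unfolding bdd_fun_def
proof (intro conjI assms(1) ballI)
  fix x assume x: "x \<in> carrier Q"
  have *: "cmod (\<psi> x) \<le> K * s" if xs: "nrm Q x < s" for s
  proof -
    obtain a' where a': "a' \<in> carrier A" "x = q a'" "nrm A a' < s"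
      using x xs by (rule Q_norm_cases)
    then have "cmod (\<psi> x) \<le> K * nrm A a'" using assms by (simp add: bdd_fun_def)
    also have "\<dots> \<le> K * s" using a' assms by (intro mult_left_mono) auto
    finally show ?thesis .
  qed
  have "((\<lambda>e. K * (nrm Q x + e)) \<longlongrightarrow> K * (nrm Q x + 0)) (at_right 0)"
    by (intro tendsto_intros)
  then show "cmod (\<psi> x) \<le> K * nrm Q x"
    by (intro tendsto_lowerbound[of _ "K * nrm Q x" "at_right (0::real)"])
      (auto simp: eventually_at_right_less intro!: * eventually_mono[OF eventually_at_right_less])
qed

end

lemma cstate_state_on:
  assumes "nstar_algebra A" "cstate A \<phi>" shows "state_on A \<phi>"
proof -
  interpret nstar_algebra A by fact
  show ?thesis using assms(2) unfolding cstate_def state_on_def lin_fun_def cpositive_def by auto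
qed

lemma state_on_cstate:
  assumes "nstar_algebra A" "state_on A \<phi>" "\<phi> \<in> extensional (carrier A)" shows "cstate A \<phi>"
proof -
  interpret nstar_algebra A by fact
  show ?thesis using assms(2,3) unfolding cstate_def state_on_def lin_fun_def cpositive_def by auto
qed

locale cstar_quot_loc = cstar_algebra A + star_quot A J for A :: "'a cstar" (structure) and J
begin

lemma Q_state_bdd: "state_on Q \<psi> \<Longrightarrow> bdd_fun Q 2 \<psi>"
  by (rule bdd_fun_q[OF _ state_bdd[OF state_on_q]]) (simp_all add: state_on_def[of Q])

end

text \<open>The elements whose adjoint lies in the closed ideal form a closed ideal themselves,
  because the involution is isometric and reverses products; it contains the self-adjoint set
  \<open>X\<close>, so minimality gives invariance under the adjoint.\<close>

lemma closed_ideal_star_quot: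
  assumes "cstar_algebra A" and X: "X \<subseteq> carrier A" and sa: "\<And>x. x \<in> X \<Longrightarrow> adj A x = x"
  shows "cstar_quot_loc A (closed_ideal A X)"
proof -
  interpret cstar_algebra A by fact
  let ?S = "{I. ideal I A \<and> closedin (ntop A) I \<and> X \<subseteq> I}"
  have "carrier A \<in> ?S"
    using X oneideal by (auto simp: closedin_iff)
  then have ne: "?S \<noteq> {}" by blast
  have id: "ideal (closed_ideal A X) A"
    unfolding closed_ideal_def by (rule i_Intersect[OF _ ne]) auto
  interpret J: ideal "closed_ideal A X" A by (rule id)
  have cl: "closedin (ntop A) (closed_ideal A X)"
    unfolding closed_ideal_def using ne by (intro closedin_Inter) auto
  have XJ: "X \<subseteq> closed_ideal A X" unfolding closed_ideal_def by auto
  let ?I = "{x \<in> carrier A. adj A x \<in> closed_ideal A X}"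
  have "ideal ?I A"
  proof (rule idealI)
    show "ring A" by (rule ring_axioms)
    show "subgroup ?I (add_monoid A)"
    proof (rule subgroup.intro)
      show "inv\<^bsub>add_monoid A\<^esub> x \<in> ?I" if "x \<in> ?I" for x
        using that by (auto simp: star_minus simp flip: a_inv_def)
    qed (auto simp: star_add)
  qed (auto simp: star_mult J.I_l_closed J.I_r_closed)
  moreover have "closedin (ntop A) ?I"
    unfolding closedin_iff
  proof (intro conjI ballI impI)
    fix x assume x: "x \<in> carrier A" and *: "\<forall>e>0. \<exists>y\<in>?I. nrm A (x \<ominus>\<^bsub>A\<^esub> y) < e"
    have "\<exists>y\<in>closed_ideal A X. nrm A (adj A x \<ominus>\<^bsub>A\<^esub> y) < e" if e: "e > 0" for e
    proof -
      obtain y where y: "y \<in> ?I" "nrm A (x \<ominus>\<^bsub>A\<^esub> y) < e"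
        using *[rule_format, OF e] by (elim bexE)
      have yc: "y \<in> carrier A" using y(1) by blast
      have "nrm A (adj A x \<ominus>\<^bsub>A\<^esub> adj A y) = nrm A (x \<ominus>\<^bsub>A\<^esub> y)"
        using norm_star[OF minus_closed[OF x yc]] by (simp only: star_diff[OF x yc])
      moreover have "adj A y \<in> closed_ideal A X" using y(1) by blast
      ultimately show ?thesis using y(2) by (intro bexI[of _ "adj A y"]) simp_all
    qed
    then show "x \<in> ?I" using cl x by (simp add: closedin_iff)
  qed auto
  moreover have "X \<subseteq> ?I" using X XJ sa by auto
  ultimately have "closed_ideal A X \<subseteq> ?I" unfolding closed_ideal_def by blast
  then have "star_quot A (closed_ideal A X)"
    by unfold_locales (use cl in auto)
  then show ?thesis by (simp add: cstar_quot_loc_def cstar_algebra_axioms)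
qed

section \<open>KMS states and homogeneous elements\<close>

text \<open>The identity theorem; the real line accumulates at 0.\<close>

lemma entire_eq_on_reals:
  assumes f: "f holomorphic_on UNIV" and g: "g holomorphic_on UNIV"
    and eq: "\<And>t::real. f (complex_of_real t) = g (complex_of_real t)"
  shows "f z = g z"
proof -
  have "0 islimpt (\<real> :: complex set)"
    unfolding islimpt_approachable
  proof (intro allI impI)
    fix e :: real assume "e > 0"
    then show "\<exists>x'\<in>\<real>. x' \<noteq> (0::complex) \<and> dist x' 0 < e"
      by (intro bexI[of _ "complex_of_real (e/2)"]) auto
  qed
  moreover have "(\<lambda>z. f z - g z) holomorphic_on UNIV" by (intro holomorphic_intros f g)
  moreover have "f w - g w = 0" if "w \<in> \<real>" for w using that eq by (elim Reals_cases) simp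
  ultimately have "f z - g z = 0"
    by (intro analytic_continuation[of "\<lambda>z. f z - g z" UNIV \<real> 0 z]) (simp_all add: connected_UNIV)
  then show ?thesis by simp
qed

text \<open>A primitive \<open>G\<close> of \<open>f(z) e\<^sup>-\<^sup>i\<^sup>k\<^sup>z\<close> satisfies \<open>G(z + 2\<pi>) - G(z) = C\<close> for a constant \<open>C\<close>, which
  is estimated along both edges of the strip.\<close>

lemma periodic_strip_bound:
  fixes k :: int and \<beta> d :: real and a b :: complex
  assumes f: "f holomorphic_on UNIV"
    and per: "\<And>t::real. f (t + 2 * pi) = f t"
    and low: "\<And>t::real. cmod (f t - exp (\<i> * of_real (t * k)) * a) \<le> d"
    and up: "\<And>t::real. cmod (f (t + \<i> * \<beta>) - exp (\<i> * of_real (t * k)) * b) \<le> d"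
  shows "cmod (a - exp (k * \<beta>) * b) \<le> d * (1 + exp (k * \<beta>))"
proof -
  let ?h = "\<lambda>z. f z * exp (- \<i> * of_int k * z)"
  have "?h holomorphic_on UNIV" by (intro holomorphic_intros f)
  then obtain G where "\<And>z. z \<in> UNIV \<Longrightarrow> (G has_field_derivative ?h z) (at z within UNIV)"
    using holomorphic_convex_primitive'[of UNIV ?h] by auto
  then have G: "(G has_field_derivative ?h z) (at z within S)" for z S
    by (metis UNIV_I has_field_derivative_at_within)
  \<comment> \<open>Periodicity is assumed on the real line only and spreads to the plane by the
    identity theorem.\<close>
  have per': "f (z + 2 * pi) = f z" for z :: complex
  proof (rule entire_eq_on_reals[of "\<lambda>z. f (z + 2 * pi)"])
    show "(\<lambda>z. f (z + 2 * pi)) holomorphic_on UNIV"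
      by (rule holomorphic_on_compose[of "\<lambda>z. z + 2 * pi" UNIV f, unfolded o_def])
        (auto intro!: holomorphic_intros intro: holomorphic_on_subset[OF f])
  qed (use f per in auto)
  have e1: "exp (- \<i> * of_int k * (z + 2 * pi)) = exp (- \<i> * of_int k * z)" for z :: complex
  proof -
    have "- \<i> * of_int k * (z + 2 * pi) = - \<i> * of_int k * z + 2 * of_int (- k) * pi * \<i>"
      by (simp add: algebra_simps)
    then show ?thesis by (metis exp_add exp_integer_2pi Ints_of_int mult.right_neutral)
  qed
  define C where "C = G (2 * pi) - G 0"
  have "(\<lambda>z :: complex. G (z + 2 * pi) - G z) constant_on UNIV"
  proof (rule has_field_derivative_0_imp_constant_on)
    fix z :: complex
    have "((\<lambda>z. G (z + 2 * pi)) has_field_derivative ?h (z + 2 * pi) * 1) (at z)"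
      by (rule DERIV_chain2[OF G]) (auto intro!: derivative_eq_intros)
    then have "((\<lambda>z. G (z + 2 * pi) - G z) has_field_derivative ?h (z + 2 * pi) * 1 - ?h z) (at z)"
      by (rule DERIV_diff[OF _ G])
    moreover have "?h (z + 2 * pi) = ?h z" by (simp only: per' e1)
    ultimately show "((\<lambda>z. G (z + 2 * pi) - G z) has_field_derivative 0) (at z)"
      by (simp only: mult_1_right diff_self)
  qed auto
  then have C: "G (z + 2 * pi) - G z = C" for z :: complex
    unfolding constant_on_def C_def by (metis UNIV_I add_0)
  \<comment> \<open>Mean value estimate for \<open>G z - m * z\<close> over one period of the
    horizontal line at height \<open>c\<close>: there the derivative of \<open>G\<close> stays
    within \<open>r\<close> of the constant \<open>m\<close>.\<close>
  have edge: "cmod (C - 2 * pi * m) \<le> 2 * pi * r"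
    if c: "\<And>t::real. cmod (?h (t + \<i> * c) - m) \<le> r" for c r :: real and m :: complex
  proof -
    let ?g = "\<lambda>z :: complex. G z - m * z" and ?S = "{z. Im z = c}"
    have "cmod (?g (\<i> * c + 2 * pi) - ?g (\<i> * c)) \<le> r * cmod ((\<i> * c + 2 * pi) - \<i> * c)"
    proof (rule field_differentiable_bound[of ?S _ "\<lambda>z. ?h z - m"])
      show "convex ?S"
        using convex_hyperplane[of \<i> c] by (simp add: inner_complex_def)
      show "(?g has_field_derivative ?h z - m) (at z within ?S)" for z
        by (auto intro!: derivative_eq_intros G)
      show "cmod (?h z - m) \<le> r" if "z \<in> ?S" for z
      proof -
        have "z = of_real (Re z) + \<i> * c" using that by (simp add: complex_eq_iff)
        then show ?thesis using c[of "Re z"] by metis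
      qed
    qed auto
    moreover have "?g (\<i> * c + 2 * pi) - ?g (\<i> * c) = C - 2 * pi * m"
      using C[of "\<i> * c"] by (simp add: algebra_simps)
    ultimately show ?thesis by (simp add: norm_mult mult_ac)
  qed
  have n1: "cmod (exp (- \<i> * of_int k * (t + \<i> * c)) * w) = exp (k * c) * cmod w"
    for t c :: real and w
    by (simp add: norm_mult norm_exp_eq_Re)
  have "cmod (C - 2 * pi * a) \<le> 2 * pi * d"
  proof (rule edge[of 0])
    fix t :: real
    have "?h (t + \<i> * 0) - a = exp (- \<i> * of_int k * (t + \<i> * 0)) * (f t - exp (\<i> * of_real (t * k)) * a)"
      by (simp add: algebra_simps flip: exp_add)
    then have "cmod (?h (t + \<i> * 0) - a) = cmod (f t - exp (\<i> * of_real (t * k)) * a)"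
      using n1[of t 0] by (simp add: norm_mult)
    then show "cmod (?h (t + \<i> * of_real 0) - a) \<le> d" using low[of t] by simp
  qed
  moreover have "cmod (C - 2 * pi * (exp (k * \<beta>) * b)) \<le> 2 * pi * (exp (k * \<beta>) * d)"
  proof (rule edge[of \<beta>])
    fix t :: real
    \<comment> \<open>At height \<open>\<beta>\<close> the factor
      \<open>exp (- \<i> * k * z)\<close> has modulus \<open>exp (k * \<beta>)\<close>; this is
      where the KMS weight comes from.\<close>
    have "exp (- \<i> * of_int k * (t + \<i> * \<beta>)) * exp (\<i> * of_real (t * k)) = exp (complex_of_real (k * \<beta>))"
      by (simp add: algebra_simps flip: exp_add)
    moreover have "x * (y - z * b) = y * x - (x * z) * b" for x y z :: complex
      by (simp add: algebra_simps)
    ultimately have "?h (t + \<i> * \<beta>) - exp (k * \<beta>) * b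
        = exp (- \<i> * of_int k * (t + \<i> * \<beta>)) * (f (t + \<i> * \<beta>) - exp (\<i> * of_real (t * k)) * b)"
      by (simp only: exp_of_real)
    then have "cmod (?h (t + \<i> * \<beta>) - exp (k * \<beta>) * b)
        = exp (k * \<beta>) * cmod (f (t + \<i> * \<beta>) - exp (\<i> * of_real (t * k)) * b)"
      by (simp only: n1)
    then show "cmod (?h (t + \<i> * \<beta>) - exp (k * \<beta>) * b) \<le> exp (k * \<beta>) * d"
      using up[of t] by (simp add: mult_left_mono)
  qed
  ultimately have "cmod (2 * pi * a - 2 * pi * (exp (k * \<beta>) * b)) \<le> 2 * pi * d + 2 * pi * (exp (k * \<beta>) * d)"
    using norm_triangle_ineq4[of "C - 2 * pi * (exp (k * \<beta>) * b)" "C - 2 * pi * a"] by simp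
  moreover have "2 * pi * a - 2 * pi * (exp (k * \<beta>) * b) = complex_of_real (2 * pi) * (a - exp (k * \<beta>) * b)"
    by (simp add: algebra_simps)
  moreover have "cmod (complex_of_real (2 * pi) * w) = 2 * pi * cmod w" for w
    by (simp add: norm_mult)
  ultimately have "2 * pi * cmod (a - exp (k * \<beta>) * b) \<le> 2 * pi * d + 2 * pi * (exp (k * \<beta>) * d)"
    by (simp only:)
  also have "\<dots> = 2 * pi * (d * (1 + exp (k * \<beta>)))"
    by (simp add: algebra_simps)
  finally have "2 * pi * cmod (a - exp (k * \<beta>) * b) \<le> 2 * pi * (d * (1 + exp (k * \<beta>)))" .
  then show ?thesis by simp
qed

section \<open>Homogeneous elements and the KMS relation\<close>

context nstar_algebra
begin

lemma bdd_fun_tendsto: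
  assumes "bdd_fun A K \<phi>" "limitin (ntop A) f l F"
  shows "((\<lambda>x. \<phi> (f x)) \<longlongrightarrow> \<phi> l) F"
proof (rule tendstoI)
  fix e :: real assume e: "e > 0"
  have l: "l \<in> carrier A" using assms(2) by (simp add: limitin_iff)
  have "e / (2 * (\<bar>K\<bar> + 1)) > 0" using e by (simp add: add_nonneg_pos)
  then have "\<forall>\<^sub>F x in F. f x \<in> carrier A \<and> nrm A (f x \<ominus> l) < e / (2 * (\<bar>K\<bar> + 1))"
    using assms(2) by (simp add: limitin_iff)
  then show "\<forall>\<^sub>F x in F. dist (\<phi> (f x)) (\<phi> l) < e"
  proof (rule eventually_mono)
    fix x assume x: "f x \<in> carrier A \<and> nrm A (f x \<ominus> l) < e / (2 * (\<bar>K\<bar> + 1))"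
    then have "cmod (\<phi> (f x) - \<phi> l) \<le> \<bar>K\<bar> * (e / (2 * (\<bar>K\<bar> + 1)))"
      using assms(1) l by (intro bdd_fun_approx) auto
    also have "\<dots> \<le> (\<bar>K\<bar> + 1) * (e / (2 * (\<bar>K\<bar> + 1)))"
      using e by (intro mult_right_mono) (auto intro!: divide_nonneg_nonneg)
    also have "\<dots> = e / 2" using e by (simp add: field_simps)
    finally show "dist (\<phi> (f x)) (\<phi> l) < e" using e by (simp add: dist_norm)
  qed
qed

lemma bdd_fun_entire:
  assumes \<phi>: "bdd_fun A K \<phi>" and F: "entire A F"
  shows "(\<lambda>z. \<phi> (F z)) holomorphic_on UNIV"
proof -
  have Fc: "F z \<in> carrier A" for z using F by (auto simp: entire_def)
  have "\<exists>d. ((\<lambda>z. \<phi> (F z)) has_field_derivative d) (at z)" for z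
  proof -
    obtain D where D: "limitin (ntop A) (\<lambda>h. (1 / h) \<odot> (F (z + h) \<ominus> F z)) D (at 0)"
      using F by (auto simp: entire_def)
    have "\<phi> ((1 / h) \<odot> (F (z + h) \<ominus> F z)) = (\<phi> (F (z + h)) - \<phi> (F z)) / h" for h
      using Fc \<phi> by (simp add: lin_fun_scale lin_fun_diff bdd_fun_lin)
    then have "((\<lambda>h. (\<phi> (F (z + h)) - \<phi> (F z)) / h) \<longlongrightarrow> \<phi> D) (at 0)"
      using bdd_fun_tendsto[OF \<phi> D] by simp
    then show ?thesis by (auto simp: DERIV_def)
  qed
  then show ?thesis by (simp add: holomorphic_on_open)
qed

end

text \<open>The \<open>k\<close>-th spectral subspace of the dynamics.\<close>

definition homogeneous :: "'a cstar \<Rightarrow> (real \<Rightarrow> 'a \<Rightarrow> 'a) \<Rightarrow> int \<Rightarrow> 'a \<Rightarrow> bool" where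
  "homogeneous A \<sigma> k x \<longleftrightarrow> x \<in> carrier A \<and> (\<forall>t. \<sigma> t x = exp (\<i> * of_real (t * of_int k)) \<odot>\<^bsub>A\<^esub> x)"

locale star_dynamics = nstar_algebra A for A :: "'a cstar" (structure) +
  fixes \<sigma> :: "real \<Rightarrow> 'a \<Rightarrow> 'a"
  assumes dyn: "dynamics A \<sigma>"
begin

lemma dyn_closed [simp]: "x \<in> carrier A \<Longrightarrow> \<sigma> t x \<in> carrier A"
  and dyn_mult: "x \<in> carrier A \<Longrightarrow> y \<in> carrier A \<Longrightarrow> \<sigma> t (x \<otimes> y) = \<sigma> t x \<otimes> \<sigma> t y"
  and dyn_add: "x \<in> carrier A \<Longrightarrow> y \<in> carrier A \<Longrightarrow> \<sigma> t (x \<oplus> y) = \<sigma> t x \<oplus> \<sigma> t y"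
  and dyn_one: "\<sigma> t \<one> = \<one>"
  and dyn_scale: "x \<in> carrier A \<Longrightarrow> \<sigma> t (c \<odot> x) = c \<odot> \<sigma> t x"
  and dyn_star: "x \<in> carrier A \<Longrightarrow> \<sigma> t (adj A x) = adj A (\<sigma> t x)"
  and dyn_group: "x \<in> carrier A \<Longrightarrow> \<sigma> (r + t) x = \<sigma> r (\<sigma> t x)"
proof -
  have h: "\<sigma> t \<in> ring_hom A A" and
    "(\<forall>c. \<forall>x\<in>carrier A. \<sigma> t (c \<odot> x) = c \<odot> \<sigma> t x) \<and> (\<forall>x\<in>carrier A. \<sigma> t (adj A x) = adj A (\<sigma> t x))"
    using dyn unfolding dynamics_def star_hom_def by blast+
  then show "x \<in> carrier A \<Longrightarrow> \<sigma> t (c \<odot> x) = c \<odot> \<sigma> t x"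
    "x \<in> carrier A \<Longrightarrow> \<sigma> t (adj A x) = adj A (\<sigma> t x)" by blast+
  show "x \<in> carrier A \<Longrightarrow> \<sigma> t x \<in> carrier A" using h by (rule ring_hom_closed)
  show "x \<in> carrier A \<Longrightarrow> y \<in> carrier A \<Longrightarrow> \<sigma> t (x \<otimes> y) = \<sigma> t x \<otimes> \<sigma> t y"
    using h by (rule ring_hom_mult)
  show "x \<in> carrier A \<Longrightarrow> y \<in> carrier A \<Longrightarrow> \<sigma> t (x \<oplus> y) = \<sigma> t x \<oplus> \<sigma> t y"
    using h by (rule ring_hom_add)
  show "\<sigma> t \<one> = \<one>" using h by (rule ring_hom_one)
  show "x \<in> carrier A \<Longrightarrow> \<sigma> (r + t) x = \<sigma> r (\<sigma> t x)"
    using dyn unfolding dynamics_def by blast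
qed

lemma dyn_zero: "\<sigma> t \<zero> = \<zero>"
  using dyn_scale[of \<zero> t 0] by simp

lemma state_dyn: "state_on A \<phi> \<Longrightarrow> state_on A (\<lambda>x. \<phi> (\<sigma> t x))"
  unfolding state_on_def lin_fun_def
  by (auto simp: dyn_add dyn_scale dyn_mult dyn_star dyn_one)

lemma homogeneous_mult:
  assumes "homogeneous A \<sigma> k x" "homogeneous A \<sigma> l y"
  shows "homogeneous A \<sigma> (k + l) (x \<otimes> y)"
  using assms
  by (auto simp: homogeneous_def dyn_mult scale_mult_left scale_mult_right scale_scale algebra_simps
    simp flip: exp_add)

lemma homogeneous_star:
  assumes "homogeneous A \<sigma> k x" shows "homogeneous A \<sigma> (- k) (adj A x)"
  using assms by (auto simp: homogeneous_def dyn_star star_scale exp_cnj)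

lemma homogeneous_one: "homogeneous A \<sigma> 0 \<one>"
  by (simp add: homogeneous_def dyn_one)

end

text \<open>Boundedness of states is an assumption because \<open>A\<close> is only a normed
  star-algebra here; for the quotient it is inherited from the C*-algebra above it.\<close>

locale KMS_setup = star_dynamics A \<sigma> for A :: "'a cstar" (structure) and \<sigma> +
  fixes M :: "'a set"
  assumes M_hom: "x \<in> M \<Longrightarrow> \<exists>k. homogeneous A \<sigma> k x"
    and M_dense: "x \<in> carrier A \<Longrightarrow> e > 0 \<Longrightarrow> \<exists>y\<in>linear_span A M. nrm A (x \<ominus> y) < e"
    and states_bdd: "state_on A \<phi> \<Longrightarrow> bdd_fun A 2 \<phi>"
begin

lemma M_carrier: "M \<subseteq> carrier A"
  using M_hom by (auto simp: homogeneous_def)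

lemma eq_on_M:
  assumes "bdd_fun A K \<phi>" "bdd_fun A K' \<psi>" "\<And>m. m \<in> M \<Longrightarrow> \<phi> m = \<psi> m" and x: "x \<in> carrier A"
  shows "\<phi> x = \<psi> x"
proof (rule bdd_fun_eq_closure[OF assms(1,2) x])
  fix e :: real assume e: "e > 0"
  let ?V = "{x \<in> carrier A. \<phi> x = \<psi> x}"
  have "linear_subspace A ?V"
    using assms(1,2) unfolding linear_subspace_def
    by (auto simp: lin_fun_add lin_fun_scale bdd_fun_lin lin_fun_zero)
  then have "linear_span A M \<subseteq> ?V" using assms(3) M_carrier by (intro span_minimal) auto
  then show "\<exists>y\<in>carrier A. \<phi> y = \<psi> y \<and> nrm A (x \<ominus> y) < e" using M_dense[OF x e] by blast
qed

text \<open>The other factor is first taken from \<open>M\<close>: homogeneity turns the boundary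
  values into phases times values of the states \<open>\<psi> \<circ> \<sigma> t\<close>, which are
  bounded uniformly in \<open>t\<close>. General \<open>b\<close> follows by density.\<close>

lemma KMS_homogeneous:
  assumes K: "KMS_state A \<sigma> \<beta> \<psi>" and a: "homogeneous A \<sigma> k a" and b: "b \<in> carrier A"
  shows "\<psi> (b \<otimes> a) = exp (of_int k * \<beta>) * \<psi> (a \<otimes> b)"
proof -
  have st: "state_on A \<psi>"
    using K cstate_state_on[OF nstar_algebra_axioms] by (auto simp: KMS_state_def)
  have bd: "bdd_fun A 2 \<psi>" by (rule states_bdd[OF st])
  note lin = bdd_fun_lin[OF bd]
  have ac: "a \<in> carrier A" using a by (simp add: homogeneous_def)
  obtain S where S0: "S \<subseteq> analytic_elements A \<sigma> \<and>
      ntop A closure_of linear_span A S = carrier A \<and>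
      (\<forall>t. \<sigma> t ` linear_span A S \<subseteq> linear_span A S) \<and>
      (\<forall>a\<in>S. \<forall>b\<in>S. \<forall>F. entire_extension A \<sigma> a F \<longrightarrow>
         \<psi> (a \<otimes> b) = \<psi> (b \<otimes> F (\<i> * complex_of_real \<beta>)))"
    using conjunct2[OF K[unfolded KMS_state_def]] by (rule exE)
  note S = S0[THEN conjunct1] S0[THEN conjunct2, THEN conjunct1]
    S0[THEN conjunct2, THEN conjunct2, THEN conjunct1, THEN spec]
    S0[THEN conjunct2, THEN conjunct2, THEN conjunct2, rule_format]
  have Sc: "S \<subseteq> carrier A" using S(1) by (auto simp: analytic_elements_def)
  have spc: "linear_span A S \<subseteq> carrier A" using Sc by (rule span_carrier)
  have Sd: "\<exists>y\<in>linear_span A S. nrm A (x \<ominus> y) < e" if "x \<in> carrier A" "e > 0" for x e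
    using that closure_iff[OF spc, of x] S(2) by auto
  have bdl: "bdd_fun A (2 * nrm A x) (\<lambda>y. \<psi> (x \<otimes> y))" if "x \<in> carrier A" for x
    using bdd_fun_left[OF bd that] by simp
  have bdr: "bdd_fun A (2 * nrm A x) (\<lambda>y. \<psi> (y \<otimes> x))" if "x \<in> carrier A" for x
    using bdd_fun_right[OF bd that] by simp
  \<comment> \<open>\<open>good x c f\<close> is the KMS condition for \<open>x\<close> and
    \<open>c\<close> in terms of a scalar entire function. In this form it is linear in
    \<open>x\<close>, does not mention an extension of the orbit of \<open>x\<close>, and allows
    arbitrary \<open>c\<close>.\<close>
  define good where "good = (\<lambda>x c f. f holomorphic_on UNIV \<and>
      (\<forall>t::real. f t = \<psi> (c \<otimes> \<sigma> t x)) \<and> f (\<i> * complex_of_real \<beta>) = \<psi> (x \<otimes> c))"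
  have good: "\<exists>f. good x c f" if x: "x \<in> linear_span A S" and c: "c \<in> carrier A" for x c
  proof -
    let ?V = "{x \<in> carrier A. \<exists>f. good x c f}"
    have "linear_subspace A ?V"
      unfolding linear_subspace_def
    proof (intro conjI ballI allI)
      show "\<zero> \<in> ?V"
        using c lin by (auto intro!: exI[of _ "\<lambda>_. 0"] simp: good_def dyn_zero lin_fun_zero)
      fix x y assume xy: "x \<in> ?V" "y \<in> ?V"
      then obtain f g where "good x c f" "good y c g" by blast
      then have "good (x \<oplus> y) c (\<lambda>z. f z + g z)"
        using xy c lin by (auto simp: good_def dyn_add r_distr l_distr lin_fun_add intro!: holomorphic_intros)
      with xy show "x \<oplus> y \<in> ?V" by blast
    next
      fix r x assume x: "x \<in> ?V"
      then obtain f where "good x c f" by blast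
      then have "good (r \<odot> x) c (\<lambda>z. r * f z)"
        using x c lin by (auto simp: good_def dyn_scale scale_mult_left scale_mult_right lin_fun_scale
          intro!: holomorphic_intros)
      with x show "r \<odot> x \<in> ?V" by blast
    qed auto
    moreover have "S \<subseteq> ?V"
    proof
      fix x assume x: "x \<in> S"
      then obtain F where F: "entire_extension A \<sigma> x F" using S(1) by (auto simp: analytic_elements_def)
      let ?w = "F (\<i> * complex_of_real \<beta>)"
      have xc: "x \<in> carrier A" and w: "?w \<in> carrier A"
        using x Sc F by (auto simp: entire_extension_def entire_def)
      \<comment> \<open>With \<open>x\<close> fixed in \<open>S\<close>, both sides are bounded in
        \<open>c\<close>, so the KMS equation passes from \<open>c\<close> in \<open>S\<close> to
        all \<open>c\<close>.\<close>
      have "\<psi> (x \<otimes> c) = \<psi> (c \<otimes> ?w)"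
      proof (rule bdd_fun_eq_closure[OF bdl[OF xc] bdr[OF w] c])
        fix e :: real assume e: "e > 0"
        let ?W = "{c \<in> carrier A. \<psi> (x \<otimes> c) = \<psi> (c \<otimes> ?w)}"
        have "linear_subspace A ?W"
          using lin xc w unfolding linear_subspace_def
          by (auto simp: lin_fun_add lin_fun_scale lin_fun_zero r_distr l_distr scale_mult_left scale_mult_right)
        moreover have "S \<subseteq> ?W" using S(4)[OF x _ F] Sc by auto
        ultimately have "linear_span A S \<subseteq> ?W" by (rule span_minimal)
        then show "\<exists>y\<in>carrier A. \<psi> (x \<otimes> y) = \<psi> (y \<otimes> ?w) \<and> nrm A (c \<ominus> y) < e"
          using Sd[OF c e] by blast
      qed
      moreover have "(\<lambda>z. \<psi> (c \<otimes> F z)) holomorphic_on UNIV"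
        using bdd_fun_entire[OF bdl[OF c]] F by (simp add: entire_extension_def)
      ultimately have "good x c (\<lambda>z. \<psi> (c \<otimes> F z))"
        using F by (simp add: good_def entire_extension_def)
      with xc show "x \<in> ?V" by blast
    qed
    ultimately have "linear_span A S \<subseteq> ?V" by (rule span_minimal)
    with x show ?thesis by blast
  qed
  have main: "\<psi> (m \<otimes> a) = exp (of_int k * \<beta>) * \<psi> (a \<otimes> m)" if m: "m \<in> M" for m
  proof -
    obtain l where l: "homogeneous A \<sigma> l m" using M_hom[OF m] by blast
    have mc: "m \<in> carrier A" using m M_carrier by blast
    have expn: "exp (- \<i> * of_real (t * of_int n)) * exp (\<i> * of_real (t * of_int n)) = (1::complex)" for t :: real and n :: int
      by (simp flip: exp_add)
    \<comment> \<open>Moving the homogeneous \<open>m\<close> inside \<open>\<sigma> t\<close> costs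
      a phase of modulus 1, so the bound for the state \<open>\<psi> \<circ> \<sigma> t\<close>
      gives estimates independent of \<open>t\<close>.\<close>
    have shift: "\<psi> (m \<otimes> \<sigma> t x) = exp (- \<i> * of_real (t * of_int l)) * \<psi> (\<sigma> t (m \<otimes> x))"
      "\<psi> (\<sigma> t x \<otimes> m) = exp (- \<i> * of_real (t * of_int l)) * \<psi> (\<sigma> t (x \<otimes> m))"
      if x: "x \<in> carrier A" for t x
    proof -
      have s: "\<sigma> t m = exp (\<i> * of_real (t * of_int l)) \<odot> m" using l by (simp add: homogeneous_def)
      have "\<psi> (\<sigma> t (m \<otimes> x)) = exp (\<i> * of_real (t * of_int l)) * \<psi> (m \<otimes> \<sigma> t x)"
        using x mc lin by (simp add: dyn_mult s scale_mult_left lin_fun_scale)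
      then show "\<psi> (m \<otimes> \<sigma> t x) = exp (- \<i> * of_real (t * of_int l)) * \<psi> (\<sigma> t (m \<otimes> x))"
        using expn[of t l] by (simp only: mult.assoc[symmetric] mult_1_left)
      have "\<psi> (\<sigma> t (x \<otimes> m)) = exp (\<i> * of_real (t * of_int l)) * \<psi> (\<sigma> t x \<otimes> m)"
        using x mc lin by (simp add: dyn_mult s scale_mult_right lin_fun_scale)
      then show "\<psi> (\<sigma> t x \<otimes> m) = exp (- \<i> * of_real (t * of_int l)) * \<psi> (\<sigma> t (x \<otimes> m))"
        using expn[of t l] by (simp only: mult.assoc[symmetric] mult_1_left)
    qed
    have nexp: "cmod (exp (- \<i> * of_real r)) = 1" for r :: real
      by (simp add: norm_exp_eq_Re)
    have bnd: "cmod (\<psi> (m \<otimes> \<sigma> t x)) \<le> 2 * (nrm A m * nrm A x)"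
      "cmod (\<psi> (\<sigma> t x \<otimes> m)) \<le> 2 * (nrm A m * nrm A x)" if x: "x \<in> carrier A" for t x
    proof -
      have bt: "cmod (\<psi> (\<sigma> t y)) \<le> 2 * nrm A y" if "y \<in> carrier A" for y
        using states_bdd[OF state_dyn[OF st, of t]] that by (simp add: bdd_fun_def)
      show "cmod (\<psi> (m \<otimes> \<sigma> t x)) \<le> 2 * (nrm A m * nrm A x)"
        using bt[of "m \<otimes> x"] norm_mult_le[of m x] x mc unfolding shift(1)[OF x] norm_mult nexp by simp
      show "cmod (\<psi> (\<sigma> t x \<otimes> m)) \<le> 2 * (nrm A m * nrm A x)"
        using bt[of "x \<otimes> m"] norm_mult_le[of x m] x mc unfolding shift(2)[OF x] norm_mult nexp
        by (simp add: mult.commute)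
    qed
    \<comment> \<open>\<open>\<sigma> (2 * pi)\<close> fixes homogeneous elements since the degrees
      are integers; density does the rest. This makes
      \<open>t \<mapsto> \<psi> (m \<otimes> \<sigma> t y)\<close> periodic.\<close>
    have per: "\<psi> (m \<otimes> \<sigma> (2 * pi) x) = \<psi> (m \<otimes> x)" if x: "x \<in> carrier A" for x
    proof (rule eq_on_M[OF _ bdl[OF mc] _ x])
      show "bdd_fun A (2 * nrm A m) (\<lambda>x. \<psi> (m \<otimes> \<sigma> (2 * pi) x))"
        unfolding bdd_fun_def lin_fun_def using bnd(1) mc lin
        by (auto simp: dyn_add dyn_scale r_distr scale_mult_right lin_fun_add lin_fun_scale mult.assoc)
      fix n assume "n \<in> M"
      then obtain j where "homogeneous A \<sigma> j n" using M_hom by blast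
      then have n: "n \<in> carrier A" "\<sigma> (2 * pi) n = exp (\<i> * of_real (2 * pi * of_int j)) \<odot> n"
        by (auto simp: homogeneous_def)
      have "exp (\<i> * of_real (2 * pi * of_int j)) = (1::complex)"
        using exp_integer_2pi[of "of_int j"] by (simp add: mult_ac)
      then show "\<psi> (m \<otimes> \<sigma> (2 * pi) n) = \<psi> (m \<otimes> n)" using n by simp
    qed
    have approx: "cmod (\<psi> (m \<otimes> a) - exp (of_int k * \<beta>) * \<psi> (a \<otimes> m))
        \<le> (2 * (nrm A m * e)) * (1 + exp (of_int k * \<beta>))" if e: "e > 0" for e
    proof -
      obtain y where y: "y \<in> linear_span A S" "nrm A (a \<ominus> y) < e" using Sd[OF ac e] by blast
      have yc: "y \<in> carrier A" using y spc by blast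
      obtain f where f: "good y m f" using good[OF y(1) mc] by blast
      have fh: "f holomorphic_on UNIV" and ft: "\<And>t::real. f t = \<psi> (m \<otimes> \<sigma> t y)"
        using f by (auto simp: good_def)
      \<comment> \<open>Invariance of the span puts \<open>\<sigma> t y\<close> into it again. Its
        entire function agrees on the real line with \<open>f\<close> translated by
        \<open>t\<close>, hence everywhere, in particular at \<open>\<i> * \<beta>\<close>.\<close>
      have up: "f (t + \<i> * \<beta>) = \<psi> (\<sigma> t y \<otimes> m)" for t :: real
      proof -
        have "\<sigma> t y \<in> linear_span A S" using S(3)[of t] y(1) by blast
        then obtain g where g: "good (\<sigma> t y) m g" using good mc by blast
        have "g z = f (z + t)" for z :: complex
        proof (rule entire_eq_on_reals[of g "\<lambda>z. f (z + t)"])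
          show "g holomorphic_on UNIV" using g by (simp add: good_def)
          show "(\<lambda>z. f (z + t)) holomorphic_on UNIV"
            by (rule holomorphic_on_compose[of "\<lambda>z. z + t" UNIV f, unfolded o_def])
              (auto intro!: holomorphic_intros intro: holomorphic_on_subset[OF fh])
          fix r :: real
          have "f (complex_of_real r + complex_of_real t) = f (complex_of_real (r + t))" by simp
          also have "\<dots> = g (complex_of_real r)"
            using g yc by (simp only: ft) (simp add: good_def dyn_group)
          finally show "g (complex_of_real r) = f (complex_of_real r + complex_of_real t)" ..
        qed
        from this[of "\<i> * \<beta>"] show ?thesis using g by (simp add: good_def add.commute)
      qed
      have small: "nrm A m * nrm A (y \<ominus> a) \<le> nrm A m * e"
        using y yc ac mc norm_diff_commute[OF yc ac] by (intro mult_left_mono) auto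
      have sa: "\<sigma> t a = exp (\<i> * of_real (t * k)) \<odot> a" for t using a by (simp add: homogeneous_def)
      have sd: "\<sigma> t (y \<ominus> a) = \<sigma> t y \<oplus> (-1) \<odot> \<sigma> t a" for t
        using yc ac by (simp add: diff_eq_scale dyn_add dyn_scale)
      have eql: "\<psi> (m \<otimes> \<sigma> t (y \<ominus> a)) = \<psi> (m \<otimes> \<sigma> t y) - exp (\<i> * of_real (t * k)) * \<psi> (m \<otimes> a)" for t
        unfolding sd sa using yc ac mc lin
        by (simp add: r_distr scale_mult_right scale_scale lin_fun_add lin_fun_scale)
      have eqr: "\<psi> (\<sigma> t (y \<ominus> a) \<otimes> m) = \<psi> (\<sigma> t y \<otimes> m) - exp (\<i> * of_real (t * k)) * \<psi> (a \<otimes> m)" for t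
        unfolding sd sa using yc ac mc lin
        by (simp add: l_distr scale_mult_left scale_scale lin_fun_add lin_fun_scale)
      show ?thesis
      proof (rule periodic_strip_bound[OF fh])
        fix t :: real
        have "f (t + 2 * pi) = f (complex_of_real (2 * pi + t))" by (simp add: add.commute)
        then show "f (t + 2 * pi) = f t"
          using per[of "\<sigma> t y"] yc by (simp only: ft dyn_group[OF yc] dyn_closed)
        show "cmod (f t - exp (\<i> * of_real (t * k)) * \<psi> (m \<otimes> a)) \<le> 2 * (nrm A m * e)"
          using bnd(1)[of "y \<ominus> a" t] yc ac small unfolding ft eql by simp
        show "cmod (f (t + \<i> * \<beta>) - exp (\<i> * of_real (t * k)) * \<psi> (a \<otimes> m)) \<le> 2 * (nrm A m * e)"
          using bnd(2)[of "y \<ominus> a" t] yc ac small unfolding up eqr by simp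
      qed
    qed
    have "cmod (\<psi> (m \<otimes> a) - exp (of_int k * \<beta>) * \<psi> (a \<otimes> m)) \<le> 0"
    proof (rule tendsto_lowerbound)
      show "((\<lambda>e. (2 * (nrm A m * e)) * (1 + exp (of_int k * \<beta>))) \<longlongrightarrow> 0) (at_right (0::real))"
        by (auto intro!: tendsto_eq_intros)
      show "\<forall>\<^sub>F e in at_right (0::real). cmod (\<psi> (m \<otimes> a) - exp (of_int k * \<beta>) * \<psi> (a \<otimes> m))
          \<le> (2 * (nrm A m * e)) * (1 + exp (of_int k * \<beta>))"
        using eventually_at_right_less by (rule eventually_mono) (rule approx)
    qed simp
    then show ?thesis by simp
  qed
  have "bdd_fun A (exp (of_int k * \<beta>) * (2 * nrm A a)) (\<lambda>y. exp (of_int k * \<beta>) * \<psi> (a \<otimes> y))"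
    using bdl[OF ac] unfolding bdd_fun_def lin_fun_def
    by (auto simp: norm_mult algebra_simps)
  from eq_on_M[OF bdr[OF ac] this main b] show ?thesis by simp
qed

end

section \<open>The groupoid generated by the two odometers\<close>

text \<open>The edges \<open>e\<^sub>i\<^sub>,\<^sub>i\<^sub>,\<^sub>0\<close> and \<open>e\<^sub>i\<^sub>,\<^sub>i\<^sub>,\<^sub>1\<close> are binary digits: the \<open>n\<close>-th power of \<open>f\<^bsub>a\<^sub>i\<^esub>\<close> adds
  \<open>n\<close> to the digit, and the carry is the exponent of the restriction.\<close>

fun turn :: "int \<Rightarrow> edge \<Rightarrow> edge" where
  "turn n e110 = (if even n then e110 else e111)"
| "turn n e111 = (if even n then e111 else e110)"
| "turn n e220 = (if even n then e220 else e221)"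
| "turn n e221 = (if even n then e221 else e220)"
| "turn n e = e"

fun carry :: "int \<Rightarrow> edge \<Rightarrow> int" where
  "carry n e110 = n div 2"
| "carry n e111 = (n + 1) div 2"
| "carry n e120 = 0"
| "carry n e210 = n"
| "carry n e211 = n"
| "carry n e220 = n div 2"
| "carry n e221 = (n + 1) div 2"

fun odo :: "int \<Rightarrow> edge list \<Rightarrow> edge list" where
  "odo n [] = []"
| "odo n (e # es) = turn n e # odo (carry n e) es"

definition gpow :: "nat \<Rightarrow> int \<Rightarrow> (nat, edge) piso" where
  "gpow v n = \<lparr>pdom = v, pcod = v, pact = (\<lambda>\<mu>\<in>paths exE v. (v, odo n (snd \<mu>)))\<rparr>"

lemma exE_simps [simp]:
  "verts exE = {1, 2}" "arcs exE = UNIV" "tail exE = edge_s" "head exE = edge_r"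
  by (simp_all add: exE_def)

lemma edge_r_verts [simp]: "edge_r e = 1 \<or> edge_r e = 2" "edge_s e = 1 \<or> edge_s e = 2"
  by (cases e; simp)+

lemma turn_ends [simp]: "edge_r (turn n e) = edge_r e" "edge_s (turn n e) = edge_s e"
  by (cases e; simp)+

lemma turn_zero [simp]: "turn 0 e = e" and carry_zero [simp]: "carry 0 e = 0"
  by (cases e; simp)+

lemma turn_turn: "turn m (turn n e) = turn (m + n) e"
  by (cases e) auto

text \<open>The cocycle rule for the restriction of a product, with exponents added.\<close>

lemma carry_turn: "carry m (turn n e) + carry n e = carry (m + n) e"
  by (cases e) (auto, presburger+)

lemma odo_zero [simp]: "odo 0 es = es"
  by (induction es) auto

lemma odo_odo: "odo m (odo n es) = odo (m + n) es"
  by (induction es arbitrary: m n) (auto simp: turn_turn carry_turn)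

lemma odo_length [simp]: "length (odo n es) = length es"
  by (induction es arbitrary: n) auto

lemma odo_eq_Nil [simp]: "odo n es = [] \<longleftrightarrow> es = []"
  using odo_length[of n es] by (metis length_0_conv)

text \<open>The exponent \<open>k\<close> is the carry out of the prefix. That the image of a prefix
  does not depend on what follows is the condition on one-edge extensions in
  \<open>PIso\<close>.\<close>

lemma odo_append: "\<exists>k. odo n (es @ fs) = odo n es @ odo k fs"
  by (induction es arbitrary: n) auto

lemma odo_minus [simp]: "odo n (odo (- n) es) = es" "odo (- n) (odo n es) = es"
  by (simp_all add: odo_odo)

lemma is_epath_odo [simp]: "is_epath exE (v, odo n es) \<longleftrightarrow> is_epath exE (v, es)"
  by (induction es arbitrary: v n) auto

lemma is_epath_verts: "is_epath exE (v, es) \<Longrightarrow> v = 1 \<or> v = 2"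
  using edge_r_verts(1) by (cases es) auto

lemma is_epath_snoc:
  "is_epath exE (v, es @ [f]) \<longleftrightarrow> is_epath exE (v, es) \<and> edge_r f = psource exE (v, es)"
proof (induction es arbitrary: v)
  case Nil
  then show ?case using edge_r_verts(1)[of f] edge_r_verts(2)[of f] by (auto simp: psource_def)
qed (auto simp: psource_def)

lemma psource_odo [simp]: "psource exE (v, odo n es) = psource exE (v, es)"
  by (induction es arbitrary: v n) (auto simp: psource_def)

lemma paths_exE: "\<mu> \<in> paths exE v \<longleftrightarrow> is_epath exE \<mu> \<and> fst \<mu> = v"
  by (auto simp: paths_def paths_len_def)

lemma pair_in_paths [simp]: "(w, es) \<in> paths exE v \<longleftrightarrow> w = v \<and> is_epath exE (v, es)"
  by (auto simp: paths_exE)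

lemma gpow_simps [simp]:
  "pdom (gpow v n) = v" "pcod (gpow v n) = v"
  "is_epath exE (v, es) \<Longrightarrow> pact (gpow v n) (v, es) = (v, odo n es)"
  by (simp_all add: gpow_def)

lemma gpow_bij:
  "bij_betw (pact (gpow v n)) (paths_len exE v k) (paths_len exE v k)"
  by (rule bij_betw_byWitness[of _ "pact (gpow v (- n))"])
    (auto simp: paths_len_def)

lemma gpow_bij_paths:
  "bij_betw (pact (gpow v n)) (paths exE v) (paths exE v)"
  by (rule bij_betw_byWitness[of _ "pact (gpow v (- n))"])
    auto

lemma gpow_PIso:
  assumes v: "v = 1 \<or> v = 2"
  shows "gpow v n \<in> PIso exE"
proof -
  have "\<exists>f. edge_r f = psource exE (pact (gpow v n) \<mu>) \<and>
      pact (gpow v n) (pconcat \<mu> (edge_path exE e)) = pconcat (pact (gpow v n) \<mu>) (edge_path exE f)"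
    if \<mu>: "\<mu> \<in> paths exE v" and e: "edge_r e = psource exE \<mu>" for \<mu> e
  proof -
    obtain es where es: "\<mu> = (v, es)" "is_epath exE (v, es)" using \<mu> by (cases \<mu>) auto
    then have ee: "is_epath exE (v, es @ [e])" using e by (simp add: is_epath_snoc)
    obtain k where k: "odo n (es @ [e]) = odo n es @ [turn k e]" using odo_append[of n es "[e]"] by auto
    from ee have "is_epath exE (v, odo n (es @ [e]))" by simp
    then have "edge_r (turn k e) = psource exE (v, es)" unfolding k is_epath_snoc by simp
    with es ee k show ?thesis
      by (intro exI[of _ "turn k e"]) (simp add: pconcat_def edge_path_def)
  qed
  then show ?thesis using v gpow_bij gpow_bij_paths
    by (auto simp: PIso_def) (auto simp: gpow_def)
qed

lemma gpow_zero: "piso_id exE v = gpow v 0"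
  by (auto simp: piso_id_def gpow_def paths_exE intro!: restrict_ext)

lemma gpow_comp: "piso_comp exE (gpow v m) (gpow v n) = gpow v (m + n)"
  by (auto simp: piso_comp_def gpow_def compose_def paths_exE odo_odo intro!: restrict_ext)

lemma gpow_inv: "piso_inv exE (gpow v n) = gpow v (- n)"
proof -
  have "inv_into (paths exE v) (pact (gpow v n)) \<mu> = (v, odo (- n) (snd \<mu>))" if "\<mu> \<in> paths exE v" for \<mu>
  proof (rule inv_into_f_eq)
    show "inj_on (pact (gpow v n)) (paths exE v)" using gpow_bij_paths by (simp add: bij_betw_def)
  qed (use that in \<open>auto simp: paths_exE\<close>)
  then show ?thesis unfolding piso_inv_def by (auto simp: gpow_def intro!: restrict_ext)
qed

text \<open>With exponent 1, the digit 0 becomes 1 with carry 0, the digit 1 becomes 0 with carry 1,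
  and \<open>e120\<close> ends the process.\<close>

lemma act1_odo: "is_epath exE (1, es) \<Longrightarrow> act1 es = odo 1 es"
proof (induction es rule: act1.induct)
  case (4 es)
  then show ?case by simp
qed auto

lemma act2_odo: "is_epath exE (2, es) \<Longrightarrow> act2 es = odo 1 es"
  by (induction es rule: act2.induct) (auto simp: act1_odo simp flip: One_nat_def)

lemma fa1_gpow: "fa1 = gpow 1 1"
  by (auto simp: fa1_def gpow_def paths_exE intro!: restrict_ext act1_odo)

lemma fa2_gpow: "fa2 = gpow 2 1"
  by (auto simp: fa2_def gpow_def paths_exE intro!: restrict_ext act2_odo)

definition gpows :: "(nat, edge) piso set" where
  "gpows = {gpow v n | v n. v = 1 \<or> v = 2}"

lemma gpow_in_gpows: "v = 1 \<or> v = 2 \<Longrightarrow> gpow v n \<in> gpows"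
  by (auto simp: gpows_def)

lemma subgroupoid_gpows: "subgroupoid exE gpows"
proof -
  have "piso_comp exE g h \<in> gpows" if "g \<in> gpows" "h \<in> gpows" "pdom g = pcod h" for g h
    using that unfolding gpows_def by (clarsimp simp: gpow_comp) blast
  moreover have "piso_inv exE g \<in> gpows" if "g \<in> gpows" for g
    using that unfolding gpows_def by (clarsimp simp: gpow_inv) blast
  ultimately show ?thesis
    by (auto simp: subgroupoid_def gpow_zero gpow_in_gpows) (auto simp: gpows_def gpow_PIso)
qed

text \<open>The powers form a subgroupoid containing the generators; conversely every such
  subgroupoid contains the nonnegative powers by composition and the negative ones by
  inversion.\<close>

lemma exG_gpows: "exG = gpows"
proof
  have "{fa1, fa2, piso_id exE 1, piso_id exE 2} \<subseteq> gpows"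
    by (auto simp: gpows_def fa1_gpow fa2_gpow gpow_zero)
  then show "exG \<subseteq> gpows"
    using subgroupoid_gpows unfolding exG_def generated_subgroupoid_def by blast
  have "gpow v n \<in> H" if H: "subgroupoid exE H" "{fa1, fa2, piso_id exE 1, piso_id exE 2} \<subseteq> H"
    and v: "v = 1 \<or> v = 2" for H v n
  proof -
    have one: "gpow v 1 \<in> H" using H(2) v by (auto simp: fa1_gpow fa2_gpow)
    have nat: "gpow v (int k) \<in> H" for k
    proof (induction k)
      case 0
      then show ?case using H(2) v by (auto simp: gpow_zero)
    next
      case (Suc k)
      then have "piso_comp exE (gpow v 1) (gpow v (int k)) \<in> H"
        using H(1) one by (simp add: subgroupoid_def)
      then show ?case by (simp add: gpow_comp)
    qed
    have "gpow v (- int k) \<in> H" for k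
      using H(1) nat[of k] by (simp add: subgroupoid_def flip: gpow_inv)
    with nat show ?thesis by (cases n rule: int_cases2) auto
  qed
  then show "gpows \<subseteq> exG"
    unfolding exG_def generated_subgroupoid_def gpows_def by blast
qed

lemma exG_cases:
  assumes "g \<in> exG"
  obtains v n where "v = 1 \<or> v = 2" "g = gpow v n"
  using assms by (auto simp: exG_gpows gpows_def)

lemma gpow_in_exG [simp]: "v = 1 \<or> v = 2 \<Longrightarrow> gpow v n \<in> exG"
  by (auto simp: exG_gpows gpows_def)

lemma gpow_edge_path: "edge_r e = v \<Longrightarrow> pact (gpow v n) (edge_path exE e) = (v, [turn n e])"
  using edge_r_verts(2)[of e] by (auto simp: edge_path_def)

lemma edge_act_gpow: "edge_r e = v \<Longrightarrow> edge_act exE (gpow v n) e = turn n e"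
  by (simp add: edge_act_def gpow_edge_path)

text \<open>Uniqueness compares maps rather than exponents: a restriction acts on the paths with
  range \<open>edge_s e\<close> exactly as the carried power does, and records of extensional maps
  with equal action are equal.\<close>

lemma is_restriction_gpow_iff:
  assumes "edge_r e = v"
  shows "is_restriction exE exG (gpow v n) e h \<longleftrightarrow> h = gpow (edge_s e) (carry n e)"
proof
  show "is_restriction exE exG (gpow v n) e h" if "h = gpow (edge_s e) (carry n e)"
    using assms that edge_r_verts(2)[of e]
    by (auto simp: is_restriction_def gpow_edge_path psource_def pconcat_def paths_exE edge_path_def)
  assume h: "is_restriction exE exG (gpow v n) e h"
  then obtain w m where w: "h = gpow w m" "w = edge_s e"
    by (auto simp: is_restriction_def elim: exG_cases)
  have "odo m es = odo (carry n e) es" if "is_epath exE (w, es)" for es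
  proof -
    have "(w, es) \<in> paths exE (tail exE e)" using that w by simp
    then have "pact (gpow v n) (pconcat (edge_path exE e) (w, es))
        = pconcat (pact (gpow v n) (edge_path exE e)) (pact h (w, es))"
      using h unfolding is_restriction_def by blast
    then show ?thesis using that assms w by (simp add: gpow_edge_path) (simp add: pconcat_def edge_path_def)
  qed
  then show "h = gpow (edge_s e) (carry n e)"
    unfolding w by (auto simp: gpow_def paths_exE intro!: restrict_ext)
qed

lemma restriction_gpow: "edge_r e = v \<Longrightarrow> restriction exE exG (gpow v n) e = gpow (edge_s e) (carry n e)"
  by (simp add: restriction_def is_restriction_gpow_iff)

lemma exG_acts_self_similarly: "acts_self_similarly exE exG"
  unfolding acts_self_similarly_def
proof (intro conjI ballI impI)
  show "subgroupoid exE exG" by (simp add: exG_gpows subgroupoid_gpows)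
  fix g e assume "g \<in> exG" "e \<in> arcs exE" "head exE e = pdom g"
  then show "\<exists>!h. is_restriction exE exG g e h"
    by (auto simp: is_restriction_gpow_iff elim!: exG_cases)
qed

section \<open>Uniqueness and values\<close>

text \<open>Keeps the vertex \<open>1\<close> in the form in which the rules for vertices match
  it.\<close>

declare One_nat_def [simp del]

lemma arcs_into [simp]:
  "{e. edge_r e = 1} = {e110, e111, e120}" "{e. edge_r e = 2} = {e210, e211, e220, e221}"
proof -
  have "edge_r e = 1 \<longleftrightarrow> e \<in> {e110, e111, e120}" "edge_r e = 2 \<longleftrightarrow> e \<in> {e210, e211, e220, e221}" for e
    by (cases e; simp)+
  then show "{e. edge_r e = 1} = {e110, e111, e120}" "{e. edge_r e = 2} = {e210, e211, e220, e221}"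
    by blast+
qed

lemma finite_edge: "finite (UNIV :: edge set)"
proof (rule finite_subset)
  show "(UNIV :: edge set) \<subseteq> {e110, e111, e120, e210, e211, e220, e221}"
  proof
    fix e :: edge
    show "e \<in> {e110, e111, e120, e210, e211, e220, e221}" by (cases e) auto
  qed
qed simp

lemma finite_arcs_into [simp]: "finite {e. edge_r e = v}"
  using finite_edge by (rule rev_finite_subset) simp

section \<open>Words in the generators of a self-similar family\<close>

locale ss_family = cstar_algebra A for A :: "'a cstar" (structure) +
  fixes u :: "(nat, edge) piso \<Rightarrow> 'a" and p :: "nat \<Rightarrow> 'a" and s :: "edge \<Rightarrow> 'a"
  assumes fam: "toeplitz_family exE exG A u p s"
begin

abbreviation gens :: "'a set" where "gens \<equiv> u ` exG \<union> p ` verts exE \<union> s ` arcs exE"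

abbreviation U :: "nat \<Rightarrow> int \<Rightarrow> 'a" where "U v n \<equiv> u (gpow v n)"

lemma rep_u: "groupoid_rep exE exG A u" and tck: "TCK_family exE A p s"
  and u_id: "v = 1 \<or> v = 2 \<Longrightarrow> U v 0 = p v"
  and sum_p: "(\<Oplus>v\<in>verts exE. p v) = \<one>"
  and u_s: "g \<in> exG \<Longrightarrow> u g \<otimes> s e = (if pdom g = head exE e
      then s (edge_act exE g e) \<otimes> u (restriction exE exG g e) else \<zero>)"
  using fam unfolding toeplitz_family_def by (auto simp: gpow_zero)

lemma p_proj: "v = 1 \<or> v = 2 \<Longrightarrow> projection A (p v)"
  using tck by (auto simp: TCK_family_def)

lemma p_closed [simp]: "v = 1 \<or> v = 2 \<Longrightarrow> p v \<in> carrier A"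
  using p_proj by (auto simp: projection_def)

lemma p_star: "v = 1 \<or> v = 2 \<Longrightarrow> adj A (p v) = p v"
  using p_proj by (auto simp: projection_def)

lemma s_pi: "s e \<in> carrier A" "s e \<otimes> adj A (s e) \<otimes> s e = s e"
  and s_star_s: "adj A (s e) \<otimes> s e = p (edge_s e)"
  using tck by (auto simp: TCK_family_def partial_isometry_def)

declare s_pi(1) [simp]

lemma u_pi: "g \<in> exG \<Longrightarrow> u g \<in> carrier A" "g \<in> exG \<Longrightarrow> u g \<otimes> adj A (u g) \<otimes> u g = u g"
  using rep_u by (auto simp: groupoid_rep_def partial_isometry_def)

lemma U_closed [simp]: "v = 1 \<or> v = 2 \<Longrightarrow> U v n \<in> carrier A"
  by (simp add: u_pi)

lemma gens_closed: "gens \<subseteq> carrier A"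
  using u_pi by auto

lemma U_mult:
  assumes "v = 1 \<or> v = 2" "w = 1 \<or> w = 2"
  shows "U v m \<otimes> U w n = (if v = w then U v (m + n) else \<zero>)"
proof -
  have "U v m \<otimes> U w n = (if pdom (gpow v m) = pcod (gpow w n)
      then u (piso_comp exE (gpow v m) (gpow w n)) else \<zero>)"
    using rep_u gpow_in_exG[OF assms(1)] gpow_in_exG[OF assms(2)] unfolding groupoid_rep_def by blast
  then show ?thesis by (simp add: gpow_comp)
qed

text \<open>Uniqueness of inverses: \<open>U v (- n)\<close> and the adjoint are inverse to
  \<open>U v n\<close> with respect to the same projection, so \<open>adj A (U v n) = U v (- n)
  \<otimes> U v n \<otimes> adj A (U v n) = U v (- n)\<close>.\<close>

lemma U_star:
  assumes v: "v = 1 \<or> v = 2" shows "adj A (U v n) = U v (- n)"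
proof -
  have g: "gpow v n \<in> exG" using v by simp
  have i: "adj A (U v n) \<otimes> U v n = U v 0" "U v n \<otimes> adj A (U v n) = U v 0"
    using rep_u g v unfolding groupoid_rep_def by (force simp: gpow_zero)+
  have c: "U v n \<in> carrier A" "adj A (U v n) \<in> carrier A" "U v (- n) \<in> carrier A" using v by auto
  have "adj A (U v n) = adj A (U v n \<otimes> adj A (U v n) \<otimes> U v n)" using u_pi(2)[OF g] by simp
  also have "\<dots> = (adj A (U v n) \<otimes> U v n) \<otimes> adj A (U v n)" using c by (simp add: star_mult m_assoc)
  also have "\<dots> = (U v (- n) \<otimes> U v n) \<otimes> adj A (U v n)" using v by (simp add: i U_mult)
  also have "\<dots> = U v (- n) \<otimes> (U v n \<otimes> adj A (U v n))" using c by (simp add: m_assoc)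
  also have "\<dots> = U v (- n)" using v by (simp add: i U_mult)
  finally show ?thesis .
qed

lemma U_s:
  assumes "v = 1 \<or> v = 2"
  shows "U v n \<otimes> s e = (if edge_r e = v then s (turn n e) \<otimes> U (edge_s e) (carry n e) else \<zero>)"
  using assms by (auto simp: u_s edge_act_gpow restriction_gpow)

lemma edge_verts: "edge_s e = 1 \<or> edge_s e = 2" "edge_r e = 1 \<or> edge_r e = 2"
  by (cases e; simp)+

lemma edge_closed [simp]: "U (edge_s e) n \<in> carrier A" "U (edge_r e) n \<in> carrier A"
  "p (edge_s e) \<in> carrier A" "p (edge_r e) \<in> carrier A"
  using edge_verts[of e] by auto

lemma s_p: "s e \<otimes> p (edge_s e) = s e"
  using s_pi(2)[of e] by (simp add: m_assoc s_star_s)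

lemma p_s: "p (edge_r e) \<otimes> s e = s e"
  using U_s[OF edge_verts(2), of e 0 e] by (simp add: u_id[OF edge_verts(1)] u_id[OF edge_verts(2)] s_p)

lemma p_sum: "p 1 \<oplus> p 2 = \<one>"
proof -
  have "finsum A p {1, 2} = \<one>" using sum_p by simp
  then show ?thesis by (subst (asm) finsum_insert) auto
qed

text \<open>The edge list need not be a path: a mismatch between consecutive edges makes the product
  0, so no path condition has to be carried along. The empty product is the unit, whereas
  \<open>path_elem\<close> gives a vertex projection there.\<close>

definition sw :: "edge list \<Rightarrow> 'a" where "sw es = foldr (\<lambda>e x. s e \<otimes> x) es \<one>"

lemma sw_simps [simp]: "sw [] = \<one>" "sw (e # es) = s e \<otimes> sw es"
  by (simp_all add: sw_def)

lemma sw_closed [simp]: "sw es \<in> carrier A"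
  by (induction es) auto

lemma sw_snoc: "sw (es @ [e]) = sw es \<otimes> s e"
  by (induction es) (auto simp: m_assoc)

definition word :: "edge list \<Rightarrow> nat \<Rightarrow> int \<Rightarrow> edge list \<Rightarrow> 'a" where
  "word es v n fs = sw es \<otimes> U v n \<otimes> adj A (sw fs)"

text \<open>Zero is included because a generator may annihilate a word.\<close>

definition words :: "'a set" where
  "words = insert \<zero> {word es v n fs | es v n fs. v = 1 \<or> v = 2}"

lemma word_closed [simp]: "v = 1 \<or> v = 2 \<Longrightarrow> word es v n fs \<in> carrier A"
  by (simp add: word_def)

lemma words_closed: "words \<subseteq> carrier A"
  by (auto simp: words_def)

lemma wordsI: "v = 1 \<or> v = 2 \<Longrightarrow> word es v n fs \<in> words" and zero_words: "\<zero> \<in> words"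
  by (auto simp: words_def)

lemma word_Cons: "v = 1 \<or> v = 2 \<Longrightarrow> word (e # es) v n fs = s e \<otimes> word es v n fs"
  by (simp add: word_def m_assoc)

lemma s_words: "x \<in> words \<Longrightarrow> s e \<otimes> x \<in> words"
proof (cases "x = \<zero>")
  case False
  assume "x \<in> words"
  with False obtain es v n fs where x: "x = word es v n fs" and v: "v = 1 \<or> v = 2"
    by (auto simp: words_def)
  have "word (e # es) v n fs \<in> words" by (rule wordsI[OF v])
  then show ?thesis by (simp only: x word_Cons[OF v])
qed (simp add: zero_words)

text \<open>\<open>U w k\<close> travels to the right: past \<open>s e\<close> it becomes the
  carried power at the source of \<open>e\<close>, which is why the induction generalizes over
  \<open>w\<close> and \<open>k\<close>; finally it merges with the middle factor.\<close>

lemma U_words: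
  assumes w: "w = 1 \<or> w = 2" and x: "x \<in> words" shows "U w k \<otimes> x \<in> words"
proof -
  have "U w k \<otimes> word es v n fs \<in> words" if v: "v = 1 \<or> v = 2" for es v n fs
    using w
  proof (induction es arbitrary: w k)
    case Nil
    have "U w k \<otimes> word [] v n fs = U w k \<otimes> U v n \<otimes> adj A (sw fs)"
      using v Nil by (simp add: word_def m_assoc)
    also have "\<dots> = (if w = v then word [] v (k + n) fs else \<zero>)"
      using v Nil by (simp add: U_mult word_def)
    finally show ?case using v by (auto simp: wordsI zero_words)
  next
    case (Cons e es)
    have "U w k \<otimes> word (e # es) v n fs = (U w k \<otimes> s e) \<otimes> word es v n fs"
      using v Cons.prems by (simp add: word_Cons m_assoc)
    also have "\<dots> = (if edge_r e = w then s (turn k e) \<otimes> (U (edge_s e) (carry k e) \<otimes> word es v n fs) else \<zero>)"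
      using v Cons.prems by (simp add: U_s m_assoc)
    finally show ?case using Cons.IH[OF edge_verts(1)] by (auto simp: s_words zero_words)
  qed
  with x w show ?thesis by (auto simp: words_def)
qed

text \<open>Modulo \<open>N\<close>, \<open>adj A (s e)\<close> cancels a leading edge
  \<open>e\<close> and annihilates a word with another leading edge. If there is no leading edge, it
  is moved through \<open>U v n\<close> and lengthens the right half of the word.\<close>

lemma star_s_words:
  assumes N: "ideal N A" and orth: "\<And>e f. e \<noteq> f \<Longrightarrow> adj A (s e) \<otimes> s f \<in> N" and x: "x \<in> words"
  shows "\<exists>w\<in>words. adj A (s e) \<otimes> x \<ominus> w \<in> N"
proof -
  interpret N: ideal N A by (rule N)
  have z: "y \<ominus> y \<in> N" if "y \<in> carrier A" for y using that by (simp add: r_neg a_minus_def)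
  have "\<exists>w\<in>words. adj A (s e) \<otimes> word es v n fs \<ominus> w \<in> N" if v: "v = 1 \<or> v = 2" for es v n fs
  proof (cases es)
    case Nil
    have c: "U v n \<in> carrier A" using v by simp
    have "adj A (s e) \<otimes> word es v n fs = adj A (U v (- n) \<otimes> s e) \<otimes> adj A (sw fs)"
      using v U_star[OF v, of "- n"] c by (simp add: Nil word_def star_mult m_assoc)
    also have "\<dots> \<in> words"
    proof (cases "edge_r e = v")
      case True
      let ?f = "turn (- n) e" and ?k = "carry (- n) e"
      have "adj A (U v (- n) \<otimes> s e) \<otimes> adj A (sw fs) = adj A (U (edge_s e) ?k) \<otimes> adj A (sw fs \<otimes> s ?f)"
        using True v by (simp add: U_s star_mult m_assoc)
      also have "\<dots> = word [] (edge_s e) (- ?k) (fs @ [?f])"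
        by (simp add: word_def U_star[OF edge_verts(1)] sw_snoc)
      finally show ?thesis by (simp add: wordsI[OF edge_verts(1)])
    next
      case False
      then show ?thesis using v by (simp add: U_s zero_words)
    qed
    finally show ?thesis using z words_closed by blast
  next
    case (Cons f es')
    have eq: "adj A (s e) \<otimes> word es v n fs = (adj A (s e) \<otimes> s f) \<otimes> word es' v n fs"
      using v by (simp add: Cons word_Cons m_assoc)
    show ?thesis
    proof (cases "e = f")
      case True
      then have "adj A (s e) \<otimes> word es v n fs = U (edge_s e) 0 \<otimes> word es' v n fs"
        unfolding eq by (simp add: s_star_s u_id[OF edge_verts(1)])
      then show ?thesis using z words_closed U_words[OF edge_verts(1) wordsI[OF v]] by (metis subsetD)
    next
      case False
      then have "adj A (s e) \<otimes> word es v n fs \<in> N"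
        unfolding eq by (intro N.I_r_closed orth word_closed v)
      then show ?thesis using v by (intro bexI[of _ \<zero>]) (auto simp: zero_words a_minus_def)
    qed
  qed
  moreover have "\<exists>w\<in>words. adj A (s e) \<otimes> \<zero> \<ominus> w \<in> N"
    using zero_words z[of \<zero>] by (intro bexI[of _ \<zero>]) auto
  ultimately show ?thesis using x unfolding words_def by blast
qed

text \<open>Modulo \<open>N\<close>, generators and their adjoints map words to words, so an
  induction over the monomial applies; closure of \<open>N\<close> under left multiplication keeps
  earlier errors inside it.\<close>

lemma mon_words:
  assumes N: "ideal N A" and orth: "\<And>e f. e \<noteq> f \<Longrightarrow> adj A (s e) \<otimes> s f \<in> N"
    and m: "m \<in> mon A gens" and x: "x \<in> words"
  shows "\<exists>w\<in>words. m \<otimes> x \<ominus> w \<in> N"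
proof -
  interpret N: ideal N A by (rule N)
  have z: "y \<ominus> y \<in> N" if "y \<in> carrier A" for y using that by (simp add: r_neg a_minus_def)
  have Uact: "\<exists>w\<in>words. U v n \<otimes> y \<ominus> w \<in> N" if "y \<in> words" "v = 1 \<or> v = 2" for v n y
    using U_words[OF that(2,1)] z words_closed by blast
  have S: "\<exists>w\<in>words. s e \<otimes> y \<ominus> w \<in> N" if "y \<in> words" for e y
    using s_words[OF that] z words_closed by blast
  have act: "\<exists>w\<in>words. g \<otimes> y \<ominus> w \<in> N" "\<exists>w\<in>words. adj A g \<otimes> y \<ominus> w \<in> N"
    if g: "g \<in> gens" and y: "y \<in> words" for g y
  proof -
    consider (U) v n where "v = 1 \<or> v = 2" "g = U v n" | (s) e where "g = s e"
    proof -
      from g consider h where "h \<in> exG" "g = u h" | w where "w = 1 \<or> w = 2" "g = p w" | e where "g = s e"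
        by auto
      then show thesis
      proof cases
        case 1
        then show thesis using that(1) by (metis exG_cases)
      next
        case 2
        then show thesis using that(1)[of w 0] by (simp add: u_id)
      qed (rule that(2))
    qed
    then have "(\<exists>w\<in>words. g \<otimes> y \<ominus> w \<in> N) \<and> (\<exists>w\<in>words. adj A g \<otimes> y \<ominus> w \<in> N)"
    proof cases
      case U
      then show ?thesis using Uact[OF y] by (simp add: U_star)
    next
      case s
      then show ?thesis using S star_s_words[OF N orth] y by auto
    qed
    then show "\<exists>w\<in>words. g \<otimes> y \<ominus> w \<in> N" "\<exists>w\<in>words. adj A g \<otimes> y \<ominus> w \<in> N" by auto
  qed
  have step: "\<exists>w\<in>words. g \<otimes> m \<otimes> x \<ominus> w \<in> N"
    if g: "g \<in> carrier A" "\<And>y. y \<in> words \<Longrightarrow> \<exists>w\<in>words. g \<otimes> y \<ominus> w \<in> N"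
      and m: "m \<in> carrier A" "\<exists>w\<in>words. m \<otimes> x \<ominus> w \<in> N" for g m
  proof -
    have xc: "x \<in> carrier A" using x words_closed by blast
    obtain y where y: "y \<in> words" "m \<otimes> x \<ominus> y \<in> N" using m(2) by blast
    obtain w where w: "w \<in> words" "g \<otimes> y \<ominus> w \<in> N" using g(2)[OF y(1)] by blast
    have c: "y \<in> carrier A" "w \<in> carrier A" using y w words_closed by auto
    have "g \<otimes> m \<otimes> x \<ominus> w = g \<otimes> (m \<otimes> x \<ominus> y) \<oplus> (g \<otimes> y \<ominus> w)"
      using g(1) m(1) xc c by algebra
    moreover have "g \<otimes> (m \<otimes> x \<ominus> y) \<oplus> (g \<otimes> y \<ominus> w) \<in> N"
      using y w g(1) by (intro N.a_closed N.I_l_closed) auto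
    ultimately have "g \<otimes> m \<otimes> x \<ominus> w \<in> N" by simp
    then show ?thesis using w(1) by blast
  qed
  from m show ?thesis
  proof (induction m rule: mon.induct)
    case one
    have "x \<in> carrier A" using x words_closed by blast
    then show ?case using x z by (intro bexI[of _ x]) simp_all
  next
    case (gen g m)
    then show ?case using act(1) gens_closed mon_closed[OF gens_closed] by (intro step) auto
  next
    case (star g m)
    then show ?case using act(2) gens_closed mon_closed[OF gens_closed] by (intro step) auto
  qed
qed

end

text \<open>The Perron-Frobenius eigenvalue of the matrix with rows (2, 1) and (2, 2), whose entries
  count the edges with given range and source; \<open>ln rho\<close> is the inverse
  temperature.\<close>

definition rho :: real where "rho = 2 + sqrt 2"

lemma rho_gt_1: "rho > 1" by (simp add: rho_def add_pos_nonneg)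

section \<open>Functionals satisfying the KMS relations on generators\<close>

context ss_family
begin

text \<open>What a KMS state of the quotient becomes on the algebra above it. The dynamics enters
  only through the factor \<open>rho\<close> for the generators of degree 1 and the factor 1 for
  those of degree 0.\<close>

definition CK_KMS :: "('a \<Rightarrow> complex) \<Rightarrow> bool" where
  "CK_KMS (\<phi> :: 'a \<Rightarrow> complex) \<longleftrightarrow> state_on A \<phi> \<and>
     (\<forall>v. \<forall>b\<in>carrier A. \<forall>c\<in>carrier A. v = 1 \<or> v = 2 \<longrightarrow>
        \<phi> (c \<otimes> (p v \<ominus> range_sum exE A s v) \<otimes> b) = 0) \<and>
     (\<forall>v n. \<forall>x\<in>carrier A. v = 1 \<or> v = 2 \<longrightarrow> \<phi> (x \<otimes> U v n) = \<phi> (U v n \<otimes> x)) \<and>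
     (\<forall>e. \<forall>x\<in>carrier A. \<phi> (x \<otimes> s e) = complex_of_real rho * \<phi> (s e \<otimes> x))"

text \<open>For linear functionals, the largest two-sided ideal on which all members of
  \<open>\<Phi>\<close> vanish.\<close>

definition null_ideal :: "('a \<Rightarrow> complex) set \<Rightarrow> 'a set" where
  "null_ideal \<Phi> = {x \<in> carrier A. \<forall>\<phi>\<in>\<Phi>. \<forall>b\<in>carrier A. \<forall>c\<in>carrier A. \<phi> (c \<otimes> x \<otimes> b) = 0}"

lemma null_idealD: "x \<in> null_ideal \<Phi> \<Longrightarrow> \<phi> \<in> \<Phi> \<Longrightarrow> c \<in> carrier A \<Longrightarrow> b \<in> carrier A \<Longrightarrow> \<phi> (c \<otimes> x \<otimes> b) = 0"
  by (simp add: null_ideal_def)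

lemma null_ideal_zero: "x \<in> null_ideal \<Phi> \<Longrightarrow> \<phi> \<in> \<Phi> \<Longrightarrow> \<phi> x = 0"
  using null_idealD[of x \<Phi> \<phi> \<one> \<one>] by (simp add: null_ideal_def)

lemma ideal_null_ideal:
  assumes "\<And>\<phi>. \<phi> \<in> \<Phi> \<Longrightarrow> lin_fun A \<phi>"
  shows "ideal (null_ideal \<Phi>) A"
proof (rule idealI)
  show "ring A" by (rule ring_axioms)
  show "subgroup (null_ideal \<Phi>) (add_monoid A)"
  proof (rule subgroup.intro)
    show "inv\<^bsub>add_monoid A\<^esub> x \<in> null_ideal \<Phi>" if "x \<in> null_ideal \<Phi>" for x
      using that assms unfolding a_inv_def[symmetric]
      by (auto simp: null_ideal_def l_minus r_minus lin_fun_minus)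
  qed (auto simp: null_ideal_def assms lin_fun_zero lin_fun_add l_distr r_distr)
  fix a x assume a: "a \<in> null_ideal \<Phi>" and x: "x \<in> carrier A"
  then have ac: "a \<in> carrier A" by (simp add: null_ideal_def)
  have "\<phi> (c \<otimes> (x \<otimes> a) \<otimes> b) = 0" "\<phi> (c \<otimes> (a \<otimes> x) \<otimes> b) = 0"
    if "\<phi> \<in> \<Phi>" "b \<in> carrier A" "c \<in> carrier A" for \<phi> b c
    using null_idealD[OF a that(1), of "c \<otimes> x" b] null_idealD[OF a that(1), of c "x \<otimes> b"] that x ac
    by (simp_all add: m_assoc)
  then show "x \<otimes> a \<in> null_ideal \<Phi>" "a \<otimes> x \<in> null_ideal \<Phi>"
    using x ac by (auto simp: null_ideal_def)
qed

lemma range_sum_lin: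
  assumes "lin_fun A \<phi>"
  shows "\<phi> (range_sum exE A s v) = (\<Sum>e | edge_r e = v. \<phi> (s e \<otimes> adj A (s e)))"
  unfolding range_sum_def using lin_fun_finsum[OF assms finite_arcs_into] by auto

lemma range_sum_closed [simp]: "range_sum exE A s v \<in> carrier A"
  unfolding range_sum_def by (rule finsum_closed) auto

text \<open>The \<open>case\<close> expression is the range of the word: the range of its first
  edge, or \<open>v\<close> if there is none.\<close>

lemma p_word:
  assumes v: "v = 1 \<or> v = 2" and w: "w = 1 \<or> w = 2"
  shows "p w \<otimes> word es v n fs = (if (case es of [] \<Rightarrow> v | e # _ \<Rightarrow> edge_r e) = w then word es v n fs else \<zero>)"
proof (cases es)
  case Nil
  have "p w \<otimes> word es v n fs = (p w \<otimes> U v n) \<otimes> adj A (sw fs)" using v w by (simp add: Nil word_def m_assoc)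
  also have "p w \<otimes> U v n = (if w = v then U v n else \<zero>)"
    using U_mult[OF w v, of 0 n] w by (simp add: u_id)
  finally show ?thesis using v by (auto simp: Nil word_def)
next
  case (Cons e es')
  have "p w \<otimes> word es v n fs = (p w \<otimes> s e) \<otimes> word es' v n fs" using v w by (simp add: Cons word_Cons m_assoc)
  also have "p w \<otimes> s e = (if edge_r e = w then s e else \<zero>)"
    using U_s[OF w, of 0 e] w by (simp add: u_id u_id[OF edge_verts(1)] s_p)
  finally show ?thesis using v by (auto simp: Cons word_Cons)
qed

context
  fixes \<phi> :: "'a \<Rightarrow> complex"
  assumes kms: "CK_KMS \<phi>"
begin

lemma kms_state: "state_on A \<phi>"
  and kms_CK: "v = 1 \<or> v = 2 \<Longrightarrow> b \<in> carrier A \<Longrightarrow> c \<in> carrier A \<Longrightarrow>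
      \<phi> (c \<otimes> (p v \<ominus> range_sum exE A s v) \<otimes> b) = 0"
  and kms_U: "v = 1 \<or> v = 2 \<Longrightarrow> x \<in> carrier A \<Longrightarrow> \<phi> (x \<otimes> U v n) = \<phi> (U v n \<otimes> x)"
  and kms_s: "x \<in> carrier A \<Longrightarrow> \<phi> (x \<otimes> s e) = rho * \<phi> (s e \<otimes> x)"
  using kms unfolding CK_KMS_def by blast+

lemmas kms_lin = state_lin[OF kms_state]

lemma kms_CK_expand:
  assumes v: "v = 1 \<or> v = 2" and bc: "b \<in> carrier A" "c \<in> carrier A"
  shows "\<phi> (c \<otimes> p v \<otimes> b) = (\<Sum>e | edge_r e = v. \<phi> (c \<otimes> (s e \<otimes> adj A (s e)) \<otimes> b))"
proof -
  note l = lin_fun_translate[OF kms_lin bc(2,1)]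
  have "\<phi> (c \<otimes> p v \<otimes> b) = \<phi> (c \<otimes> range_sum exE A s v \<otimes> b)"
    using kms_CK[OF v bc] lin_fun_diff[OF l, of "p v" "range_sum exE A s v"] v by simp
  then show ?thesis using range_sum_lin[OF l] by simp
qed

text \<open>The adjoint form of the relation for \<open>s e\<close>: \<open>\<phi>\<close> is
  Hermitian and \<open>rho\<close> is real.\<close>

lemma kms_star_s: "x \<in> carrier A \<Longrightarrow> \<phi> (adj A (s e) \<otimes> x) = rho * \<phi> (x \<otimes> adj A (s e))"
  using kms_s[of "adj A x" e] state_star[OF kms_state, of "adj A x \<otimes> s e"]
    state_star[OF kms_state, of "s e \<otimes> adj A x"] by (simp add: star_mult)

text \<open>Compressing \<open>p\<^sub>v = \<Sum>\<^sub>e s\<^sub>e s\<^sub>e\<^sup>*\<close> by \<open>s\<^sub>f\<close> leaves nonnegative terms for \<open>e \<noteq> f\<close> that sum to 0, so the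
  ranges are orthogonal as far as \<open>\<phi>\<close> can see. That they are orthogonal in the algebra itself would
  require the theory of positive elements.\<close>

lemma kms_orthogonal:
  assumes "e \<noteq> f" and b: "b \<in> carrier A" and c: "c \<in> carrier A"
  shows "\<phi> (c \<otimes> (adj A (s e) \<otimes> s f) \<otimes> b) = 0"
proof (cases "edge_r e = edge_r f")
  case True
  define y where "y = (\<lambda>e. adj A (s e) \<otimes> s f \<otimes> b)"
  have yc: "y e \<in> carrier A" for e using b by (simp add: y_def)
  let ?v = "edge_r f" and ?d = "adj A b \<otimes> adj A (s f)"
  have yy: "adj A (y e) \<otimes> y e = ?d \<otimes> (s e \<otimes> adj A (s e)) \<otimes> (s f \<otimes> b)" for e
    using b by (simp add: y_def star_mult m_assoc)
  have "?d \<otimes> p ?v \<otimes> (s f \<otimes> b) = adj A b \<otimes> adj A (s f) \<otimes> (p ?v \<otimes> s f) \<otimes> b"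
    using b by (simp add: m_assoc)
  also have "\<dots> = adj A (y f) \<otimes> y f"
  proof -
    have "adj A (y f) \<otimes> y f = adj A b \<otimes> adj A (s f) \<otimes> (s f \<otimes> adj A (s f) \<otimes> s f) \<otimes> b"
      unfolding yy using b by (simp add: m_assoc)
    then show ?thesis by (simp add: p_s s_pi(2))
  qed
  finally have "\<phi> (adj A (y f) \<otimes> y f) = (\<Sum>e | edge_r e = ?v. \<phi> (adj A (y e) \<otimes> y e))"
    using kms_CK_expand[OF edge_verts(2)[of f], of "s f \<otimes> b" ?d] b by (simp add: yy)
  then have "(\<Sum>e\<in>{e. edge_r e = ?v} - {f}. \<phi> (adj A (y e) \<otimes> y e)) = 0"
    by (simp add: sum_diff1)
  then have "(\<Sum>e\<in>{e. edge_r e = ?v} - {f}. Re (\<phi> (adj A (y e) \<otimes> y e))) = 0"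
    by (metis Re_sum zero_complex.sel(1))
  then have "Re (\<phi> (adj A (y e) \<otimes> y e)) = 0"
    using state_pos[OF kms_state yc] True assms(1) by (subst (asm) sum_nonneg_eq_0_iff) auto
  then have "\<phi> (adj A (y e) \<otimes> y e) = 0"
    using state_pos[OF kms_state yc[of e]] by (simp add: complex_eq_iff complex_is_Real_iff)
  then have "\<phi> (c \<otimes> y e) = 0" using state_null_right[OF kms_state yc _ c] by blast
  then show ?thesis using b c by (simp add: y_def m_assoc)
next
  case False
  have "adj A (s e) \<otimes> s f = adj A (p (edge_r e) \<otimes> s e) \<otimes> (p (edge_r f) \<otimes> s f)" by (simp add: p_s)
  also have "\<dots> = adj A (s e) \<otimes> (p (edge_r e) \<otimes> p (edge_r f)) \<otimes> s f"
    by (simp add: star_mult p_star[OF edge_verts(2)] m_assoc)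
  also have "p (edge_r e) \<otimes> p (edge_r f) = \<zero>"
    using False U_mult[OF edge_verts(2)[of e] edge_verts(2)[of f], of 0 0] by (simp add: u_id[OF edge_verts(2)])
  finally show ?thesis using b c by (simp add: lin_fun_zero kms_lin)
qed

text \<open>Insert the Cuntz-Krieger sum after \<open>U v n\<close>, push \<open>U v n\<close>
  through \<open>s e\<close>, and move \<open>s (turn n e)\<close> to the right end, which absorbs
  \<open>rho\<close>. There it meets \<open>adj A (s e)\<close>, so only edges fixed by the power
  survive.\<close>

lemma kms_U_step:
  assumes v: "v = 1 \<or> v = 2"
  shows "rho * \<phi> (U v n) = (\<Sum>e | edge_r e = v. if turn n e = e then \<phi> (U (edge_s e) (carry n e)) else 0)"
proof -
  have "\<phi> (U v n) = \<phi> (U v n \<otimes> p v \<otimes> \<one>)"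
    using v U_mult[OF v v, of n 0] by (simp add: u_id)
  also have "\<dots> = (\<Sum>e | edge_r e = v. \<phi> (U v n \<otimes> (s e \<otimes> adj A (s e)) \<otimes> \<one>))"
    using v by (intro kms_CK_expand) auto
  finally have "rho * \<phi> (U v n) = (\<Sum>e | edge_r e = v. rho * \<phi> (U v n \<otimes> (s e \<otimes> adj A (s e)) \<otimes> \<one>))"
    by (simp add: sum_distrib_left)
  also have "\<dots> = (\<Sum>e | edge_r e = v. if turn n e = e then \<phi> (U (edge_s e) (carry n e)) else 0)"
  proof (rule sum.cong[OF refl])
    fix e assume e: "e \<in> {e. edge_r e = v}"
    let ?W = "U (edge_s e) (carry n e)"
    have "U v n \<otimes> (s e \<otimes> adj A (s e)) \<otimes> \<one> = (U v n \<otimes> s e) \<otimes> adj A (s e)"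
      using v by (simp add: m_assoc)
    also have "\<dots> = s (turn n e) \<otimes> (?W \<otimes> adj A (s e))"
      using e v by (simp add: U_s m_assoc)
    finally have "rho * \<phi> (U v n \<otimes> (s e \<otimes> adj A (s e)) \<otimes> \<one>) = \<phi> (?W \<otimes> (adj A (s e) \<otimes> s (turn n e)) \<otimes> \<one>)"
      using kms_s[of "?W \<otimes> adj A (s e)" "turn n e"] by (simp add: m_assoc)
    also have "\<dots> = (if turn n e = e then \<phi> ?W else 0)"
    proof (cases "turn n e = e")
      case True
      have "?W \<otimes> p (edge_s e) = ?W"
        using U_mult[OF edge_verts(1)[of e] edge_verts(1)[of e], of "carry n e" 0] by (simp add: u_id[OF edge_verts(1)])
      then show ?thesis using True by (simp add: s_star_s)
    next
      case False
      then show ?thesis using kms_orthogonal[of e "turn n e" \<one> ?W] by simp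
    qed
    finally show "rho * \<phi> (U v n \<otimes> (s e \<otimes> adj A (s e)) \<otimes> \<one>) = (if turn n e = e then \<phi> ?W else 0)" .
  qed
  finally show ?thesis .
qed

text \<open>An even power fixes both loops at 1 and halves its exponent along them, an odd one fixes
  neither; \<open>e120\<close> is always fixed and its restriction is the identity at 2.\<close>

lemma kms_U1: "rho * \<phi> (U 1 n) = (if even n then 2 * \<phi> (U 1 (n div 2)) else 0) + \<phi> (U 2 0)"
proof -
  have "(n + 1) div 2 = n div 2" if "even n" using that by presburger
  then show ?thesis using kms_U_step[of 1 n] by simp
qed

text \<open>The two edges with range 2 and source 1 are fixed and keep the exponent; the loops at 2
  behave like those at 1.\<close>

lemma kms_U2: "rho * \<phi> (U 2 n) = 2 * \<phi> (U 1 n) + (if even n then 2 * \<phi> (U 2 (n div 2)) else 0)"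
proof -
  have "(n + 1) div 2 = n div 2" if "even n" using that by presburger
  then show ?thesis using kms_U_step[of 2 n] by simp
qed

text \<open>The recursion at exponent 0 is the eigenvector equation for \<open>rho\<close>, and
  \<open>p 1 \<oplus> p 2 = \<one>\<close> normalizes the eigenvector.\<close>

lemma kms_U_zero: "\<phi> (U 1 0) = complex_of_real (sqrt 2 - 1)" "\<phi> (U 2 0) = complex_of_real (2 - sqrt 2)"
proof -
  have sq: "complex_of_real (sqrt 2) * complex_of_real (sqrt 2) = 2"
    by (simp flip: of_real_mult)
  have "\<phi> (p 1 \<oplus> p 2) = 1" using p_sum state_one[OF kms_state] by simp
  then have sum: "\<phi> (U 1 0) + \<phi> (U 2 0) = 1" by (simp add: lin_fun_add kms_lin u_id)
  have eq: "sqrt 2 * \<phi> (U 1 0) = \<phi> (U 2 0)"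
    using kms_U1[of 0] by (simp add: rho_def algebra_simps)
  have "(sqrt 2 + 1) * \<phi> (U 1 0) = 1" using sum eq by (simp add: algebra_simps)
  then have "(sqrt 2 - 1) * ((sqrt 2 + 1) * \<phi> (U 1 0)) = (sqrt 2 - 1)" by simp
  then show 1: "\<phi> (U 1 0) = complex_of_real (sqrt 2 - 1)"
    using sq by (simp add: algebra_simps flip: mult.assoc)
  show "\<phi> (U 2 0) = complex_of_real (2 - sqrt 2)"
    unfolding eq[symmetric] 1 using sq by (simp add: algebra_simps)
qed

lemma kms_sw: "x \<in> carrier A \<Longrightarrow> \<phi> (x \<otimes> sw es) = rho ^ length es * \<phi> (sw es \<otimes> x)"
proof (induction es arbitrary: x)
  case (Cons e es)
  have "\<phi> (x \<otimes> sw (e # es)) = \<phi> ((x \<otimes> s e) \<otimes> sw es)" using Cons.prems by (simp add: m_assoc)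
  also have "\<dots> = rho ^ length es * \<phi> ((sw es \<otimes> x) \<otimes> s e)"
    using Cons.IH[of "x \<otimes> s e"] Cons.prems by (simp add: m_assoc)
  also have "\<dots> = rho ^ length es * (rho * \<phi> (s e \<otimes> (sw es \<otimes> x)))"
    using Cons.prems by (simp add: kms_s)
  finally show ?case using Cons.prems by (simp add: m_assoc)
qed simp

lemma kms_star_sw: "x \<in> carrier A \<Longrightarrow> \<phi> (adj A (sw es) \<otimes> x) = rho ^ length es * \<phi> (x \<otimes> adj A (sw es))"
  using kms_sw[of "adj A x" es] state_star[OF kms_state, of "adj A x \<otimes> sw es"]
    state_star[OF kms_state, of "sw es \<otimes> adj A x"] by (simp add: star_mult)

text \<open>Cyclic rotation: moving \<open>sw es\<close>, then \<open>U v n\<close>, then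
  \<open>adj A (sw fs)\<close> from the left end to the right restores the word. If the value is not
  0, the powers of \<open>rho\<close> for the two lengths must agree, and \<open>rho > 1\<close>
  separates them.\<close>

lemma kms_word_zero:
  assumes v: "v = 1 \<or> v = 2" and len: "length es \<noteq> length fs"
  shows "\<phi> (word es v n fs) = 0"
proof -
  let ?F = "adj A (sw fs)" and ?w = "word es v n fs"
  have c: "U v n \<in> carrier A" using v by simp
  have "rho ^ length es * \<phi> ?w = \<phi> (U v n \<otimes> ?F \<otimes> sw es)"
    using kms_sw[of "U v n \<otimes> ?F" es] c by (simp add: word_def m_assoc)
  also have "\<dots> = \<phi> ((?F \<otimes> sw es) \<otimes> U v n)"
    using kms_U[OF v, of "?F \<otimes> sw es" n] c by (simp add: m_assoc)
  also have "\<dots> = rho ^ length fs * \<phi> ?w"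
    using kms_star_sw[of "sw es \<otimes> U v n" fs] c by (simp add: word_def m_assoc)
  finally have "(complex_of_real rho ^ length es - complex_of_real rho ^ length fs) * \<phi> ?w = 0"
    by (simp add: algebra_simps)
  moreover have "rho ^ length es \<noteq> rho ^ length fs"
    using len rho_gt_1 by (simp add: power_inject_exp)
  then have "complex_of_real rho ^ length es \<noteq> complex_of_real rho ^ length fs"
    by (metis of_real_eq_iff of_real_power)
  ultimately show ?thesis by simp
qed

text \<open>Rotating \<open>s e\<close> to the right end makes it meet \<open>adj A (s f)\<close>,
  so one outer pair of edges cancels or the value is 0.\<close>

lemma kms_word_step:
  assumes v: "v = 1 \<or> v = 2"
  shows "rho * \<phi> (word (e # es) v n (f # fs)) = (if e = f then \<phi> (p (edge_s e) \<otimes> word es v n fs) else 0)"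
proof -
  have c: "U v n \<in> carrier A" using v by simp
  have "word (e # es) v n (f # fs) = s e \<otimes> (word es v n fs \<otimes> adj A (s f))"
    using c by (simp add: word_def star_mult m_assoc)
  then have "rho * \<phi> (word (e # es) v n (f # fs)) = \<phi> (word es v n fs \<otimes> adj A (s f) \<otimes> s e)"
    using kms_s[of "word es v n fs \<otimes> adj A (s f)" e] v by simp
  also have "\<dots> = \<phi> (word es v n fs \<otimes> (adj A (s f) \<otimes> s e) \<otimes> \<one>)" using v by (simp add: m_assoc)
  also have "\<dots> = (if e = f then \<phi> (p (edge_s e) \<otimes> word es v n fs) else 0)"
  proof (cases "e = f")
    case True
    then show ?thesis using v kms_U[OF edge_verts(1)[of e], of "word es v n fs" 0]
      by (simp add: s_star_s u_id[OF edge_verts(1)])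
  next
    case False
    then show ?thesis using kms_orthogonal[of f e \<one> "word es v n fs"] v by auto
  qed
  finally show ?thesis .
qed

end

lemma CK_KMS_unique:
  assumes gen: "generates A gens" and k: "CK_KMS \<phi>" "CK_KMS \<psi>" and x: "x \<in> carrier A"
  shows "\<phi> x = \<psi> x"
proof -
  have rho0: "complex_of_real rho \<noteq> 0" using rho_gt_1 by simp
  \<comment> \<open>Halving an even nonzero exponent lowers its absolute value, and an odd one
    leaves only the known value at exponent 0. At vertex 2 the recursion also uses the values at 1,
    which therefore come before.\<close>
  have U1: "\<phi> (U 1 n) = \<psi> (U 1 n)" for n
  proof (induction "nat \<bar>n\<bar>" arbitrary: n rule: less_induct)
    case less
    show ?case
    proof (cases "n = 0")
      case True
      then show ?thesis using k by (simp add: kms_U_zero)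
    next
      case False
      have "\<phi> (U 1 (n div 2)) = \<psi> (U 1 (n div 2))" if "even n"
        by (rule less) (use that False in \<open>auto elim!: evenE\<close>)
      then have "rho * \<phi> (U 1 n) = rho * \<psi> (U 1 n)"
        using k unfolding kms_U1[OF k(1)] kms_U1[OF k(2)] by (simp add: kms_U_zero)
      then show ?thesis using rho0 by simp
    qed
  qed
  have U2: "\<phi> (U 2 n) = \<psi> (U 2 n)" for n
  proof (induction "nat \<bar>n\<bar>" arbitrary: n rule: less_induct)
    case less
    show ?case
    proof (cases "n = 0")
      case True
      then show ?thesis using k by (simp add: kms_U_zero)
    next
      case False
      have "\<phi> (U 2 (n div 2)) = \<psi> (U 2 (n div 2))" if "even n"
        by (rule less) (use that False in \<open>auto elim!: evenE\<close>)
      then have "rho * \<phi> (U 2 n) = rho * \<psi> (U 2 n)"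
        unfolding kms_U2[OF k(1)] kms_U2[OF k(2)] by (simp add: U1)
      then show ?thesis using rho0 by simp
    qed
  qed
  note l = state_lin[OF kms_state[OF k(1)]] state_lin[OF kms_state[OF k(2)]]
  have word: "\<phi> (word es v n fs) = \<psi> (word es v n fs)" if v: "v = 1 \<or> v = 2" for es v n fs
  proof (induction es arbitrary: fs)
    case Nil
    show ?case
    proof (cases fs)
      case Nil
      then show ?thesis using v U1 U2 by (auto simp: word_def)
    next
      case Cons
      then show ?thesis using v by (simp add: kms_word_zero k)
    qed
  next
    case (Cons e es)
    show ?case
    proof (cases fs)
      case Nil
      then show ?thesis using v by (simp add: kms_word_zero k)
    next
      case (Cons f fs')
      have "rho * \<phi> (word (e # es) v n fs) = rho * \<psi> (word (e # es) v n fs)"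
        unfolding Cons kms_word_step[OF k(1) v] kms_word_step[OF k(2) v] p_word[OF v edge_verts(1)]
        by (simp add: Cons.IH l lin_fun_zero)
      then show ?thesis using rho0 by simp
    qed
  qed
  have words: "\<phi> w = \<psi> w" if "w \<in> words" for w
    using that word by (auto simp: words_def l lin_fun_zero)
  \<comment> \<open>One ideal for both functionals, so that the same word represents a monomial for
    each of them.\<close>
  let ?N = "null_ideal {\<phi>, \<psi>}"
  have N: "ideal ?N A" by (rule ideal_null_ideal) (use l in auto)
  have orth: "adj A (s e) \<otimes> s f \<in> ?N" if "e \<noteq> f" for e f
    using that k by (auto simp: null_ideal_def kms_orthogonal)
  show ?thesis
  proof (rule bdd_fun_eqI[OF gen state_bdd[OF kms_state[OF k(1)]] state_bdd[OF kms_state[OF k(2)]] _ x])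
    fix m assume m: "m \<in> mon A gens"
    then have mc: "m \<in> carrier A" using mon_closed[OF gens_closed] by blast
    \<comment> \<open>The reduction to words needs a word to act on; the unit is the sum of the two
      words \<open>p 1\<close> and \<open>p 2\<close>.\<close>
    have part: "\<phi> (m \<otimes> p v) = \<psi> (m \<otimes> p v)" if v: "v = 1 \<or> v = 2" for v
    proof -
      have "p v = word [] v 0 []" using v by (simp add: word_def u_id)
      then have "p v \<in> words" using wordsI[OF v] by simp
      then obtain w where w: "w \<in> words" "m \<otimes> p v \<ominus> w \<in> ?N" using mon_words[OF N orth m] by blast
      have c: "m \<otimes> p v \<in> carrier A" "w \<in> carrier A" using w(1) words_closed mc v by auto
      show ?thesis
        using null_ideal_zero[OF w(2), of \<phi>] null_ideal_zero[OF w(2), of \<psi>] words[OF w(1)] c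
        by (simp add: lin_fun_diff l)
    qed
    have "m = m \<otimes> p 1 \<oplus> m \<otimes> p 2" using mc p_sum by (simp flip: r_distr)
    then show "\<phi> m = \<psi> m" using part[of 1] part[of 2] mc by (metis lin_fun_add l m_closed p_closed)
  qed
qed

text \<open>For odd exponents the recursion has a single known term:
  \<open>(2 - sqrt 2) / rho = 3 - 2 * sqrt 2\<close> at vertex 1, and from this
  \<open>2 * (3 - 2 * sqrt 2) / rho = 10 - 7 * sqrt 2\<close> at vertex 2.\<close>

lemma CK_KMS_values:
  assumes k: "CK_KMS \<phi>"
  shows "\<phi> (U 1 1) = complex_of_real (3 - 2 * sqrt 2)" "\<phi> (U 1 (-1)) = complex_of_real (3 - 2 * sqrt 2)"
    "\<phi> (U 2 1) = complex_of_real (10 - 7 * sqrt 2)" "\<phi> (U 2 (-1)) = complex_of_real (10 - 7 * sqrt 2)"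
proof -
  have rho0: "complex_of_real rho \<noteq> 0" using rho_gt_1 by simp
  have sq: "sqrt 2 * sqrt 2 = 2" by simp
  have "rho * (3 - 2 * sqrt 2) = 2 - sqrt 2" "rho * (10 - 7 * sqrt 2) = 2 * (3 - 2 * sqrt 2)"
    by (simp_all add: rho_def algebra_simps)
  then have r: "complex_of_real rho * complex_of_real (3 - 2 * sqrt 2) = complex_of_real (2 - sqrt 2)"
    "complex_of_real rho * complex_of_real (10 - 7 * sqrt 2) = complex_of_real (2 * (3 - 2 * sqrt 2))"
    by (simp_all only: flip: of_real_mult)
  have 1: "\<phi> (U 1 n) = complex_of_real (3 - 2 * sqrt 2)" if "odd n" for n
  proof -
    have "rho * \<phi> (U 1 n) = complex_of_real (2 - sqrt 2)"
      using that by (simp add: kms_U1[OF k] kms_U_zero[OF k])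
    then show ?thesis using rho0 r(1) by (metis mult_left_cancel)
  qed
  have 2: "\<phi> (U 2 n) = complex_of_real (10 - 7 * sqrt 2)" if "odd n" for n
  proof -
    have "rho * \<phi> (U 2 n) = complex_of_real (2 * (3 - 2 * sqrt 2))"
      using that by (simp add: kms_U2[OF k] 1)
    then show ?thesis using rho0 r(2) by (metis mult_left_cancel)
  qed
  show "\<phi> (U 1 1) = complex_of_real (3 - 2 * sqrt 2)" "\<phi> (U 1 (-1)) = complex_of_real (3 - 2 * sqrt 2)"
    "\<phi> (U 2 1) = complex_of_real (10 - 7 * sqrt 2)" "\<phi> (U 2 (-1)) = complex_of_real (10 - 7 * sqrt 2)"
    using 1 2 by auto
qed

end

section \<open>Operators on $\ell^2$\<close>

text \<open>Set up as a real Hilbert space, so that the Banach space of bounded real-linear maps is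
  at hand; complex multiplication is added as the operation \<open>cmul\<close>.\<close>

typedef 'i ell2 = "{f :: 'i \<Rightarrow> complex. (\<lambda>i. (cmod (f i))\<^sup>2) summable_on UNIV}"
  morphisms coord Abs_ell2
  by (rule exI[of _ "\<lambda>_. 0"]) simp

setup_lifting type_definition_ell2

lemma summable_sq_bound:
  assumes "\<And>F. finite F \<Longrightarrow> (\<Sum>i\<in>F. (cmod (f i))\<^sup>2) \<le> B"
  shows "(\<lambda>i. (cmod (f i))\<^sup>2) summable_on UNIV"
  by (rule nonneg_bdd_above_summable_on) (use assms in \<open>auto intro!: bdd_aboveI2[of _ _ B]\<close>)

lemma summable_sq_add:
  assumes "(\<lambda>i. (cmod (f i))\<^sup>2) summable_on UNIV" "(\<lambda>i. (cmod (g i))\<^sup>2) summable_on UNIV"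
  shows "(\<lambda>i. (cmod (f i + g i))\<^sup>2) summable_on UNIV"
proof (rule summable_on_comparison_test)
  show "(\<lambda>i. 2 * (cmod (f i))\<^sup>2 + 2 * (cmod (g i))\<^sup>2) summable_on UNIV"
    by (intro summable_on_add summable_on_cmult_right assms)
  fix i
  have "(cmod (f i + g i))\<^sup>2 \<le> (cmod (f i) + cmod (g i))\<^sup>2"
    by (intro power_mono norm_triangle_ineq) auto
  also have "\<dots> \<le> 2 * (cmod (f i))\<^sup>2 + 2 * (cmod (g i))\<^sup>2"
    using sum_squares_bound[of "cmod (f i)" "cmod (g i)"] by (simp add: power2_sum)
  finally show "(cmod (f i + g i))\<^sup>2 \<le> 2 * (cmod (f i))\<^sup>2 + 2 * (cmod (g i))\<^sup>2" .
qed auto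

lemma summable_sq_mult:
  assumes "(\<lambda>i. (cmod (f i))\<^sup>2) summable_on UNIV"
  shows "(\<lambda>i. (cmod (c * f i))\<^sup>2) summable_on UNIV"
  using summable_on_cmult_right[OF assms, of "(cmod c)\<^sup>2"] by (simp add: norm_mult power_mult_distrib)

instantiation ell2 :: (type) real_vector
begin

lift_definition zero_ell2 :: "'a ell2" is "\<lambda>_. 0" by simp

lift_definition plus_ell2 :: "'a ell2 \<Rightarrow> 'a ell2 \<Rightarrow> 'a ell2" is "\<lambda>f g i. f i + g i"
  by (rule summable_sq_add)

lift_definition scaleR_ell2 :: "real \<Rightarrow> 'a ell2 \<Rightarrow> 'a ell2" is "\<lambda>c f i. c *\<^sub>R f i"
  unfolding scaleR_conv_of_real by (rule summable_sq_mult)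

lift_definition uminus_ell2 :: "'a ell2 \<Rightarrow> 'a ell2" is "\<lambda>f i. - f i" by simp

lift_definition minus_ell2 :: "'a ell2 \<Rightarrow> 'a ell2 \<Rightarrow> 'a ell2" is "\<lambda>f g i. f i - g i"
  using summable_sq_add[of _ "\<lambda>i. - _ i"] by simp

instance
proof
  fix x y z :: "'a ell2" and r t :: real
  show "x + y + z = x + (y + z)" by transfer (simp add: add.assoc)
  show "x + y = y + x" by transfer (simp add: add.commute)
  show "0 + x = x" by transfer simp
  show "- x + x = 0" by transfer simp
  show "x - y = x + - y" by transfer simp
  show "r *\<^sub>R (x + y) = r *\<^sub>R x + r *\<^sub>R y" by transfer (simp add: scaleR_add_right)
  show "(r + t) *\<^sub>R x = r *\<^sub>R x + t *\<^sub>R x" by transfer (simp add: scaleR_add_left)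
  show "r *\<^sub>R t *\<^sub>R x = (r * t) *\<^sub>R x" by transfer simp
  show "1 *\<^sub>R x = x" by transfer simp
qed

end

lemma coord_simps [simp]:
  "coord 0 i = 0" "coord (x + y) i = coord x i + coord y i" "coord (r *\<^sub>R x) i = r *\<^sub>R coord x i"
  "coord (- x) i = - coord x i" "coord (x - y) i = coord x i - coord y i"
  by (simp_all add: minus_ell2.rep_eq zero_ell2.rep_eq plus_ell2.rep_eq scaleR_ell2.rep_eq uminus_ell2.rep_eq)

lemma ell2_eqI: "(\<And>i. coord x i = coord y i) \<Longrightarrow> x = y"
  by (metis coord_inject ext)

lemma coord_sq_summable: "(\<lambda>i. (cmod (coord x i))\<^sup>2) summable_on UNIV"
  using coord[of x] by simp

lemma coord_inner_summable: "(\<lambda>i. coord x i \<bullet> coord y i) summable_on UNIV"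
proof (rule abs_summable_summable, rule summable_on_comparison_test)
  show "(\<lambda>i. (cmod (coord x i))\<^sup>2 + (cmod (coord y i))\<^sup>2) summable_on UNIV"
    by (intro summable_on_add coord_sq_summable)
  fix i
  have "\<bar>coord x i \<bullet> coord y i\<bar> \<le> cmod (coord x i) * cmod (coord y i)" by (rule Cauchy_Schwarz_ineq2)
  also have "\<dots> \<le> (cmod (coord x i))\<^sup>2 + (cmod (coord y i))\<^sup>2"
    using sum_squares_bound[of "cmod (coord x i)" "cmod (coord y i)", unfolded mult.assoc]
      mult_nonneg_nonneg[OF norm_ge_zero norm_ge_zero, of "coord x i" "coord y i"] by linarith
  finally show "norm (coord x i \<bullet> coord y i) \<le> (cmod (coord x i))\<^sup>2 + (cmod (coord y i))\<^sup>2" by simp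
qed auto

instantiation ell2 :: (type) real_inner
begin

text \<open>The real part of the complex inner product.\<close>

definition inner_ell2 :: "'a ell2 \<Rightarrow> 'a ell2 \<Rightarrow> real" where
  "inner_ell2 x y = (\<Sum>\<^sub>\<infinity>i. coord x i \<bullet> coord y i)"

definition norm_ell2 :: "'a ell2 \<Rightarrow> real" where "norm_ell2 x = sqrt (inner x x)"

definition dist_ell2 :: "'a ell2 \<Rightarrow> 'a ell2 \<Rightarrow> real" where "dist_ell2 x y = norm (x - y)"

definition sgn_ell2 :: "'a ell2 \<Rightarrow> 'a ell2" where "sgn_ell2 x = x /\<^sub>R norm x"

definition uniformity_ell2 :: "('a ell2 \<times> 'a ell2) filter" where
  "uniformity_ell2 = (INF e\<in>{0<..}. principal {(x, y). dist x y < e})"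

definition open_ell2 :: "'a ell2 set \<Rightarrow> bool" where
  "open_ell2 U \<longleftrightarrow> (\<forall>x\<in>U. \<forall>\<^sub>F (x', y) in uniformity. x' = x \<longrightarrow> y \<in> U)"

instance
proof
  fix x y z :: "'a ell2" and r :: real
  show "inner x y = inner y x" by (simp add: inner_ell2_def inner_commute)
  show "inner (x + y) z = inner x z + inner y z"
    by (simp add: inner_ell2_def inner_add_left infsum_add coord_inner_summable)
  show "inner (r *\<^sub>R x) y = r * inner x y"
    by (simp add: inner_ell2_def infsum_cmult_right')
  show "0 \<le> inner x x" by (simp add: inner_ell2_def infsum_nonneg)
  show "inner x x = 0 \<longleftrightarrow> x = 0"
  proof
    assume "inner x x = 0"
    then have "coord x i \<bullet> coord x i = 0" for i
      using nonneg_infsum_le_0D[of "\<lambda>i. coord x i \<bullet> coord x i" UNIV i]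
      by (simp add: inner_ell2_def coord_inner_summable)
    then show "x = 0" by (intro ell2_eqI) simp
  qed (simp add: inner_ell2_def)
qed (simp_all add: norm_ell2_def dist_ell2_def sgn_ell2_def uniformity_ell2_def open_ell2_def)

end

lemma norm_sq_ell2: "(norm x)\<^sup>2 = (\<Sum>\<^sub>\<infinity>i. (cmod (coord x i))\<^sup>2)" for x :: "'i ell2"
  by (simp add: power2_norm_eq_inner inner_ell2_def)

lemma finite_sum_le_norm: "finite F \<Longrightarrow> (\<Sum>i\<in>F. (cmod (coord x i))\<^sup>2) \<le> (norm x)\<^sup>2"
  unfolding norm_sq_ell2 by (rule finite_sum_le_infsum) (auto intro: coord_sq_summable)

lemma norm_le_of_finite_sums:
  assumes "\<And>F. finite F \<Longrightarrow> (\<Sum>i\<in>F. (cmod (coord x i))\<^sup>2) \<le> B\<^sup>2" "B \<ge> 0"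
  shows "norm x \<le> B"
proof -
  have "(norm x)\<^sup>2 \<le> B\<^sup>2"
    unfolding norm_sq_ell2 by (rule infsum_le_finite_sums) (auto intro: coord_sq_summable assms)
  then show ?thesis using assms(2) by (simp add: power2_le_iff_abs_le)
qed

lemma coord_le_norm: "cmod (coord x i) \<le> norm x"
  using finite_sum_le_norm[of "{i}" x] by (simp add: power2_le_iff_abs_le)

text \<open>Coordinates converge; bounds on finite partial sums survive the limit and give both
  square-summability of the limit and convergence in norm.\<close>

instance ell2 :: (type) banach
proof
  fix X :: "nat \<Rightarrow> 'a ell2"
  assume X: "Cauchy X"
  have c: "convergent (\<lambda>n. coord (X n) i)" for i
  proof (rule Cauchy_convergent, rule CauchyI)
    fix e :: real assume "e > 0"
    then obtain N where N: "\<And>m n. m \<ge> N \<Longrightarrow> n \<ge> N \<Longrightarrow> norm (X m - X n) < e"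
      using CauchyD[OF X] by blast
    then show "\<exists>N. \<forall>m\<ge>N. \<forall>n\<ge>N. norm (coord (X m) i - coord (X n) i) < e"
      using coord_le_norm[of "X m - X n" i for m n] by (metis coord_simps(5) le_less_trans)
  qed
  define l where "l = (\<lambda>i. lim (\<lambda>n. coord (X n) i))"
  have l: "(\<lambda>n. coord (X n) i) \<longlonglongrightarrow> l i" for i
    using c[of i] by (simp add: l_def convergent_LIMSEQ_iff)
  have bound: "(\<Sum>i\<in>F. (cmod (coord (X n) i - l i))\<^sup>2) \<le> e\<^sup>2"
    if F: "finite F" and N: "\<And>m. m \<ge> N \<Longrightarrow> norm (X n - X m) \<le> e" for F n e N
  proof (rule tendsto_upperbound)
    show "(\<lambda>m. \<Sum>i\<in>F. (cmod (coord (X n) i - coord (X m) i))\<^sup>2) \<longlonglongrightarrow> (\<Sum>i\<in>F. (cmod (coord (X n) i - l i))\<^sup>2)"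
      by (intro tendsto_intros l)
    show "\<forall>\<^sub>F m in sequentially. (\<Sum>i\<in>F. (cmod (coord (X n) i - coord (X m) i))\<^sup>2) \<le> e\<^sup>2"
    proof (rule eventually_sequentiallyI[of N])
      fix m assume "m \<ge> N"
      then have "(norm (X n - X m))\<^sup>2 \<le> e\<^sup>2" using N by (intro power_mono) auto
      then show "(\<Sum>i\<in>F. (cmod (coord (X n) i - coord (X m) i))\<^sup>2) \<le> e\<^sup>2"
        using finite_sum_le_norm[OF F, of "X n - X m"] by simp
    qed
  qed simp
  obtain N1 where N1: "\<And>m n. m \<ge> N1 \<Longrightarrow> n \<ge> N1 \<Longrightarrow> norm (X m - X n) < 1"
    using CauchyD[OF X, of 1] by auto
  have "(\<lambda>i. (cmod (coord (X N1) i - l i))\<^sup>2) summable_on UNIV"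
    by (rule summable_sq_bound[of _ "1\<^sup>2"], rule bound[of _ N1]) (use N1 in \<open>auto intro: less_imp_le\<close>)
  \<comment> \<open>The limit is written as \<open>X N1\<close> minus a square-summable
    difference.\<close>
  then have "(\<lambda>i. (cmod (coord (X N1) i + (- 1) * (coord (X N1) i - l i)))\<^sup>2) summable_on UNIV"
    by (intro summable_sq_add summable_sq_mult coord_sq_summable)
  then have ls: "(\<lambda>i. (cmod (l i))\<^sup>2) summable_on UNIV" by simp
  define L where "L = Abs_ell2 l"
  have L: "coord L i = l i" for i using ls by (simp add: L_def Abs_ell2_inverse)
  have "X \<longlonglongrightarrow> L"
  proof (rule LIMSEQ_I)
    fix e :: real assume e: "e > 0"
    then obtain N where N: "\<And>m n. m \<ge> N \<Longrightarrow> n \<ge> N \<Longrightarrow> norm (X m - X n) < e/2"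
      using CauchyD[OF X, of "e/2"] by auto
    have "norm (X n - L) \<le> e/2" if "n \<ge> N" for n
      by (rule norm_le_of_finite_sums, unfold coord_simps L, rule bound[of _ N])
        (use N that e in \<open>auto intro: less_imp_le\<close>)
    then show "\<exists>N. \<forall>n\<ge>N. norm (X n - L) < e" using e by (intro exI[of _ N]) fastforce
  qed
  then show "convergent X" by (rule convergentI)
qed

section \<open>Complex scalars, basis vectors and operators with adjoints\<close>

lift_definition cmul :: "complex \<Rightarrow> 'i ell2 \<Rightarrow> 'i ell2" is "\<lambda>c f i. c * f i"
  by (rule summable_sq_mult)

lemma coord_cmul [simp]: "coord (cmul c x) i = c * coord x i"
  by (simp add: cmul.rep_eq)

lemma norm_cmul: "norm (cmul c x) = cmod c * norm x"
proof -
  have "(norm (cmul c x))\<^sup>2 = (cmod c * norm x)\<^sup>2"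
    by (simp add: norm_sq_ell2 power_mult_distrib norm_mult infsum_cmult_right')
  then show ?thesis by (simp add: power2_eq_iff_nonneg)
qed

lemma cmul_algebra:
  "cmul c (x + y) = cmul c x + cmul c y" "cmul c (x - y) = cmul c x - cmul c y" "cmul (c + d) x = cmul c x + cmul d x"
  "cmul c (cmul d x) = cmul (c * d) x" "cmul 1 x = x" "cmul c (r *\<^sub>R x) = r *\<^sub>R cmul c x" "cmul c 0 = 0"
  "cmul 0 x = 0"
  by (rule ell2_eqI; simp add: algebra_simps)+

lemma inner_cmul_left: "inner (cmul c x) y = inner x (cmul (cnj c) y)"
proof -
  have "(c * a) \<bullet> b = a \<bullet> (cnj c * b)" for a b :: complex
    by (simp add: inner_complex_def algebra_simps)
  then show ?thesis by (simp add: inner_ell2_def)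
qed

lift_definition cmulL :: "complex \<Rightarrow> 'i ell2 \<Rightarrow>\<^sub>L 'i ell2" is cmul
proof -
  fix c
  show "bounded_linear (cmul c :: 'i ell2 \<Rightarrow> 'i ell2)"
    by (rule bounded_linear_intro[where K = "cmod c"]) (auto simp: cmul_algebra norm_cmul mult.commute)
qed

text \<open>The scalar is an argument because the real inner products with \<open>delta c i\<close>
  for all \<open>c\<close> determine the complex coordinate at \<open>i\<close>.\<close>

lift_definition delta :: "complex \<Rightarrow> 'i \<Rightarrow> 'i ell2" is "\<lambda>c i j. if j = i then c else 0"
proof -
  fix c and i :: 'i
  have "(\<lambda>j. (cmod (if j = i then c else 0))\<^sup>2) summable_on UNIV \<longleftrightarrow> (\<lambda>j. (cmod c)\<^sup>2) summable_on {i}"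
    by (rule summable_on_cong_neutral) auto
  then show "(\<lambda>j. (cmod (if j = i then c else 0))\<^sup>2) summable_on UNIV" by simp
qed

lemma coord_delta [simp]: "coord (delta c i) j = (if j = i then c else 0)"
  by (simp add: delta.rep_eq)

lemma cmul_delta [simp]: "cmul c (delta d i) = delta (c * d) i"
  by (rule ell2_eqI) simp

lemma inner_delta: "inner x (delta c i) = coord x i \<bullet> c"
proof -
  have "(\<Sum>\<^sub>\<infinity>j. coord x j \<bullet> coord (delta c i) j) = (\<Sum>\<^sub>\<infinity>j\<in>{i}. coord x i \<bullet> c)"
    by (rule infsum_cong_neutral) auto
  then show ?thesis by (simp add: inner_ell2_def)
qed

lemma complex_eq_inner: "(\<And>c. z \<bullet> c = w \<bullet> c) \<Longrightarrow> z = w" for z w :: complex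
  by (metis inner_commute vector_eq_rdot)

text \<open>For complex-linear maps, an adjoint for the real part of the inner product is an adjoint
  for the complex inner product.\<close>

definition adjoint_pair :: "('i ell2 \<Rightarrow>\<^sub>L 'i ell2) \<Rightarrow> ('i ell2 \<Rightarrow>\<^sub>L 'i ell2) \<Rightarrow> bool" where
  "adjoint_pair T S \<longleftrightarrow> (\<forall>x y. inner (blinfun_apply T x) y = inner x (blinfun_apply S y))"

text \<open>Real-linear operators that commute with the scalars and have an adjoint for the real inner
  product; this avoids the Riesz representation theorem.\<close>

definition operators :: "('i ell2 \<Rightarrow>\<^sub>L 'i ell2) set" where
  "operators = {T. (\<forall>c x. blinfun_apply T (cmul c x) = cmul c (blinfun_apply T x)) \<and> (\<exists>S. adjoint_pair T S)}"

definition adjL :: "('i ell2 \<Rightarrow>\<^sub>L 'i ell2) \<Rightarrow> ('i ell2 \<Rightarrow>\<^sub>L 'i ell2)" where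
  "adjL T = (THE S. adjoint_pair T S)"

lemma adjoint_pair_unique: "adjoint_pair T S \<Longrightarrow> adjoint_pair T S' \<Longrightarrow> S = S'"
  unfolding adjoint_pair_def
  by (rule blinfun_eqI, rule vector_eq_ldot[THEN iffD1]) (metis (no_types))

lemma adjL_eq: "adjoint_pair T S \<Longrightarrow> adjL T = S"
  unfolding adjL_def using adjoint_pair_unique by blast

lemma adjoint_pair_commute: "adjoint_pair T S \<Longrightarrow> adjoint_pair S T"
  unfolding adjoint_pair_def by (metis inner_commute)

lemma adjoint_pair_norm_le:
  assumes "adjoint_pair T S" shows "norm S \<le> norm T"
proof (rule norm_blinfun_bound)
  fix y
  let ?z = "blinfun_apply S y"
  have "norm ?z * norm ?z = inner (blinfun_apply T ?z) y"
    using assms by (simp add: adjoint_pair_def flip: power2_norm_eq_inner power2_eq_square)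
  also have "\<dots> \<le> norm (blinfun_apply T ?z) * norm y" by (rule norm_cauchy_schwarz)
  also have "\<dots> \<le> norm T * norm ?z * norm y" by (intro mult_right_mono norm_blinfun) auto
  finally have "norm ?z * norm ?z \<le> (norm T * norm y) * norm ?z" by (simp add: mult_ac)
  then show "norm ?z \<le> norm T * norm y"
    by (cases "norm ?z = 0") (auto dest: mult_right_le_imp_le)
qed auto

lemma adjoint_pair_norm: "adjoint_pair T S \<Longrightarrow> norm S = norm T"
  using adjoint_pair_norm_le adjoint_pair_commute by (metis antisym)

lemma adjoint_pair_add: "adjoint_pair T S \<Longrightarrow> adjoint_pair T' S' \<Longrightarrow> adjoint_pair (T + T') (S + S')"
  by (simp add: adjoint_pair_def blinfun.add_left inner_add_left inner_add_right)

lemma adjoint_pair_diff: "adjoint_pair T S \<Longrightarrow> adjoint_pair T' S' \<Longrightarrow> adjoint_pair (T - T') (S - S')"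
  by (simp add: adjoint_pair_def blinfun.diff_left inner_diff_left inner_diff_right)

lemma adjoint_pair_comp: "adjoint_pair T S \<Longrightarrow> adjoint_pair T' S' \<Longrightarrow> adjoint_pair (T o\<^sub>L T') (S' o\<^sub>L S)"
  by (simp add: adjoint_pair_def)

lemma adjoint_pair_cmul: "adjoint_pair (cmulL c) (cmulL (cnj c))"
  by (simp add: adjoint_pair_def cmulL.rep_eq inner_cmul_left)

lemma adjoint_pair_zero: "adjoint_pair 0 0" and adjoint_pair_id: "adjoint_pair id_blinfun id_blinfun"
  by (simp_all add: adjoint_pair_def)

lemma operators_pair:
  assumes "T \<in> operators" shows "adjoint_pair T (adjL T)"
proof -
  obtain S where "adjoint_pair T S" using assms by (auto simp: operators_def)
  then show ?thesis by (simp add: adjL_eq)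
qed

lemma operatorsI:
  assumes "\<And>c x. blinfun_apply T (cmul c x) = cmul c (blinfun_apply T x)" "adjoint_pair T S"
  shows "T \<in> operators"
  unfolding operators_def
proof (rule CollectI, rule conjI)
  show "\<forall>c x. blinfun_apply T (cmul c x) = cmul c (blinfun_apply T x)"
    by (rule allI, rule allI, rule assms(1))
  show "\<exists>S. adjoint_pair T S" by (rule exI, rule assms(2))
qed

lemma operators_cmul: "T \<in> operators \<Longrightarrow> blinfun_apply T (cmul c x) = cmul c (blinfun_apply T x)"
  by (simp add: operators_def)

lemma adjL_operators:
  assumes T: "T \<in> operators" shows "adjL T \<in> operators"
proof -
  have "blinfun_apply (adjL T) (cmul c y) = cmul c (blinfun_apply (adjL T) y)" for c y
  proof -
    have adj: "inner (blinfun_apply T x) z = inner x (blinfun_apply (adjL T) z)" for x z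
      using operators_pair[OF T] by (simp add: adjoint_pair_def)
    have cnj: "inner z (cmul c w) = inner (cmul (cnj c) z) w" for z w :: "'a ell2"
      by (simp add: inner_cmul_left)
    have "inner x (blinfun_apply (adjL T) (cmul c y)) = inner x (cmul c (blinfun_apply (adjL T) y))" for x
    proof -
      have "inner x (blinfun_apply (adjL T) (cmul c y)) = inner (cmul (cnj c) (blinfun_apply T x)) y"
        by (simp only: adj[symmetric] cnj)
      also have "\<dots> = inner (blinfun_apply T (cmul (cnj c) x)) y"
        by (simp only: operators_cmul[OF T])
      also have "\<dots> = inner x (cmul c (blinfun_apply (adjL T) y))"
        by (simp only: adj cnj)
      finally show ?thesis .
    qed
    then show ?thesis by (rule vector_eq_ldot[THEN iffD1, OF allI])
  qed
  then show ?thesis by (rule operatorsI[OF _ adjoint_pair_commute[OF operators_pair[OF T]]])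
qed

lemma operators_intros:
  "0 \<in> operators" "id_blinfun \<in> operators"
  "T \<in> operators \<Longrightarrow> S \<in> operators \<Longrightarrow> T + S \<in> operators"
  "T \<in> operators \<Longrightarrow> S \<in> operators \<Longrightarrow> T - S \<in> operators"
  "T \<in> operators \<Longrightarrow> S \<in> operators \<Longrightarrow> T o\<^sub>L S \<in> operators"
  "cmulL c \<in> operators"
proof -
  show "0 \<in> operators" by (rule operatorsI[OF _ adjoint_pair_zero]) (simp add: cmul_algebra)
  show "id_blinfun \<in> operators" by (rule operatorsI[OF _ adjoint_pair_id]) simp
  show "cmulL c \<in> operators"
    by (rule operatorsI[OF _ adjoint_pair_cmul]) (simp add: cmulL.rep_eq cmul_algebra mult.commute)
  assume TS: "T \<in> operators" "S \<in> operators"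
  show "T + S \<in> operators"
    by (rule operatorsI[OF _ adjoint_pair_add[OF TS[THEN operators_pair]]])
      (simp add: blinfun.add_left operators_cmul TS cmul_algebra)
  show "T - S \<in> operators"
    by (rule operatorsI[OF _ adjoint_pair_diff[OF TS[THEN operators_pair]]])
      (simp add: blinfun.diff_left operators_cmul TS cmul_algebra)
  show "T o\<^sub>L S \<in> operators"
    by (rule operatorsI[OF _ adjoint_pair_comp[OF TS[THEN operators_pair]]])
      (simp add: operators_cmul TS)
qed

lemma operators_uminus: "T \<in> operators \<Longrightarrow> - T \<in> operators"
  using operators_intros(4)[OF operators_intros(1), of T] by simp

text \<open>For the lower bound, the squared norm of \<open>T\<close> at \<open>x\<close> is the
  inner product of \<open>x\<close> with the image of \<open>x\<close> under
  \<open>S o\<^sub>L T\<close>.\<close>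

lemma cstar_norm_sq:
  assumes "adjoint_pair T S" shows "norm (S o\<^sub>L T) = (norm T)\<^sup>2"
proof (rule antisym)
  have "norm (S o\<^sub>L T) \<le> norm S * norm T" by (rule norm_blinfun_compose)
  then show "norm (S o\<^sub>L T) \<le> (norm T)\<^sup>2" by (simp add: adjoint_pair_norm[OF assms] power2_eq_square)
  have "norm T \<le> sqrt (norm (S o\<^sub>L T))"
  proof (rule norm_blinfun_bound)
    fix x
    have "(norm (blinfun_apply T x))\<^sup>2 = inner x (blinfun_apply (S o\<^sub>L T) x)"
      using assms by (simp add: power2_norm_eq_inner adjoint_pair_def)
    also have "\<dots> \<le> norm x * norm (blinfun_apply (S o\<^sub>L T) x)" by (rule norm_cauchy_schwarz)
    also have "\<dots> \<le> norm x * (norm (S o\<^sub>L T) * norm x)" by (intro mult_left_mono norm_blinfun) auto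
    also have "\<dots> = (sqrt (norm (S o\<^sub>L T)) * norm x)\<^sup>2" by (simp add: power_mult_distrib power2_eq_square)
    finally show "norm (blinfun_apply T x) \<le> sqrt (norm (S o\<^sub>L T)) * norm x"
      by (rule power2_le_imp_le) auto
  qed auto
  then have "(norm T)\<^sup>2 \<le> (sqrt (norm (S o\<^sub>L T)))\<^sup>2" by (intro power_mono) auto
  then show "(norm T)\<^sup>2 \<le> norm (S o\<^sub>L T)" by simp
qed

lemma norm_cmulL_comp: "norm (cmulL c o\<^sub>L T) = cmod c * norm T"
proof (rule antisym)
  show "norm (cmulL c o\<^sub>L T) \<le> cmod c * norm T"
    by (rule norm_blinfun_bound)
      (auto simp: cmulL.rep_eq norm_cmul mult.assoc intro!: mult_left_mono norm_blinfun)
  show "cmod c * norm T \<le> norm (cmulL c o\<^sub>L T)"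
  proof (cases "c = 0")
    case False
    have "norm T \<le> norm (cmulL c o\<^sub>L T) / cmod c"
    proof (rule norm_blinfun_bound)
      fix x
      have "cmod c * norm (blinfun_apply T x) = norm (blinfun_apply (cmulL c o\<^sub>L T) x)"
        by (simp add: cmulL.rep_eq norm_cmul)
      also have "\<dots> \<le> norm (cmulL c o\<^sub>L T) * norm x" by (rule norm_blinfun)
      finally show "norm (blinfun_apply T x) \<le> norm (cmulL c o\<^sub>L T) / cmod c * norm x"
        using False by (simp add: field_simps)
    qed auto
    then show ?thesis using False by (simp add: field_simps)
  qed auto
qed

definition opalg :: "('i ell2 \<Rightarrow>\<^sub>L 'i ell2) cstar" where
  "opalg = \<lparr>carrier = operators, monoid.mult = (o\<^sub>L), one = id_blinfun, zero = 0, add = (+),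
     module.smult = (\<lambda>c T. cmulL c o\<^sub>L T), adj = adjL, nrm = norm\<rparr>"

lemma opalg_simps [simp]:
  "carrier opalg = operators" "monoid.mult opalg = (o\<^sub>L)" "one opalg = id_blinfun" "zero opalg = 0"
  "add opalg = (+)" "module.smult opalg = (\<lambda>c T. cmulL c o\<^sub>L T)" "adj opalg = adjL" "nrm opalg = norm"
  by (simp_all add: opalg_def)

lemma opalg_ring: "ring opalg"
proof (rule ringI)
  show "abelian_group opalg"
  proof (rule abelian_groupI)
    show "\<exists>S\<in>carrier opalg. S \<oplus>\<^bsub>opalg\<^esub> T = \<zero>\<^bsub>opalg\<^esub>" if "T \<in> carrier opalg" for T
      using that by (intro bexI[of _ "- T"]) (auto simp: operators_uminus)
  qed (auto simp: operators_intros)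
  show "monoid opalg"
    by (rule monoidI) (auto simp: operators_intros intro!: blinfun_eqI)
qed (auto simp: blinfun.add_left blinfun.add_right intro!: blinfun_eqI)

lemma opalg_minus: "S \<in> operators \<Longrightarrow> T \<ominus>\<^bsub>opalg\<^esub> S = T - S"
proof -
  assume S: "S \<in> operators"
  interpret ring opalg by (rule opalg_ring)
  have "\<ominus>\<^bsub>opalg\<^esub> S = - S"
    by (rule minus_equality) (use S in \<open>auto simp: operators_uminus\<close>)
  then show ?thesis by (simp add: a_minus_def)
qed

lemma opalg_nstar: "nstar_algebra opalg"
proof -
  interpret ring opalg by (rule opalg_ring)
  show ?thesis
  proof
    fix x y :: "'a ell2 \<Rightarrow>\<^sub>L 'a ell2" and c d
    assume x: "x \<in> carrier opalg"
    note X = operators_pair[OF x[unfolded opalg_simps]]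
    show "c \<odot>\<^bsub>opalg\<^esub> x \<in> carrier opalg" using x by (simp add: operators_intros)
    show "adj opalg x \<in> carrier opalg" using x adjL_operators by simp
    show "(c + d) \<odot>\<^bsub>opalg\<^esub> x = c \<odot>\<^bsub>opalg\<^esub> x \<oplus>\<^bsub>opalg\<^esub> d \<odot>\<^bsub>opalg\<^esub> x"
      "c \<odot>\<^bsub>opalg\<^esub> (d \<odot>\<^bsub>opalg\<^esub> x) = (c * d) \<odot>\<^bsub>opalg\<^esub> x" "1 \<odot>\<^bsub>opalg\<^esub> x = x"
      by (auto intro!: blinfun_eqI simp: blinfun.add_left cmulL.rep_eq cmul_algebra)
    show "adj opalg (adj opalg x) = x" using adjL_eq[OF adjoint_pair_commute[OF X]] by simp
    have xc: "x o\<^sub>L cmulL c = cmulL c o\<^sub>L x" for c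
      using x by (auto intro!: blinfun_eqI simp: cmulL.rep_eq operators_cmul)
    have "adjL x o\<^sub>L cmulL c = cmulL c o\<^sub>L adjL x" for c
      using adjL_operators[of x] x by (auto intro!: blinfun_eqI simp: cmulL.rep_eq operators_cmul)
    then show "adj opalg (c \<odot>\<^bsub>opalg\<^esub> x) = cnj c \<odot>\<^bsub>opalg\<^esub> adj opalg x"
      using adjL_eq[OF adjoint_pair_comp[OF adjoint_pair_cmul X]] by simp
    show "nrm opalg x = 0 \<longleftrightarrow> x = \<zero>\<^bsub>opalg\<^esub>" "0 \<le> nrm opalg x" by auto
    show "nrm opalg (c \<odot>\<^bsub>opalg\<^esub> x) = cmod c * nrm opalg x" by (simp add: norm_cmulL_comp)
    show "nrm opalg (adj opalg x) = nrm opalg x" using adjoint_pair_norm[OF X] by simp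
    assume y: "y \<in> carrier opalg"
    note Y = operators_pair[OF y[unfolded opalg_simps]]
    show "c \<odot>\<^bsub>opalg\<^esub> (x \<oplus>\<^bsub>opalg\<^esub> y) = c \<odot>\<^bsub>opalg\<^esub> x \<oplus>\<^bsub>opalg\<^esub> c \<odot>\<^bsub>opalg\<^esub> y"
      by (auto intro!: blinfun_eqI simp: blinfun.add_left blinfun.add_right)
    show "c \<odot>\<^bsub>opalg\<^esub> x \<otimes>\<^bsub>opalg\<^esub> y = c \<odot>\<^bsub>opalg\<^esub> (x \<otimes>\<^bsub>opalg\<^esub> y)"
      by (auto intro!: blinfun_eqI)
    show "x \<otimes>\<^bsub>opalg\<^esub> (c \<odot>\<^bsub>opalg\<^esub> y) = c \<odot>\<^bsub>opalg\<^esub> (x \<otimes>\<^bsub>opalg\<^esub> y)"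
      using x by (auto intro!: blinfun_eqI simp: cmulL.rep_eq operators_cmul)
    show "adj opalg (x \<oplus>\<^bsub>opalg\<^esub> y) = adj opalg x \<oplus>\<^bsub>opalg\<^esub> adj opalg y"
      using adjL_eq[OF adjoint_pair_add[OF X Y]] by simp
    show "adj opalg (x \<otimes>\<^bsub>opalg\<^esub> y) = adj opalg y \<otimes>\<^bsub>opalg\<^esub> adj opalg x"
      using adjL_eq[OF adjoint_pair_comp[OF X Y]] by simp
    show "nrm opalg (x \<oplus>\<^bsub>opalg\<^esub> y) \<le> nrm opalg x + nrm opalg y" by (simp add: norm_triangle_ineq)
    show "nrm opalg (x \<otimes>\<^bsub>opalg\<^esub> y) \<le> nrm opalg x * nrm opalg y" by (simp add: norm_blinfun_compose)
  qed
qed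

text \<open>Passing to adjoints is isometric, so the adjoints of a convergent sequence converge as
  well; their limit is the adjoint required for \<open>L\<close>.\<close>

lemma operators_closed_limit:
  assumes T: "\<And>n. T n \<in> operators" and lim: "T \<longlonglongrightarrow> L"
  shows "L \<in> operators"
proof -
  have Lx: "(\<lambda>n. blinfun_apply (T n) x) \<longlonglongrightarrow> blinfun_apply L x" for x
    by (intro tendsto_intros lim)
  have c: "blinfun_apply L (cmul c x) = cmul c (blinfun_apply L x)" for c x
  proof -
    have "(\<lambda>n. blinfun_apply (cmulL c) (blinfun_apply (T n) x)) \<longlonglongrightarrow> blinfun_apply (cmulL c) (blinfun_apply L x)"
      by (intro tendsto_intros Lx)
    then show ?thesis
      using LIMSEQ_unique[OF Lx[of "cmul c x"]] by (simp add: cmulL.rep_eq operators_cmul[OF T])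
  qed
  have "norm (adjL (T m) - adjL (T n)) = norm (T m - T n)" for m n
    by (rule adjoint_pair_norm[OF adjoint_pair_diff[OF operators_pair[OF T] operators_pair[OF T]]])
  then have "Cauchy (\<lambda>n. adjL (T n))"
    using LIMSEQ_imp_Cauchy[OF lim] by (simp add: Cauchy_def dist_norm)
  then obtain S where S: "(\<lambda>n. adjL (T n)) \<longlonglongrightarrow> S"
    using Cauchy_convergent convergent_def by blast
  have "inner (blinfun_apply L x) y = inner x (blinfun_apply S y)" for x y
  proof (rule LIMSEQ_unique)
    show "(\<lambda>n. inner (blinfun_apply (T n) x) y) \<longlonglongrightarrow> inner (blinfun_apply L x) y"
      by (intro tendsto_intros lim)
    have "(\<lambda>n. inner x (blinfun_apply (adjL (T n)) y)) \<longlonglongrightarrow> inner x (blinfun_apply S y)"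
      by (intro tendsto_intros S)
    then show "(\<lambda>n. inner (blinfun_apply (T n) x) y) \<longlonglongrightarrow> inner x (blinfun_apply S y)"
      using operators_pair[OF T] by (simp add: adjoint_pair_def)
  qed
  then have "adjoint_pair L S" by (simp add: adjoint_pair_def)
  then show ?thesis by (rule operatorsI[OF c])
qed

lemma (in nstar_algebra) cstar_algebraI:
  assumes "\<And>x. x \<in> carrier A \<Longrightarrow> nrm A (adj A x \<otimes> x) = (nrm A x)\<^sup>2"
    and "Metric_space.mcomplete (carrier A) (ndist A)"
  shows "cstar_algebra A"
  by unfold_locales
    (simp_all add: assms scale_add_left scale_add_right scale_scale scale_mult_left scale_mult_right
      star_add star_scale star_mult norm_eq_0 norm_triangle norm_scale norm_mult_le)

lemma opalg_cstar: "cstar_algebra opalg"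
proof -
  interpret nstar_algebra opalg by (rule opalg_nstar)
  have "Metric_space.mcomplete (carrier opalg) (ndist (opalg :: ('a ell2 \<Rightarrow>\<^sub>L 'a ell2) cstar))"
    unfolding metric.mcomplete_def
  proof (intro allI impI)
    fix T :: "nat \<Rightarrow> 'a ell2 \<Rightarrow>\<^sub>L 'a ell2" assume "metric.MCauchy T"
    then have T: "T n \<in> operators" and C: "\<And>e. e > 0 \<Longrightarrow> \<exists>N. \<forall>n n'. N \<le> n \<longrightarrow> N \<le> n' \<longrightarrow> norm (T n - T n') < e" for n
      unfolding metric.MCauchy_def by (auto simp: ndist_def opalg_minus subset_iff)
    have "Cauchy T" unfolding Cauchy_def dist_norm using C by blast
    then obtain L where L: "T \<longlonglongrightarrow> L" using Cauchy_convergent convergent_def by blast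
    have "L \<in> operators" by (rule operators_closed_limit[OF T L])
    then have "limitin (ntop opalg) T L sequentially"
      using L T unfolding limitin_iff by (simp add: opalg_minus tendsto_iff dist_norm)
    then show "\<exists>L. limitin (ntop opalg) T L sequentially" by blast
  qed
  then show ?thesis
    by (intro cstar_algebraI) (simp_all add: cstar_norm_sq operators_pair)
qed

section \<open>The path space representation\<close>

text \<open>\<open>h\<close> and \<open>h'\<close> are inverse partial bijections, so both sums run
  over the same set of related pairs.\<close>

lemma inner_infsum_reindex:
  fixes f :: "'i \<Rightarrow> 'j \<Rightarrow> real"
  assumes inv: "\<And>i j. h' i = Some j \<longleftrightarrow> h j = Some i"
  shows "(\<Sum>\<^sub>\<infinity>j. (case h j of None \<Rightarrow> 0 | Some i \<Rightarrow> f i j)) = (\<Sum>\<^sub>\<infinity>i. (case h' i of None \<Rightarrow> 0 | Some j \<Rightarrow> f i j))"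
proof -
  let ?F = "\<lambda>i. case h' i of None \<Rightarrow> 0 | Some j \<Rightarrow> f i j"
  have h': "h' i = Some j" if "h j = Some i" for i j using that by (simp add: inv)
  have "(\<Sum>\<^sub>\<infinity>j. (case h j of None \<Rightarrow> 0 | Some i \<Rightarrow> f i j)) = (\<Sum>\<^sub>\<infinity>j\<in>dom h. ?F (the (h j)))"
  proof (rule infsum_cong_neutral)
    fix j assume "j \<in> UNIV \<inter> dom h"
    then obtain i where "h j = Some i" by auto
    then show "(case h j of None \<Rightarrow> 0 | Some i \<Rightarrow> f i j) = ?F (the (h j))" by (simp add: h')
  qed (auto simp: domIff)
  also have "\<dots> = infsum ?F (dom h')"
  proof (rule infsum_reindex_bij_betw)
    show "bij_betw (\<lambda>j. the (h j)) (dom h) (dom h')"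
    proof (rule bij_betw_byWitness[of _ "\<lambda>i. the (h' i)"])
      show "\<forall>j\<in>dom h. the (h' (the (h j))) = j" using h' by (metis domD option.sel)
      show "\<forall>i\<in>dom h'. the (h (the (h' i))) = i" using inv by (metis domD option.sel)
      show "(\<lambda>j. the (h j)) ` dom h \<subseteq> dom h'" using h' by (auto simp: dom_def)
      show "(\<lambda>i. the (h' i)) ` dom h' \<subseteq> dom h" using inv by fastforce
    qed
  qed
  also have "\<dots> = infsum ?F UNIV"
    by (rule infsum_cong_neutral) (auto simp: domIff split: option.split)
  finally show ?thesis .
qed

definition pinj :: "('i \<Rightarrow> 'i option) \<Rightarrow> bool" where
  "pinj h \<longleftrightarrow> (\<forall>i j k. h i = Some k \<longrightarrow> h j = Some k \<longrightarrow> i = j)"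

lemma pinjI:
  assumes "\<And>i j. h i = Some j \<Longrightarrow> h' j = Some i"
  shows "pinj h"
  unfolding pinj_def
proof (intro allI impI)
  fix i j k assume "h i = Some k" "h j = Some k"
  from this[THEN assms] show "i = j" by simp
qed

lemma pull_finite_sums:
  assumes h: "pinj h" and F: "finite F"
  shows "(\<Sum>j\<in>F. (cmod (case h j of None \<Rightarrow> 0 | Some i \<Rightarrow> coord x i))\<^sup>2) \<le> (norm x)\<^sup>2"
proof -
  let ?D = "{j \<in> F. h j \<noteq> None}"
  have "(\<Sum>j\<in>F. (cmod (case h j of None \<Rightarrow> 0 | Some i \<Rightarrow> coord x i))\<^sup>2) = (\<Sum>j\<in>?D. (cmod (coord x (the (h j))))\<^sup>2)"
    using F by (intro sum.mono_neutral_cong_right) auto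
  also have "\<dots> = (\<Sum>i\<in>(\<lambda>j. the (h j)) ` ?D. (cmod (coord x i))\<^sup>2)"
    using h by (subst sum.reindex) (auto simp: inj_on_def pinj_def)
  also have "\<dots> \<le> (norm x)\<^sup>2" using F by (intro finite_sum_le_norm) auto
  finally show ?thesis .
qed

text \<open>Each coordinate is read from the index \<open>h j\<close>, or is 0; on basis vectors
  this acts by the inverse of \<open>h\<close>.\<close>

definition pull_vec :: "('i \<Rightarrow> 'i option) \<Rightarrow> 'i ell2 \<Rightarrow> 'i ell2" where
  "pull_vec h x = Abs_ell2 (\<lambda>j. case h j of None \<Rightarrow> 0 | Some i \<Rightarrow> coord x i)"

lemma coord_pull_vec:
  assumes "pinj h"
  shows "coord (pull_vec h x) j = (case h j of None \<Rightarrow> 0 | Some i \<Rightarrow> coord x i)"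
  using summable_sq_bound[OF pull_finite_sums[OF assms, of _ x]]
  by (simp add: pull_vec_def Abs_ell2_inverse)

definition pull :: "('i \<Rightarrow> 'i option) \<Rightarrow> 'i ell2 \<Rightarrow>\<^sub>L 'i ell2" where
  "pull h = Blinfun (pull_vec h)"

lemma coord_pull:
  assumes h: "pinj h"
  shows "coord (blinfun_apply (pull h) x) j = (case h j of None \<Rightarrow> 0 | Some i \<Rightarrow> coord x i)"
proof -
  have "bounded_linear (pull_vec h)"
  proof (rule bounded_linear_intro[where K = 1])
    show "norm (pull_vec h x) \<le> norm x * 1" for x
      using norm_le_of_finite_sums[of "pull_vec h x" "norm x"] pull_finite_sums[OF h]
      by (simp add: coord_pull_vec[OF h])
  qed (auto intro!: ell2_eqI simp: coord_pull_vec[OF h] split: option.split)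
  then show ?thesis by (simp add: pull_def bounded_linear_Blinfun_apply coord_pull_vec[OF h])
qed

lemma pull_adjoint_pair:
  assumes inv: "\<And>i j. h i = Some j \<longleftrightarrow> h' j = Some i"
  shows "adjoint_pair (pull h) (pull h')"
proof -
  have p: "pinj h" "pinj h'" unfolding pinj_def by (metis inv option.inject)+
  have "(case h j of None \<Rightarrow> 0 | Some i \<Rightarrow> coord x i) \<bullet> coord y j
      = (case h j of None \<Rightarrow> 0 | Some i \<Rightarrow> coord x i \<bullet> coord y j)" for j and x y :: "'a ell2"
    by (simp split: option.split)
  moreover have "coord x i \<bullet> (case h' i of None \<Rightarrow> 0 | Some j \<Rightarrow> coord y j)
      = (case h' i of None \<Rightarrow> 0 | Some j \<Rightarrow> coord x i \<bullet> coord y j)" for i and x y :: "'a ell2"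
    by (simp split: option.split)
  ultimately show ?thesis
    using inner_infsum_reindex[OF inv[symmetric], of "\<lambda>i j. coord _ i \<bullet> coord _ j"]
    by (simp add: adjoint_pair_def inner_ell2_def coord_pull[OF p(1)] coord_pull[OF p(2)])
qed

lemma pull_operators:
  assumes inv: "\<And>i j. h i = Some j \<longleftrightarrow> h' j = Some i"
  shows "pull h \<in> operators" "adjL (pull h) = pull h'"
proof -
  have p: "pinj h" unfolding pinj_def by (metis inv option.inject)
  show "pull h \<in> operators"
    by (rule operatorsI[OF _ pull_adjoint_pair[OF inv]])
      (auto intro!: ell2_eqI simp: coord_pull[OF p] split: option.split)
  show "adjL (pull h) = pull h'" by (rule adjL_eq[OF pull_adjoint_pair[OF inv]])
qed

section \<open>The path space and the generators acting on it\<close>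

typedef vpath = "{\<mu>. is_epath exE \<mu>}"
  by (rule exI[of _ "(1, [])"]) simp

text \<open>Countability of the path space is what allows operators to be encoded as matrices
  indexed by natural numbers.\<close>

instance edge :: countable by countable_datatype

instance vpath :: countable
proof
  show "\<exists>f :: vpath \<Rightarrow> nat. inj f"
    by (rule exI[of _ "to_nat \<circ> Rep_vpath"]) (simp add: inj_on_def Rep_vpath_inject)
qed

definition rng :: "vpath \<Rightarrow> nat" where "rng l = fst (Rep_vpath l)"

definition edges :: "vpath \<Rightarrow> edge list" where "edges l = snd (Rep_vpath l)"

definition mkp :: "nat \<Rightarrow> edge list \<Rightarrow> vpath" where "mkp v es = Abs_vpath (v, es)"

lemma vpath_valid [simp]: "is_epath exE (rng l, edges l)"
  using Rep_vpath[of l] by (simp add: rng_def edges_def)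

lemma mkp_simps [simp]:
  "is_epath exE (v, es) \<Longrightarrow> rng (mkp v es) = v" "is_epath exE (v, es) \<Longrightarrow> edges (mkp v es) = es"
  "mkp (rng l) (edges l) = l"
  by (simp_all add: rng_def edges_def mkp_def Abs_vpath_inverse Rep_vpath_inverse)

lemma mkp_edges [simp]: "rng l = v \<Longrightarrow> mkp v (edges l) = l"
  by auto

lemma mkp_Nil: "edges l = [] \<Longrightarrow> rng l = v \<Longrightarrow> mkp v [] = l"
  by (metis mkp_simps(3))

lemma vpath_eqI: "rng l = rng m \<Longrightarrow> edges l = edges m \<Longrightarrow> l = m"
  by (metis mkp_simps(3))

lemma vpath_cases:
  obtains v es where "l = mkp v es" "is_epath exE (v, es)"
  by (metis mkp_simps(3) vpath_valid)

lemma mkp_inject: "is_epath exE (v, es) \<Longrightarrow> is_epath exE (w, fs) \<Longrightarrow> mkp v es = mkp w fs \<longleftrightarrow> v = w \<and> es = fs"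
  by (metis mkp_simps(1,2))

lemma rng_verts: "rng l = 1 \<or> rng l = 2"
  using is_epath_verts[OF vpath_valid] .

text \<open>The index maps invert the intended action on paths, since coordinates are pulled back:
  the sign of \<open>n\<close> is reversed here, \<open>mapS\<close> removes an edge so that
  \<open>opS\<close> prepends it, and \<open>mapS'\<close> does the opposite.\<close>

definition mapU :: "nat \<Rightarrow> int \<Rightarrow> vpath \<Rightarrow> vpath option" where
  "mapU v n l = (if rng l = v then Some (mkp v (odo (- n) (edges l))) else None)"

definition mapS :: "edge \<Rightarrow> vpath \<Rightarrow> vpath option" where
  "mapS e l = (case edges l of [] \<Rightarrow> None | f # es \<Rightarrow> if f = e then Some (mkp (edge_s e) es) else None)"

definition mapS' :: "edge \<Rightarrow> vpath \<Rightarrow> vpath option" where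
  "mapS' e l = (if rng l = edge_s e then Some (mkp (edge_r e) (e # edges l)) else None)"

definition opU :: "nat \<Rightarrow> int \<Rightarrow> vpath ell2 \<Rightarrow>\<^sub>L vpath ell2" where "opU v n = pull (mapU v n)"

definition opS :: "edge \<Rightarrow> vpath ell2 \<Rightarrow>\<^sub>L vpath ell2" where "opS e = pull (mapS e)"

definition opS' :: "edge \<Rightarrow> vpath ell2 \<Rightarrow>\<^sub>L vpath ell2" where "opS' e = pull (mapS' e)"

lemma mapU_inv: "mapU v n l = Some m \<longleftrightarrow> mapU v (- n) m = Some l"
proof (cases "rng l = v \<and> rng m = v")
  case True
  then have v: "is_epath exE (v, edges l)" "is_epath exE (v, edges m)" using vpath_valid by metis+
  have "odo (- n) (edges l) = edges m \<longleftrightarrow> odo n (edges m) = edges l" by (metis odo_minus)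
  then show ?thesis
    using True v mkp_inject[of v "odo (- n) (edges l)" v "edges m"] mkp_inject[of v "odo n (edges m)" v "edges l"]
    by (simp add: mapU_def)
next
  case False
  then show ?thesis by (auto simp: mapU_def)
qed

lemma mapS_inv: "mapS e l = Some m \<longleftrightarrow> mapS' e m = Some l"
proof -
  obtain v es where l: "l = mkp v es" "is_epath exE (v, es)" by (rule vpath_cases)
  obtain w fs where m: "m = mkp w fs" "is_epath exE (w, fs)" by (rule vpath_cases)
  show ?thesis using l m
    by (cases es) (auto simp: mapS_def mapS'_def mkp_inject)
qed

lemma pinj_maps [simp]: "pinj (mapU v n)" "pinj (mapS e)" "pinj (mapS' e)"
  by (rule pinjI[OF mapU_inv[THEN iffD1]], assumption,
    rule pinjI[OF mapS_inv[THEN iffD1]], assumption,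
    rule pinjI[OF mapS_inv[THEN iffD2]], assumption)

lemma coord_opU:
  "coord (blinfun_apply (opU v n) x) l = (if rng l = v then coord x (mkp v (odo (- n) (edges l))) else 0)"
  by (simp add: opU_def coord_pull mapU_def)

lemma coord_opS:
  "coord (blinfun_apply (opS e) x) l = (case edges l of [] \<Rightarrow> 0 | f # es \<Rightarrow> if f = e then coord x (mkp (edge_s e) es) else 0)"
  by (simp add: opS_def coord_pull mapS_def split: list.split)

lemma coord_opS':
  "coord (blinfun_apply (opS' e) x) l = (if rng l = edge_s e then coord x (mkp (edge_r e) (e # edges l)) else 0)"
  by (simp add: opS'_def coord_pull mapS'_def)

lemma op_operators [simp]: "opU v n \<in> operators" "opS e \<in> operators" "opS' e \<in> operators"
  and op_adj: "adjL (opU v n) = opU v (- n)" "adjL (opS e) = opS' e"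
  unfolding opU_def opS_def opS'_def
  using pull_operators[of "mapU v n" "mapU v (- n)"] pull_operators[of "mapS e" "mapS' e"]
    pull_operators[of "mapS' e" "mapS e"] mapU_inv mapS_inv by metis+

lemma is_epath_rng: "rng l = v \<Longrightarrow> is_epath exE (v, edges l)"
  using vpath_valid by metis

lemma is_epath_edges: "edges l = e # es \<Longrightarrow> rng l = edge_r e \<and> is_epath exE (edge_s e, es)"
  using vpath_valid[of l] by simp

lemma op_eqI: "(\<And>x l. coord (blinfun_apply T x) l = coord (blinfun_apply S x) l) \<Longrightarrow> T = S"
  by (intro blinfun_eqI ell2_eqI)

lemma opU_opU: "opU v m o\<^sub>L opU w n = (if v = w then opU v (m + n) else 0)"
  by (rule op_eqI) (auto simp: coord_opU is_epath_rng odo_odo add.commute)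

lemma opS'_opS: "opS' e o\<^sub>L opS f = (if e = f then opU (edge_s e) 0 else 0)"
  by (rule op_eqI) (auto simp: coord_opU coord_opS coord_opS' is_epath_rng)

lemma opS_opS': "coord (blinfun_apply (opS e) (blinfun_apply (opS' e) x)) l
    = (case edges l of [] \<Rightarrow> 0 | f # es \<Rightarrow> if f = e then coord x l else 0)"
proof (cases "edges l")
  case (Cons f es)
  then have "mkp (edge_r f) (f # es) = l" using is_epath_edges[OF Cons] mkp_simps(3)[of l] by simp
  then show ?thesis using Cons is_epath_edges[OF Cons] by (auto simp: coord_opS coord_opS')
qed (simp add: coord_opS)

lemma carry_minus: "carry (- n) (turn n e) = - carry n e"
  using carry_turn[of "- n" n e] by simp

lemma opU_opS: "opU v n o\<^sub>L opS e = (if edge_r e = v then opS (turn n e) o\<^sub>L opU (edge_s e) (carry n e) else 0)"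
proof (rule op_eqI)
  fix x l
  have t: "turn (- n) f = e \<longleftrightarrow> f = turn n e" for f
    using turn_turn[of n "- n" f] turn_turn[of "- n" n e] by auto
  show "coord (blinfun_apply (opU v n o\<^sub>L opS e) x) l
    = coord (blinfun_apply (if edge_r e = v then opS (turn n e) o\<^sub>L opU (edge_s e) (carry n e) else 0) x) l"
  proof (cases "edges l")
    case Nil
    then show ?thesis using is_epath_rng[of l] by (auto simp: coord_opU coord_opS)
  next
    case (Cons f es)
    note ie = is_epath_edges[OF Cons]
    have "is_epath exE (edge_r f, turn (- n) f # odo (carry (- n) f) es)" using ie by simp
    then have "edges (mkp (edge_r f) (turn (- n) f # odo (carry (- n) f) es)) = turn (- n) f # odo (carry (- n) f) es"
      by (rule mkp_simps(2))
    then show ?thesis using Cons ie by (auto simp: coord_opU coord_opS t carry_minus)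
  qed
qed

text \<open>Written in terms of the record \<open>g\<close>, so that no exponent has to be chosen
  for a given groupoid element; on powers it reduces to \<open>opU\<close>.\<close>

definition uop :: "(nat, edge) piso \<Rightarrow> vpath ell2 \<Rightarrow>\<^sub>L vpath ell2" where
  "uop g = pull (\<lambda>l. if rng l = pcod g then Some (Abs_vpath (pact (piso_inv exE g) (Rep_vpath l))) else None)"

lemma uop_gpow: "uop (gpow v n) = opU v n"
proof -
  have "Abs_vpath (pact (gpow v (- n)) (Rep_vpath l)) = mkp v (odo (- n) (edges l))" if "rng l = v" for l
  proof -
    have "Rep_vpath l = (v, edges l)" using that by (simp add: rng_def edges_def prod_eq_iff)
    then show ?thesis using is_epath_rng[OF that] by (simp add: mkp_def)
  qed
  then have "(\<lambda>l. if rng l = pcod (gpow v n) then Some (Abs_vpath (pact (piso_inv exE (gpow v n)) (Rep_vpath l))) else None) = mapU v n"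
    by (auto simp: mapU_def gpow_inv)
  then show ?thesis by (simp add: uop_def opU_def)
qed

lemma opalg_finsum:
  assumes "finite I" "\<And>i. i \<in> I \<Longrightarrow> f i \<in> operators"
  shows "finsum opalg f I = sum f I"
proof -
  interpret ring opalg by (rule opalg_ring)
  show ?thesis using assms by (induction I rule: finite_induct) auto
qed

lemma sum_in_operators: "(\<And>i. i \<in> I \<Longrightarrow> f i \<in> operators) \<Longrightarrow> sum f I \<in> operators"
  by (induction I rule: infinite_finite_induct) (auto simp: operators_intros)

lemma coord_sum: "coord (sum f I) i = (\<Sum>j\<in>I. coord (f j) i)"
  by (induction I rule: infinite_finite_induct) auto

text \<open>For a vertex \<open>v\<close>, the projection onto the basis vector of the path of
  length 0 at \<open>v\<close>. It is the Cuntz-Krieger defect in this representation, since exactly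
  the paths of length 0 begin with no edge.\<close>

definition vac :: "nat \<Rightarrow> vpath ell2 \<Rightarrow>\<^sub>L vpath ell2" where
  "vac v = pull (\<lambda>l. if rng l = v \<and> edges l = [] then Some l else None)"

lemma vac_operators: "vac v \<in> operators" "adjL (vac v) = vac v"
proof -
  let ?h = "\<lambda>l. if rng l = v \<and> edges l = [] then Some l else None"
  have "?h i = Some j \<longleftrightarrow> ?h j = Some i" for i j by auto
  note pull_operators[of ?h ?h, OF this]
  then show "vac v \<in> operators" "adjL (vac v) = vac v" by (simp_all add: vac_def)
qed

lemma coord_vac: "coord (blinfun_apply (vac v) x) l = (if rng l = v \<and> edges l = [] then coord x l else 0)"
  unfolding vac_def by (subst coord_pull) (auto simp: pinj_def split: if_splits)

lemma vac_eq: "opU v 0 - (\<Sum>e | edge_r e = v. opS e o\<^sub>L opS' e) = vac v"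
proof (rule op_eqI)
  fix x l
  have "coord (blinfun_apply (\<Sum>e | edge_r e = v. opS e o\<^sub>L opS' e) x) l
      = (\<Sum>e | edge_r e = v. case edges l of [] \<Rightarrow> 0 | f # es \<Rightarrow> if f = e then coord x l else 0)"
    by (simp add: blinfun.sum_left coord_sum opS_opS')
  also have "\<dots> = (if rng l = v \<and> edges l \<noteq> [] then coord x l else 0)"
    using is_epath_edges[of l] by (cases "edges l") auto
  finally show "coord (blinfun_apply (opU v 0 - (\<Sum>e | edge_r e = v. opS e o\<^sub>L opS' e)) x) l
      = coord (blinfun_apply (vac v) x) l"
    by (auto simp: blinfun.diff_left coord_vac coord_opU mkp_Nil)
qed

definition pop :: "nat \<Rightarrow> vpath ell2 \<Rightarrow>\<^sub>L vpath ell2" where "pop v = opU v 0"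

lemma range_sum_opS: "range_sum exE opalg opS v = (\<Sum>e | edge_r e = v. opS e o\<^sub>L opS' e)"
  unfolding range_sum_def using finite_arcs_into[of v]
  by (subst opalg_finsum) (auto simp: op_adj operators_intros)

text \<open>The Toeplitz inequality holds because the defect is the projection \<open>vac v\<close>,
  which is its own positive square root.\<close>

lemma family_op: "toeplitz_family exE exG opalg uop pop opS"
proof -
  have id: "opU 1 0 + opU 2 0 = id_blinfun"
    by (rule op_eqI) (use rng_verts in \<open>auto simp: blinfun.add_left coord_opU intro: ccontr\<close>)
  have g: "groupoid_rep exE exG opalg uop"
    unfolding groupoid_rep_def projection_def partial_isometry_def
    by (auto simp: gpow_zero uop_gpow opU_opU op_adj gpow_comp elim!: exG_cases)
  have orth: "opU v 0 \<in> operators" "opU v 0 o\<^sub>L opU v 0 = opU v 0" "adjL (opU v 0) = opU v 0" for v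
    by (simp_all add: opU_opU op_adj)
  have "opS e o\<^sub>L opS' e o\<^sub>L opS e = opS e" for e
  proof -
    have "opS e o\<^sub>L opU (edge_s e) 0 = opS e"
      by (rule op_eqI) (auto simp: coord_opS coord_opU is_epath_edges split: list.split)
    moreover have "opS e o\<^sub>L opS' e o\<^sub>L opS e = opS e o\<^sub>L (opS' e o\<^sub>L opS e)" by (rule blinfun_eqI) simp
    ultimately show ?thesis by (simp add: opS'_opS)
  qed
  moreover have "cle opalg (range_sum exE opalg opS v) (pop v)" for v
  proof -
    have "range_sum exE opalg opS v \<in> operators" unfolding range_sum_opS
      by (rule sum_in_operators) (auto simp: operators_intros)
    then have "pop v \<ominus>\<^bsub>opalg\<^esub> range_sum exE opalg opS v = vac v"
      by (simp add: opalg_minus range_sum_opS pop_def vac_eq)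
    moreover have "vac v o\<^sub>L vac v = vac v" by (rule op_eqI) (auto simp: coord_vac)
    ultimately show ?thesis unfolding cle_def cpositive_def
      by (intro bexI[of _ "vac v"]) (simp_all add: vac_operators)
  qed
  ultimately have t: "TCK_family exE opalg pop opS"
    unfolding TCK_family_def projection_def partial_isometry_def
    by (auto simp: pop_def opU_opU op_adj opS'_opS)
  show ?thesis
    unfolding toeplitz_family_def
  proof (intro conjI g t ballI)
    show "uop (piso_id exE v) = pop v" for v by (simp add: gpow_zero uop_gpow pop_def)
    show "finsum opalg pop (verts exE) = \<one>\<^bsub>opalg\<^esub>"
      using id by (subst opalg_finsum) (auto simp: pop_def)
    fix g e assume "g \<in> exG"
    then show "uop g \<otimes>\<^bsub>opalg\<^esub> opS e = (if pdom g = head exE e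
        then opS (edge_act exE g e) \<otimes>\<^bsub>opalg\<^esub> uop (restriction exE exG g e) else \<zero>\<^bsub>opalg\<^esub>)"
      by (auto simp: uop_gpow opU_opS edge_act_gpow restriction_gpow elim!: exG_cases)
  qed
qed

section \<open>The functionals on paths of a fixed length\<close>

text \<open>The eigenvector for \<open>rho\<close> in the sense of \<open>rho_cw\<close>, normalized
  to sum 1; its entries are the values forced by \<open>kms_U_zero\<close>.\<close>

definition cw :: "nat \<Rightarrow> real" where "cw v = (if v = 1 then sqrt 2 - 1 else 2 - sqrt 2)"

definition wt :: "vpath \<Rightarrow> real" where
  "wt l = cw (psource exE (rng l, edges l)) / rho ^ length (edges l)"

definition level :: "nat \<Rightarrow> vpath set" where "level k = {l. length (edges l) = k}"

definition level_trace :: "nat \<Rightarrow> (vpath ell2 \<Rightarrow>\<^sub>L vpath ell2) \<Rightarrow> complex" where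
  "level_trace k b = (\<Sum>l\<in>level k. complex_of_real (wt l) * coord (blinfun_apply b (delta 1 l)) l)"

lemma finite_level [simp]: "finite (level k)"
proof -
  have "finite {es :: edge list. length es = k}"
    using finite_lists_length_eq[OF finite_edge, of k] by simp
  then have "finite ({1, 2} \<times> {es :: edge list. length es = k})" by simp
  moreover have "(\<lambda>l. (rng l, edges l)) ` level k \<subseteq> {1, 2} \<times> {es. length es = k}"
    using rng_verts by (auto simp: level_def)
  moreover have "inj_on (\<lambda>l. (rng l, edges l)) (level k)"
    by (auto simp: inj_on_def intro: vpath_eqI)
  ultimately show ?thesis by (intro inj_on_finite[of "\<lambda>l. (rng l, edges l)" "level k"])
qed

lemma cw_nonneg: "0 \<le> cw v"
proof -
  have "sqrt 2 \<le> sqrt 4" by (rule real_sqrt_le_mono) simp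
  then show ?thesis by (simp add: cw_def)
qed

lemma wt_nonneg: "0 \<le> wt l"
  using cw_nonneg rho_gt_1 by (simp add: wt_def)

lemma level_trace_add: "level_trace k (a + b) = level_trace k a + level_trace k b"
  by (simp add: level_trace_def blinfun.add_left distrib_left sum.distrib)

lemma level_trace_zero: "level_trace k 0 = 0"
  by (simp add: level_trace_def)

lemma level_trace_scale: "level_trace k (cmulL c o\<^sub>L b) = c * level_trace k b"
  by (simp add: level_trace_def cmulL.rep_eq sum_distrib_left mult_ac)

lemma level_trace_sum: "level_trace k (sum f I) = (\<Sum>i\<in>I. level_trace k (f i))"
  by (induction I rule: infinite_finite_induct) (auto simp: level_trace_zero level_trace_add)

text \<open>The diagonal entries of \<open>adjL y o\<^sub>L y\<close> are the squared norms of the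
  images of \<open>delta 1 l\<close> under \<open>y\<close>, and the weights are
  nonnegative.\<close>

lemma level_trace_positive:
  assumes y: "y \<in> operators"
  shows "level_trace k (adjL y o\<^sub>L y) \<in> \<real> \<and> 0 \<le> Re (level_trace k (adjL y o\<^sub>L y))"
proof -
  have z: "coord (blinfun_apply (adjL y) (blinfun_apply y (delta 1 l))) l
      = complex_of_real ((norm (blinfun_apply y (delta 1 l)))\<^sup>2)" for l
  proof -
    let ?v = "blinfun_apply y (delta 1 l)"
    let ?z = "coord (blinfun_apply (adjL y) ?v) l"
    have adj: "inner (blinfun_apply (adjL y) a) b = inner a (blinfun_apply y b)" for a b
      using adjoint_pair_commute[OF operators_pair[OF y]] by (simp add: adjoint_pair_def)
    have "?z \<bullet> c = inner ?v (cmul c ?v)" for c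
      using operators_cmul[OF y, of c "delta 1 l"] adj[of ?v "delta c l"] by (simp add: inner_delta)
    \<comment> \<open>Testing with 1 gives the real part; testing with \<open>\<i>\<close> gives the
      imaginary part, which vanishes because multiplication by \<open>\<i>\<close> is skew for the
      real inner product.\<close>
    from this[of 1] this[of \<i>]
    have re: "Re ?z = inner ?v ?v" and im: "Im ?z = inner ?v (cmul \<i> ?v)"
      by (simp_all add: cmul_algebra inner_complex_def)
    have "cmul (- \<i>) ?v = - cmul \<i> ?v" by (rule ell2_eqI) simp
    then have "inner (cmul \<i> ?v) ?v = - inner (cmul \<i> ?v) ?v"
      using inner_cmul_left[of \<i> ?v ?v] by (simp add: inner_commute)
    then have "Im ?z = 0" using im by (simp add: inner_commute)
    then show ?thesis using re by (simp add: complex_eq_iff power2_norm_eq_inner)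
  qed
  have "level_trace k (adjL y o\<^sub>L y) = complex_of_real (\<Sum>l\<in>level k. wt l * (norm (blinfun_apply y (delta 1 l)))\<^sup>2)"
    by (simp add: level_trace_def z)
  moreover have "0 \<le> (\<Sum>l\<in>level k. wt l * (norm (blinfun_apply y (delta 1 l)))\<^sup>2)"
    by (intro sum_nonneg mult_nonneg_nonneg wt_nonneg) auto
  ultimately show ?thesis by (simp only: Reals_of_real Re_complex_of_real)
qed

lemma opU_delta:
  "blinfun_apply (opU v n) (delta c l) = (if rng l = v then delta c (mkp v (odo n (edges l))) else 0)"
proof (rule ell2_eqI)
  fix m
  show "coord (blinfun_apply (opU v n) (delta c l)) m
      = coord (if rng l = v then delta c (mkp v (odo n (edges l))) else 0) m"
  proof (cases "rng m = v")
    case True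
    note vm = is_epath_rng[OF True]
    show ?thesis
    proof (cases "rng l = v")
      case l: True
      have "mkp v (odo (- n) (edges m)) = l \<longleftrightarrow> odo (- n) (edges m) = edges l"
        using mkp_inject[of v "odo (- n) (edges m)" v "edges l"] vm is_epath_rng[OF l] l by simp
      also have "\<dots> \<longleftrightarrow> edges m = odo n (edges l)" by (metis odo_minus)
      also have "\<dots> \<longleftrightarrow> m = mkp v (odo n (edges l))"
        using mkp_inject[of v "edges m" v "odo n (edges l)"] vm is_epath_rng[OF l] True by simp
      finally show ?thesis using True l by (simp add: coord_opU)
    next
      case False
      then have "mkp v (odo (- n) (edges m)) \<noteq> l" using vm by (metis is_epath_odo mkp_simps(1))
      then show ?thesis using False by (simp add: coord_opU)
    qed
  next
    case False
    have "m \<noteq> mkp v (odo n (edges l))" if "rng l = v"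
      using False is_epath_rng[OF that] by (metis is_epath_odo mkp_simps(1))
    then show ?thesis using False by (auto simp: coord_opU)
  qed
qed

lemma opS_delta:
  "blinfun_apply (opS e) (delta c l) = (if rng l = edge_s e then delta c (mkp (edge_r e) (e # edges l)) else 0)"
proof (rule ell2_eqI)
  fix m
  show "coord (blinfun_apply (opS e) (delta c l)) m
      = coord (if rng l = edge_s e then delta c (mkp (edge_r e) (e # edges l)) else 0) m"
  proof -
    have "mapS e m = Some l \<longleftrightarrow> mapS' e l = Some m" by (rule mapS_inv)
    moreover have "coord (blinfun_apply (opS e) (delta c l)) m = (if mapS e m = Some l then c else 0)"
      by (simp add: opS_def coord_pull split: option.split)
    moreover have "coord (if rng l = edge_s e then delta c (mkp (edge_r e) (e # edges l)) else 0) m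
        = (if mapS' e l = Some m then c else 0)"
      by (auto simp: mapS'_def)
    ultimately show ?thesis by simp
  qed
qed

lemma wt_odo: "rng l = v \<Longrightarrow> wt (mkp v (odo n (edges l))) = wt l"
  using is_epath_rng[of l v] by (simp add: wt_def)

lemma wt_Cons: "rng l = edge_s e \<Longrightarrow> rho * wt (mkp (edge_r e) (e # edges l)) = wt l"
proof -
  assume l: "rng l = edge_s e"
  have "psource exE (edge_r e, e # edges l) = psource exE (rng l, edges l)"
    using l by (auto simp: psource_def)
  then show ?thesis using rho_gt_1 is_epath_rng[OF l] by (simp add: wt_def)
qed

text \<open>A power of the odometer permutes the paths of length \<open>k\<close> with range
  \<open>v\<close> and keeps their source, hence their weight; the identity is a reindexing of the
  diagonal sum.\<close>

lemma level_trace_opU: "level_trace k (opU v n o\<^sub>L b) = level_trace k (b o\<^sub>L opU v n)"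
proof -
  let ?L = "{l \<in> level k. rng l = v}"
  have "level_trace k (opU v n o\<^sub>L b)
      = (\<Sum>l\<in>?L. wt l * coord (blinfun_apply b (delta 1 l)) (mkp v (odo (- n) (edges l))))"
    unfolding level_trace_def by (rule sum.mono_neutral_cong_right) (auto simp: coord_opU)
  also have "\<dots> = (\<Sum>l\<in>?L. wt l * coord (blinfun_apply b (delta 1 (mkp v (odo n (edges l))))) l)"
    by (rule sum.reindex_bij_witness[of _ "\<lambda>l. mkp v (odo n (edges l))" "\<lambda>l. mkp v (odo (- n) (edges l))"])
      (auto simp: level_def is_epath_rng wt_odo)
  also have "\<dots> = level_trace k (b o\<^sub>L opU v n)"
    unfolding level_trace_def by (rule sum.mono_neutral_cong_left) (auto simp: opU_delta blinfun.zero_right)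
  finally show ?thesis .
qed

text \<open>Prepending \<open>e\<close> maps the paths of length \<open>k\<close> with range
  \<open>edge_s e\<close> onto the paths of length \<open>k + 1\<close> beginning with
  \<open>e\<close> and divides the weight by \<open>rho\<close>; this is the origin of both the
  factor and the change of level.\<close>

lemma level_trace_opS: "rho * level_trace (Suc k) (opS e o\<^sub>L b) = level_trace k (b o\<^sub>L opS e)"
proof -
  let ?L = "{l \<in> level k. rng l = edge_s e}" and ?c = "\<lambda>l. mkp (edge_r e) (e # edges l)"
  let ?L' = "{l \<in> level (Suc k). rng l = edge_r e \<and> hd (edges l) = e}"
  have "level_trace (Suc k) (opS e o\<^sub>L b)
      = (\<Sum>l\<in>?L'. wt l * coord (blinfun_apply b (delta 1 l)) (mkp (edge_s e) (tl (edges l))))"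
    unfolding level_trace_def
    by (rule sum.mono_neutral_cong_right) (auto simp: finite_level[unfolded level_def] coord_opS level_def is_epath_edges split: list.split)
  also have "\<dots> = (\<Sum>l\<in>?L. wt (?c l) * coord (blinfun_apply b (delta 1 (?c l))) l)"
  proof (rule sum.reindex_bij_witness[of _ ?c "\<lambda>l. mkp (edge_s e) (tl (edges l))"])
    fix l assume l: "l \<in> ?L'"
    then obtain es where es: "edges l = e # es" by (cases "edges l") (auto simp: level_def)
    note ie = is_epath_edges[OF es]
    have eq: "mkp (edge_r e) (e # es) = l" using ie es mkp_simps(3)[of l] by simp
    then show "?c (mkp (edge_s e) (tl (edges l))) = l" using ie es by simp
    show "mkp (edge_s e) (tl (edges l)) \<in> ?L" using l ie es by (simp add: level_def)
    show "wt (?c (mkp (edge_s e) (tl (edges l)))) *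
        coord (blinfun_apply b (delta 1 (?c (mkp (edge_s e) (tl (edges l)))))) (mkp (edge_s e) (tl (edges l)))
        = wt l * coord (blinfun_apply b (delta 1 l)) (mkp (edge_s e) (tl (edges l)))"
      using ie es eq by simp
  qed (auto simp: level_def is_epath_rng)
  finally have "rho * level_trace (Suc k) (opS e o\<^sub>L b) = (\<Sum>l\<in>?L. (rho * wt (?c l)) * coord (blinfun_apply b (delta 1 (?c l))) l)"
    by (simp add: sum_distrib_left mult.assoc)
  also have "\<dots> = (\<Sum>l\<in>?L. wt l * coord (blinfun_apply b (delta 1 (?c l))) l)"
    by (intro sum.cong refl) (simp add: wt_Cons flip: of_real_mult)
  also have "\<dots> = level_trace k (b o\<^sub>L opS e)"
    unfolding level_trace_def by (rule sum.mono_neutral_cong_left) (auto simp: opS_delta blinfun.zero_right)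
  finally show ?thesis .
qed

lemma level_trace_vac: "level_trace (Suc k) (vac v o\<^sub>L b) = 0"
  unfolding level_trace_def by (rule sum.neutral) (auto simp: coord_vac level_def)

lemma level_trace_vac_right: "level_trace (Suc k) (b o\<^sub>L vac v) = 0"
proof -
  have "blinfun_apply (vac v) (delta 1 l) = 0" if "l \<in> level (Suc k)" for l
    using that by (intro ell2_eqI) (auto simp: coord_vac level_def)
  then show ?thesis unfolding level_trace_def by (simp add: blinfun.zero_right)
qed

lemma comp_assoc: "(a o\<^sub>L b) o\<^sub>L c = a o\<^sub>L (b o\<^sub>L c)"
  by (rule blinfun_eqI) simp

lemma comp_sum: "a o\<^sub>L (\<Sum>i\<in>I. f i) = (\<Sum>i\<in>I. a o\<^sub>L f i)"
  by (rule blinfun_eqI) (simp add: blinfun.sum_left blinfun.sum_right)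

lemma comp_id [simp]: "a o\<^sub>L id_blinfun = a" "id_blinfun o\<^sub>L a = a"
  by (rule blinfun_eqI; simp)+

lemma adjL_id [simp]: "adjL id_blinfun = id_blinfun"
  by (rule adjL_eq[OF adjoint_pair_id])

lemma comp_add: "a o\<^sub>L (b + c) = (a o\<^sub>L b) + (a o\<^sub>L c)"
  by (rule blinfun_eqI) (simp add: blinfun.add_left blinfun.add_right)

text \<open>The computation of \<open>kms_U_step\<close> with the defect \<open>vac v\<close> added
  to the Cuntz-Krieger sum; the defect contributes nothing above level 0. Orthogonality of the
  ranges is exact here.\<close>

lemma level_trace_U_step:
  "rho * level_trace (Suc k) (opU v n) = (\<Sum>e | edge_r e = v. if turn n e = e then level_trace k (opU (edge_s e) (carry n e)) else 0)"
proof -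
  have vac: "opU v 0 = vac v + (\<Sum>e | edge_r e = v. opS e o\<^sub>L opS' e)" by (simp flip: vac_eq)
  have "opU v n = opU v n o\<^sub>L opU v 0" by (simp add: opU_opU)
  also have "\<dots> = (opU v n o\<^sub>L vac v) + (\<Sum>e | edge_r e = v. opU v n o\<^sub>L (opS e o\<^sub>L opS' e))"
    by (subst vac, subst comp_add, subst comp_sum, rule refl)
  finally have "level_trace (Suc k) (opU v n)
      = level_trace (Suc k) ((opU v n o\<^sub>L vac v) + (\<Sum>e | edge_r e = v. opU v n o\<^sub>L (opS e o\<^sub>L opS' e)))"
    by (rule arg_cong)
  also have "\<dots> = (\<Sum>e | edge_r e = v. level_trace (Suc k) (opU v n o\<^sub>L (opS e o\<^sub>L opS' e)))"
    by (simp only: level_trace_add level_trace_sum level_trace_vac_right add_0)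
  finally have "level_trace (Suc k) (opU v n) = (\<Sum>e | edge_r e = v. level_trace (Suc k) (opU v n o\<^sub>L (opS e o\<^sub>L opS' e)))" .
  then have "rho * level_trace (Suc k) (opU v n) = (\<Sum>e | edge_r e = v. rho * level_trace (Suc k) (opU v n o\<^sub>L (opS e o\<^sub>L opS' e)))"
    by (simp add: sum_distrib_left)
  also have "\<dots> = (\<Sum>e | edge_r e = v. if turn n e = e then level_trace k (opU (edge_s e) (carry n e)) else 0)"
  proof (rule sum.cong[OF refl])
    fix e assume "e \<in> {e. edge_r e = v}"
    then have "opU v n o\<^sub>L (opS e o\<^sub>L opS' e) = opS (turn n e) o\<^sub>L (opU (edge_s e) (carry n e) o\<^sub>L opS' e)"
      by (simp add: opU_opS flip: comp_assoc)
    then have "rho * level_trace (Suc k) (opU v n o\<^sub>L (opS e o\<^sub>L opS' e))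
        = level_trace k (opU (edge_s e) (carry n e) o\<^sub>L (opS' e o\<^sub>L opS (turn n e)))"
      by (simp add: level_trace_opS comp_assoc)
    also have "\<dots> = (if turn n e = e then level_trace k (opU (edge_s e) (carry n e)) else 0)"
      using level_trace_zero by (auto simp: opS'_opS opU_opU)
    finally show "rho * level_trace (Suc k) (opU v n o\<^sub>L (opS e o\<^sub>L opS' e))
        = (if turn n e = e then level_trace k (opU (edge_s e) (carry n e)) else 0)" .
  qed
  finally show ?thesis .
qed

lemma level_trace_U1: "rho * level_trace (Suc k) (opU 1 n) = (if even n then 2 * level_trace k (opU 1 (n div 2)) else 0) + level_trace k (opU 2 0)"
proof -
  have "(n + 1) div 2 = n div 2" if "even n" using that by presburger
  then show ?thesis using level_trace_U_step[of k 1 n] by simp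
qed

lemma level_trace_U2: "rho * level_trace (Suc k) (opU 2 n) = 2 * level_trace k (opU 1 n) + (if even n then 2 * level_trace k (opU 2 (n div 2)) else 0)"
proof -
  have "(n + 1) div 2 = n div 2" if "even n" using that by presburger
  then show ?thesis using level_trace_U_step[of k 2 n] by simp
qed

lemma rho_cw: "rho * cw 1 = 2 * cw 1 + cw 2" "rho * cw 2 = 2 * cw 1 + 2 * cw 2"
  by (simp_all add: rho_def cw_def algebra_simps)

lemma level_trace_zero_level: "v = 1 \<or> v = 2 \<Longrightarrow> level_trace 0 (opU v 0) = cw v"
proof -
  assume v: "v = 1 \<or> v = 2"
  then have e: "is_epath exE (v, [])" by auto
  have "level_trace 0 (opU v 0) = (\<Sum>l\<in>level 0. if l = mkp v [] then complex_of_real (cw v) else 0)"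
    unfolding level_trace_def
  proof (rule sum.cong[OF refl])
    fix l assume "l \<in> level 0"
    then have l: "edges l = []" by (simp add: level_def)
    have "l = mkp v [] \<longleftrightarrow> rng l = v" using e mkp_Nil[OF l] by auto
    then show "wt l * coord (blinfun_apply (opU v 0) (delta 1 l)) l
        = (if l = mkp v [] then complex_of_real (cw v) else 0)"
      by (auto simp: l opU_delta wt_def psource_def mkp_Nil[OF l])
  qed
  also have "mkp v [] \<in> level 0" using e by (simp add: level_def)
  then have "(\<Sum>l\<in>level 0. if l = mkp v [] then complex_of_real (cw v) else 0) = cw v" by simp
  finally show ?thesis .
qed

text \<open>At exponent 0 one step of the recursion applies the edge-counting matrix divided by
  \<open>rho\<close>, which fixes the vector \<open>cw\<close>; so the values are the same at every
  level.\<close>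

lemma level_trace_U_zero: "level_trace k (opU 1 0) = cw 1 \<and> level_trace k (opU 2 0) = cw 2"
proof (induction k)
  case (Suc k)
  have rho0: "complex_of_real rho \<noteq> 0" using rho_gt_1 by simp
  have "rho * level_trace (Suc k) (opU 1 0) = complex_of_real (2 * cw 1 + cw 2)"
    "rho * level_trace (Suc k) (opU 2 0) = complex_of_real (2 * cw 1 + 2 * cw 2)"
    using Suc by (simp_all add: level_trace_U1 level_trace_U2)
  then have "rho * level_trace (Suc k) (opU 1 0) = rho * complex_of_real (cw 1)"
    "rho * level_trace (Suc k) (opU 2 0) = rho * complex_of_real (cw 2)"
    by (simp_all only: flip: rho_cw of_real_mult)
  then show ?case using rho0 by simp
qed (simp add: level_trace_zero_level)

lemma level_trace_id: "level_trace k id_blinfun = 1"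
proof -
  have "opU 1 0 + opU 2 0 = id_blinfun"
    by (rule op_eqI) (use rng_verts in \<open>auto simp: blinfun.add_left coord_opU intro: ccontr\<close>)
  then have "level_trace k id_blinfun = level_trace k (opU 1 0) + level_trace k (opU 2 0)" by (simp flip: level_trace_add)
  also have "\<dots> = complex_of_real (cw 1 + cw 2)" by (simp add: level_trace_U_zero)
  finally show ?thesis by (simp add: cw_def)
qed

lemma convergent_level_trace_U1: "convergent (\<lambda>k. level_trace k (opU 1 n))"
proof (induction "nat \<bar>n\<bar>" arbitrary: n rule: less_induct)
  case less
  show ?case
  proof (cases "n = 0")
    case False
    \<comment> \<open>The recursion expresses level \<open>k + 1\<close> at exponent
      \<open>n\<close> by level \<open>k\<close> at exponents of smaller absolute value, so
      convergence is inherited.\<close>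
    have "convergent (\<lambda>k. level_trace k (opU 1 (n div 2)))" if "even n"
      by (rule less) (use that False in \<open>auto elim!: evenE\<close>)
    then have "convergent (\<lambda>k. (if even n then 2 * level_trace k (opU 1 (n div 2)) else 0) + level_trace k (opU 2 0))"
      by (cases "even n") (auto simp: level_trace_U_zero intro!: convergent_add convergent_mult convergent_const)
    then have "convergent (\<lambda>k. rho * level_trace (Suc k) (opU 1 n))" by (simp only: level_trace_U1)
    then have "convergent (\<lambda>k. level_trace (Suc k) (opU 1 n))"
      using rho_gt_1 by (simp add: convergent_mult_const_iff)
    then show ?thesis using convergent_Suc_iff[of "\<lambda>k. level_trace k (opU 1 n)"] by simp
  qed (simp add: level_trace_U_zero convergent_const)
qed

lemma convergent_level_trace_U2: "convergent (\<lambda>k. level_trace k (opU 2 n))"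
proof (induction "nat \<bar>n\<bar>" arbitrary: n rule: less_induct)
  case less
  show ?case
  proof (cases "n = 0")
    case False
    have "convergent (\<lambda>k. level_trace k (opU 2 (n div 2)))" if "even n"
      by (rule less) (use that False in \<open>auto elim!: evenE\<close>)
    then have "convergent (\<lambda>k. 2 * level_trace k (opU 1 n) + (if even n then 2 * level_trace k (opU 2 (n div 2)) else 0))"
      using convergent_level_trace_U1[of n]
      by (cases "even n") (auto intro!: convergent_add convergent_mult convergent_const)
    then have "convergent (\<lambda>k. rho * level_trace (Suc k) (opU 2 n))" by (simp only: level_trace_U2)
    then have "convergent (\<lambda>k. level_trace (Suc k) (opU 2 n))"
      using rho_gt_1 by (simp add: convergent_mult_const_iff)
    then show ?thesis using convergent_Suc_iff[of "\<lambda>k. level_trace k (opU 2 n)"] by simp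
  qed (simp add: level_trace_U_zero convergent_const)
qed

text \<open>Degree in the path representation, for operators that send basis vectors to basis
  vectors or 0; nonzero degree forces a zero diagonal.\<close>

definition shifts :: "int \<Rightarrow> (vpath ell2 \<Rightarrow>\<^sub>L vpath ell2) \<Rightarrow> bool" where
  "shifts d T \<longleftrightarrow> (\<forall>l. blinfun_apply T (delta 1 l) = 0 \<or>
     (\<exists>m. blinfun_apply T (delta 1 l) = delta 1 m \<and> int (length (edges m)) = int (length (edges l)) + d))"

lemma shifts_comp:
  assumes S: "shifts c S" and T: "shifts d T" shows "shifts (c + d) (S o\<^sub>L T)"
  unfolding shifts_def
proof
  fix l
  consider "blinfun_apply T (delta 1 l) = 0"
    | m where "blinfun_apply T (delta 1 l) = delta 1 m" "int (length (edges m)) = int (length (edges l)) + d"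
    using T unfolding shifts_def by blast
  then show "blinfun_apply (S o\<^sub>L T) (delta 1 l) = 0 \<or> (\<exists>m. blinfun_apply (S o\<^sub>L T) (delta 1 l) = delta 1 m \<and>
      int (length (edges m)) = int (length (edges l)) + (c + d))"
  proof cases
    case 2
    then show ?thesis using S[unfolded shifts_def, rule_format, of m] by auto
  qed (simp add: blinfun.zero_right)
qed

lemma shifts_id: "shifts 0 id_blinfun"
  by (auto simp: shifts_def)

lemma shifts_opU: "shifts 0 (opU v n)"
  using is_epath_rng unfolding shifts_def by (auto simp: opU_delta)

lemma shifts_opS: "shifts 1 (opS e)"
  unfolding shifts_def
proof
  fix l
  show "blinfun_apply (opS e) (delta 1 l) = 0 \<or> (\<exists>m. blinfun_apply (opS e) (delta 1 l) = delta 1 m \<and>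
      int (length (edges m)) = int (length (edges l)) + 1)"
  proof (cases "rng l = edge_s e")
    case True
    then show ?thesis using is_epath_rng[OF True]
      by (intro disjI2 exI[of _ "mkp (edge_r e) (e # edges l)"]) (simp add: opS_delta)
  qed (simp add: opS_delta)
qed

lemma shifts_opS': "shifts (- 1) (opS' e)"
  unfolding shifts_def
proof
  fix l
  have c: "coord (blinfun_apply (opS' e) (delta 1 l)) m = (if mapS e l = Some m then 1 else 0)" for m
    by (simp add: opS'_def coord_pull mapS_inv split: option.split)
  show "blinfun_apply (opS' e) (delta 1 l) = 0 \<or> (\<exists>m. blinfun_apply (opS' e) (delta 1 l) = delta 1 m \<and>
      int (length (edges m)) = int (length (edges l)) + - 1)"
  proof (cases "mapS e l")
    case None
    then have "blinfun_apply (opS' e) (delta 1 l) = 0" by (intro ell2_eqI) (simp add: c)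
    then show ?thesis by blast
  next
    case (Some m)
    then have "blinfun_apply (opS' e) (delta 1 l) = delta 1 m" by (intro ell2_eqI) (auto simp: c)
    moreover have "edges l = e # edges m"
      using Some is_epath_edges[of l] by (auto simp: mapS_def split: list.splits if_splits)
    ultimately show ?thesis by auto
  qed
qed

lemma level_trace_shifts:
  assumes "shifts d T" "d \<noteq> 0" shows "level_trace k T = 0"
proof -
  have "coord (blinfun_apply T (delta 1 l)) l = 0" for l
    using assms(1)[unfolded shifts_def, rule_format, of l] assms(2) by auto
  then show ?thesis by (simp add: level_trace_def)
qed

text \<open>Makes the calculus of words available for operators.\<close>

interpretation Op: ss_family "opalg :: (vpath ell2 \<Rightarrow>\<^sub>L vpath ell2) cstar" uop pop opS
  by (rule ss_family.intro[OF opalg_cstar]) (simp add: ss_family_axioms_def family_op)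

lemma Op_sw_shifts: "shifts (int (length es)) (Op.sw es) \<and> shifts (- int (length es)) (adjL (Op.sw es)) \<and> Op.sw es \<in> operators"
proof (induction es)
  case Nil
  show ?case by (simp add: shifts_id operators_intros)
next
  case (Cons e es)
  then have o: "Op.sw es \<in> operators" by simp
  have "adjL (opS e o\<^sub>L Op.sw es) = adjL (Op.sw es) o\<^sub>L opS' e"
    using Op.star_mult[of "opS e" "Op.sw es"] o by (simp add: op_adj)
  then show ?case
    using shifts_comp[OF shifts_opS[of e], of "int (length es)" "Op.sw es"]
      shifts_comp[OF _ shifts_opS'[of e], of "- int (length es)" "adjL (Op.sw es)"] Cons
    by (simp add: operators_intros algebra_simps)
qed

lemma convergent_if: "convergent f \<Longrightarrow> convergent (\<lambda>k. if P then f k else (0 :: complex))"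
  by (cases P) (simp_all add: convergent_const)

text \<open>Words with halves of different length have nonzero degree and hence trace 0 at every
  level. Otherwise one outer pair of edges is removed for each level, as in
  \<open>kms_word_step\<close>, until the value is 0 or only the middle factor is left.\<close>

lemma convergent_level_trace_word:
  assumes v: "v = 1 \<or> v = 2" shows "convergent (\<lambda>k. level_trace k (Op.word es v n fs))"
proof (induction es arbitrary: fs)
  have zero: "convergent (\<lambda>k. level_trace k (Op.word es v n fs))" if "length es \<noteq> length fs" for es fs
  proof -
    have "shifts (int (length es) + 0 + - int (length fs)) (Op.word es v n fs)"
      unfolding Op.word_def opalg_simps uop_gpow using Op_sw_shifts by (intro shifts_comp shifts_opU) auto
    then have "level_trace k (Op.word es v n fs) = 0" for k by (rule level_trace_shifts) (use that in auto)
    then show ?thesis by (simp add: convergent_const)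
  qed
  {
    case Nil
    show ?case
    proof (cases fs)
      case Nil
      then show ?thesis using v convergent_level_trace_U1 convergent_level_trace_U2 by (auto simp: Op.word_def uop_gpow)
    qed (simp add: zero)
  next
    case (Cons e es)
    show ?case
    proof (cases fs)
      case (Cons f fs')
      let ?X = "Op.word es v n fs'"
      have wo: "?X \<in> operators" using Op.word_closed[OF v] by simp
      have "Op.word (e # es) v n fs = opS e o\<^sub>L (?X o\<^sub>L opS' f)"
        using v Op_sw_shifts[of fs'] Op.star_mult[of "opS f" "Op.sw fs'"]
        by (simp add: Cons Op.word_def op_adj comp_assoc)
      then have "rho * level_trace (Suc k) (Op.word (e # es) v n fs) = level_trace k (?X o\<^sub>L (opS' f o\<^sub>L opS e))" for k
        by (simp add: level_trace_opS comp_assoc)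
      moreover have "level_trace k (?X o\<^sub>L (opS' f o\<^sub>L opS e)) = (if e = f then level_trace k (opU (edge_s e) 0 o\<^sub>L ?X) else 0)" for k
        using level_trace_zero by (auto simp: opS'_opS level_trace_opU)
      moreover have "opU (edge_s e) 0 o\<^sub>L ?X = (if (case es of [] \<Rightarrow> v | e # _ \<Rightarrow> edge_r e) = edge_s e then ?X else 0)"
        using Op.p_word[OF v Op.edge_verts(1), of e es n fs'] by (simp add: pop_def)
      ultimately have *: "rho * level_trace (Suc k) (Op.word (e # es) v n fs)
          = (if e = f \<and> (case es of [] \<Rightarrow> v | e # _ \<Rightarrow> edge_r e) = edge_s e then level_trace k ?X else 0)" for k
        by (cases "e = f"; simp add: level_trace_zero)
      have "convergent (\<lambda>k. rho * level_trace (Suc k) (Op.word (e # es) v n fs))"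
        unfolding * by (rule convergent_if[OF Cons.IH])
      then have "convergent (\<lambda>k. level_trace (Suc k) (Op.word (e # es) v n fs))"
        using rho_gt_1 by (simp add: convergent_mult_const_iff)
      then show ?thesis using convergent_Suc_iff[of "\<lambda>k. level_trace k (Op.word (e # es) v n fs)"] by simp
    qed (simp add: zero)
  }
qed

lemma convergent_level_trace_mon:
  assumes m: "m \<in> mon opalg Op.gens" shows "convergent (\<lambda>k. level_trace k m)"
proof -
  have mo: "m \<in> operators" using Op.mon_closed[OF Op.gens_closed] m by auto
  \<comment> \<open>For operators the ranges are orthogonal, so the zero ideal serves in the
    reduction to words, which becomes an equality.\<close>
  have orth: "adjL (opS e) o\<^sub>L opS f \<in> {0}" if "e \<noteq> f" for e f
    using that by (simp add: op_adj opS'_opS)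
  have part: "convergent (\<lambda>k. level_trace k (m o\<^sub>L opU v 0))" if v: "v = 1 \<or> v = 2" for v
  proof -
    have "pop v = Op.word [] v 0 []" using v by (simp add: Op.word_def Op.u_id)
    then have "pop v \<in> Op.words" using Op.wordsI[OF v] by simp
    then obtain w where w: "w \<in> Op.words" "m \<otimes>\<^bsub>opalg\<^esub> pop v \<ominus>\<^bsub>opalg\<^esub> w \<in> {0}"
      using Op.mon_words[of "{0}" m "pop v"] Op.zeroideal orth m by auto
    have "w \<in> operators" using w Op.words_closed by auto
    then have "m o\<^sub>L opU v 0 = w" using w(2) by (simp add: opalg_minus pop_def)
    moreover have "convergent (\<lambda>k. level_trace k w)"
      using w(1) convergent_level_trace_word by (auto simp: Op.words_def level_trace_zero convergent_const)
    ultimately show ?thesis by simp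
  qed
  have "opU 1 0 + opU 2 0 = id_blinfun" using Op.p_sum by (simp add: pop_def)
  then have "m = (m o\<^sub>L opU 1 0) + (m o\<^sub>L opU 2 0)" by (simp flip: comp_add)
  then have "level_trace k m = level_trace k (m o\<^sub>L opU 1 0) + level_trace k (m o\<^sub>L opU 2 0)" for k by (metis level_trace_add)
  then show ?thesis using part[of 1] part[of 2] by (simp add: convergent_add)
qed

section \<open>Existence\<close>

text \<open>Transport of structure along an injection on the carrier, used to move an algebra into a
  prescribed type; \<open>r\<close> chooses preimages.\<close>

definition transport :: "('a \<Rightarrow> 'b) \<Rightarrow> 'a cstar \<Rightarrow> 'b cstar" where
  "transport f A = (let r = inv_into (carrier A) f in
     \<lparr>carrier = f ` carrier A, monoid.mult = (\<lambda>x y. f (r x \<otimes>\<^bsub>A\<^esub> r y)), one = f \<one>\<^bsub>A\<^esub>,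
      zero = f \<zero>\<^bsub>A\<^esub>, add = (\<lambda>x y. f (r x \<oplus>\<^bsub>A\<^esub> r y)), module.smult = (\<lambda>c x. f (c \<odot>\<^bsub>A\<^esub> r x)),
      adj = (\<lambda>x. f (adj A (r x))), nrm = (\<lambda>x. nrm A (r x))\<rparr>)"

locale cstar_transport = cstar_algebra A for A :: "'a cstar" (structure) +
  fixes f :: "'a \<Rightarrow> 'b"
  assumes inj: "inj_on f (carrier A)"
begin

abbreviation B :: "'b cstar" where "B \<equiv> transport f A"

abbreviation r :: "'b \<Rightarrow> 'a" where "r \<equiv> inv_into (carrier A) f"

lemma r_f: "x \<in> carrier A \<Longrightarrow> r (f x) = x"
  by (simp add: inj)

lemma B_simps:
  "carrier B = f ` carrier A" "\<one>\<^bsub>B\<^esub> = f \<one>" "\<zero>\<^bsub>B\<^esub> = f \<zero>"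
  "x \<in> carrier A \<Longrightarrow> y \<in> carrier A \<Longrightarrow> f x \<otimes>\<^bsub>B\<^esub> f y = f (x \<otimes> y)"
  "x \<in> carrier A \<Longrightarrow> y \<in> carrier A \<Longrightarrow> f x \<oplus>\<^bsub>B\<^esub> f y = f (x \<oplus> y)"
  "x \<in> carrier A \<Longrightarrow> c \<odot>\<^bsub>B\<^esub> f x = f (c \<odot> x)"
  "x \<in> carrier A \<Longrightarrow> adj B (f x) = f (adj A x)"
  "x \<in> carrier A \<Longrightarrow> nrm B (f x) = nrm A x"
  by (simp_all add: transport_def Let_def inj)

lemma f_eq: "x \<in> carrier A \<Longrightarrow> y \<in> carrier A \<Longrightarrow> f x = f y \<longleftrightarrow> x = y"
  using inj by (auto simp: inj_on_def)

lemma B_ring: "ring B"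
proof (rule ringI)
  show "abelian_group B"
  proof (rule abelian_groupI)
    show "\<exists>y\<in>carrier B. y \<oplus>\<^bsub>B\<^esub> x = \<zero>\<^bsub>B\<^esub>" if "x \<in> carrier B" for x
    proof -
      from that have "x \<in> f ` carrier A" by (simp add: B_simps)
      then obtain a where "x = f a" "a \<in> carrier A" by blast
      then show ?thesis by (intro bexI[of _ "f (\<ominus> a)"]) (simp_all add: B_simps l_neg)
    qed
  qed (auto simp: B_simps a_ac)
  show "monoid B" by (rule monoidI) (auto simp: B_simps m_assoc)
qed (auto simp: B_simps l_distr r_distr)

lemma B_nstar: "nstar_algebra B"
proof -
  interpret Br: ring B by (rule B_ring)
  show ?thesis
    by unfold_locales
      (auto simp: B_simps scale_add_left scale_add_right scale_scale scale_mult_left scale_mult_right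
        star_add star_scale star_mult norm_eq_0 norm_triangle norm_scale norm_mult_le f_eq)
qed

sublocale Bn: nstar_algebra B by (rule B_nstar)

lemma B_diff: "x \<in> carrier A \<Longrightarrow> y \<in> carrier A \<Longrightarrow> f x \<ominus>\<^bsub>B\<^esub> f y = f (x \<ominus> y)"
  by (simp add: Bn.diff_eq_scale diff_eq_scale B_simps)

lemma B_cstar: "cstar_algebra B"
proof (rule Bn.cstar_algebraI)
  show "nrm B (adj B x \<otimes>\<^bsub>B\<^esub> x) = (nrm B x)\<^sup>2" if "x \<in> carrier B" for x
    using that by (auto simp: B_simps cstar_identity)
  show "Metric_space.mcomplete (carrier B) (ndist B)"
    unfolding Bn.metric.mcomplete_def
  proof (intro allI impI)
    fix X assume X: "Bn.metric.MCauchy X"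
    define Y where "Y = (\<lambda>n. r (X n))"
    have XY: "X n = f (Y n)" "Y n \<in> carrier A" for n
    proof -
      have "X n \<in> carrier B" using X unfolding Bn.metric.MCauchy_def by blast
      then have "X n \<in> f ` carrier A" by (simp only: B_simps)
      then show "X n = f (Y n)" "Y n \<in> carrier A" by (auto simp: Y_def r_f)
    qed
    have d: "ndist B (X m) (X n) = ndist A (Y m) (Y n)" for m n
      using XY by (simp add: ndist_def B_simps B_diff)
    have "metric.MCauchy Y"
      using X XY unfolding metric.MCauchy_def Bn.metric.MCauchy_def d by auto
    then obtain l where l: "limitin (ntop A) Y l sequentially"
      using complete by (auto simp: metric.mcomplete_def)
    then have "limitin (ntop B) X (f l) sequentially"
      unfolding limitin_iff Bn.limitin_iff using XY by (simp add: B_simps B_diff)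
    then show "\<exists>l. limitin (ntop B) X l sequentially" by blast
  qed
qed

lemma f_star_hom: "f \<in> star_hom A B"
  unfolding star_hom_def by (auto intro!: ring_hom_memI simp: B_simps)

lemma r_star_hom: "r \<in> star_hom B A"
  unfolding star_hom_def by (auto intro!: ring_hom_memI simp: B_simps r_f)

end

locale star_hom_loc = A: nstar_algebra A + B: nstar_algebra B for A :: "'a cstar" and B :: "'b cstar" +
  fixes h assumes hom: "h \<in> star_hom A B"
begin

lemma h_closed [simp]: "x \<in> carrier A \<Longrightarrow> h x \<in> carrier B"
  and h_mult: "x \<in> carrier A \<Longrightarrow> y \<in> carrier A \<Longrightarrow> h (x \<otimes>\<^bsub>A\<^esub> y) = h x \<otimes>\<^bsub>B\<^esub> h y"
  and h_add: "x \<in> carrier A \<Longrightarrow> y \<in> carrier A \<Longrightarrow> h (x \<oplus>\<^bsub>A\<^esub> y) = h x \<oplus>\<^bsub>B\<^esub> h y"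
  and h_one: "h \<one>\<^bsub>A\<^esub> = \<one>\<^bsub>B\<^esub>"
  and h_scale: "x \<in> carrier A \<Longrightarrow> h (c \<odot>\<^bsub>A\<^esub> x) = c \<odot>\<^bsub>B\<^esub> h x"
  and h_star: "x \<in> carrier A \<Longrightarrow> h (adj A x) = adj B (h x)"
proof -
  have r: "h \<in> ring_hom A B" using hom by (simp add: star_hom_def)
  show "x \<in> carrier A \<Longrightarrow> h x \<in> carrier B" using r by (rule ring_hom_closed)
  show "x \<in> carrier A \<Longrightarrow> y \<in> carrier A \<Longrightarrow> h (x \<otimes>\<^bsub>A\<^esub> y) = h x \<otimes>\<^bsub>B\<^esub> h y" using r by (rule ring_hom_mult)
  show "x \<in> carrier A \<Longrightarrow> y \<in> carrier A \<Longrightarrow> h (x \<oplus>\<^bsub>A\<^esub> y) = h x \<oplus>\<^bsub>B\<^esub> h y" using r by (rule ring_hom_add)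
  show "h \<one>\<^bsub>A\<^esub> = \<one>\<^bsub>B\<^esub>" using r by (rule ring_hom_one)
qed (use hom in \<open>simp_all add: star_hom_def\<close>)

lemma h_zero: "h \<zero>\<^bsub>A\<^esub> = \<zero>\<^bsub>B\<^esub>"
  using h_scale[of "\<zero>\<^bsub>A\<^esub>" 0] by simp

lemma h_diff: "x \<in> carrier A \<Longrightarrow> y \<in> carrier A \<Longrightarrow> h (x \<ominus>\<^bsub>A\<^esub> y) = h x \<ominus>\<^bsub>B\<^esub> h y"
  by (simp add: A.diff_eq_scale B.diff_eq_scale h_add h_scale)

lemma h_finsum:
  assumes "finite I" "g \<in> I \<rightarrow> carrier A"
  shows "h (finsum A g I) = finsum B (\<lambda>i. h (g i)) I"
  using assms by (induction I rule: finite_induct) (auto simp: h_zero h_add Pi_iff)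

lemma h_range_sum:
  assumes "\<And>e. s e \<in> carrier A"
  shows "h (range_sum exE A s v) = range_sum exE B (\<lambda>e. h (s e)) v"
  unfolding range_sum_def using assms finite_arcs_into[of v]
  by (subst h_finsum) (auto simp: h_mult h_star)

text \<open>All defining relations are equations in the operations, except the Toeplitz inequality,
  whose witness \<open>adj A y \<otimes> y\<close> is carried along by \<open>h\<close>.\<close>

lemma h_family:
  assumes A: "cstar_algebra A" and fam: "toeplitz_family exE exG A u p s"
  shows "toeplitz_family exE exG B (\<lambda>g. h (u g)) (\<lambda>v. h (p v)) (\<lambda>e. h (s e))"
proof -
  interpret S: ss_family A u p s
    by (rule ss_family.intro[OF A]) (simp add: ss_family_axioms_def fam)
  have proj: "projection B (h x)" if "projection A x" for x
    using that unfolding projection_def by (metis h_closed h_mult h_star)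
  have pi: "partial_isometry B (h x)" if "partial_isometry A x" for x
    using that unfolding partial_isometry_def by (metis A.m_closed A.star_closed h_closed h_mult h_star)
  have sh: "adj B (h x) \<otimes>\<^bsub>B\<^esub> h y = h (adj A x \<otimes>\<^bsub>A\<^esub> y)" "h x \<otimes>\<^bsub>B\<^esub> adj B (h y) = h (x \<otimes>\<^bsub>A\<^esub> adj A y)"
    "h x \<otimes>\<^bsub>B\<^esub> h y = h (x \<otimes>\<^bsub>A\<^esub> y)"
    if "x \<in> carrier A" "y \<in> carrier A" for x y
    using that by (simp_all add: h_mult h_star)
  have g: "groupoid_rep exE exG B (\<lambda>g. h (u g))"
    using S.rep_u unfolding groupoid_rep_def
    by (auto simp: proj pi sh S.u_pi h_zero)
  have "cle B (range_sum exE B (\<lambda>e. h (s e)) v) (h (p v))" if v: "v = 1 \<or> v = 2" for v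
  proof -
    have "cle A (range_sum exE A s v) (p v)" using S.tck v by (auto simp: TCK_family_def)
    then obtain y where y: "y \<in> carrier A" "p v \<ominus>\<^bsub>A\<^esub> range_sum exE A s v = adj A y \<otimes>\<^bsub>A\<^esub> y"
      by (auto simp: cle_def cpositive_def)
    have "h (p v) \<ominus>\<^bsub>B\<^esub> range_sum exE B (\<lambda>e. h (s e)) v = h (p v \<ominus>\<^bsub>A\<^esub> range_sum exE A s v)"
      using v by (simp add: h_diff h_range_sum)
    also have "\<dots> = adj B (h y) \<otimes>\<^bsub>B\<^esub> h y" using y by (simp add: h_mult h_star)
    finally show ?thesis using y(1) by (auto simp: cle_def cpositive_def)
  qed
  then have t: "TCK_family exE B (\<lambda>v. h (p v)) (\<lambda>e. h (s e))"
    using S.tck unfolding TCK_family_def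
    by (auto simp: proj pi sh h_zero)
  show ?thesis
    unfolding toeplitz_family_def
  proof (intro conjI g t ballI)
    show "h (u (piso_id exE v)) = h (p v)" if "v \<in> verts exE" for v
      using that S.u_id by (auto simp: gpow_zero)
    show "(\<Oplus>\<^bsub>B\<^esub>v\<in>verts exE. h (p v)) = \<one>\<^bsub>B\<^esub>"
      using h_finsum[of "verts exE" p] S.sum_p by (auto simp: h_one)
    fix g e assume g: "g \<in> exG"
    have "h (u g) \<otimes>\<^bsub>B\<^esub> h (s e) = h (u g \<otimes>\<^bsub>A\<^esub> s e)" using g by (simp add: sh S.u_pi)
    also have "\<dots> = (if pdom g = head exE e
        then h (s (edge_act exE g e)) \<otimes>\<^bsub>B\<^esub> h (u (restriction exE exG g e)) else \<zero>\<^bsub>B\<^esub>)"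
    proof -
      have "restriction exE exG g e \<in> exG" if "pdom g = head exE e"
        using g that edge_r_verts(2)[of e] by (auto simp: restriction_gpow elim!: exG_cases)
      then show ?thesis by (simp add: S.u_s[OF g] sh S.u_pi h_zero)
    qed
    finally show "h (u g) \<otimes>\<^bsub>B\<^esub> h (s e) = (if pdom g = head exE e
        then h (s (edge_act exE g e)) \<otimes>\<^bsub>B\<^esub> h (u (restriction exE exG g e)) else \<zero>\<^bsub>B\<^esub>)" .
  qed
qed

end

text \<open>The universal property quantifies over algebras with carrier in \<^typ>\<open>nat \<Rightarrow> nat \<Rightarrow> complex\<close>, so
  operators have to be passed to it as matrices.\<close>

definition entries :: "('i::countable ell2 \<Rightarrow>\<^sub>L 'i ell2) \<Rightarrow> nat \<Rightarrow> nat \<Rightarrow> complex" where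
  "entries T m n = coord (blinfun_apply T (delta 1 (from_nat n))) (from_nat m)"

text \<open>An operator \<open>D\<close> with zero matrix kills all basis vectors. The coordinates
  of \<open>adjL D\<close> applied to any vector are determined by inner products with their images,
  so \<open>adjL D\<close> is 0, and with it \<open>D\<close>.\<close>

lemma entries_inj: "inj_on entries operators"
proof (rule inj_onI)
  fix T S :: "'i::countable ell2 \<Rightarrow>\<^sub>L 'i ell2"
  assume TS: "T \<in> operators" "S \<in> operators" and eq: "entries T = entries S"
  let ?D = "T - S"
  have D: "?D \<in> operators" using TS by (rule operators_intros)
  have "coord (blinfun_apply ?D (delta 1 j)) i = 0" for i j
    using fun_cong[OF fun_cong[OF eq, of "to_nat i"], of "to_nat j"]
    by (simp add: entries_def blinfun.diff_left)
  then have D1: "blinfun_apply ?D (delta 1 j) = 0" for j by (intro ell2_eqI) simp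
  have D0: "blinfun_apply ?D (delta c j) = 0" for c j
    using operators_cmul[OF D, of c "delta 1 j"] D1[of j] by (simp add: cmul_algebra)
  have "blinfun_apply (adjL ?D) x = 0" for x
  proof (rule ell2_eqI, rule complex_eq_inner)
    fix i c
    show "coord (blinfun_apply (adjL ?D) x) i \<bullet> c = coord 0 i \<bullet> c"
      using adjoint_pair_commute[OF operators_pair[OF D]] D0[of c i]
      by (simp add: adjoint_pair_def flip: inner_delta)
  qed
  then have "adjL ?D = 0" by (intro blinfun_eqI) simp
  then have "norm ?D = 0" using adjoint_pair_norm[OF operators_pair[OF D]] by simp
  then show "T = S" by simp
qed

context ss_family
begin

lemma CK_KMS_intro:
  assumes st: "state_on A \<phi>"
    and CK: "\<And>v b c. b \<in> carrier A \<Longrightarrow> c \<in> carrier A \<Longrightarrow> v = 1 \<or> v = 2 \<Longrightarrow>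
      \<phi> (c \<otimes> (p v \<ominus> range_sum exE A s v) \<otimes> b) = 0"
    and U: "\<And>v n x. v = 1 \<or> v = 2 \<Longrightarrow> x \<in> carrier A \<Longrightarrow> \<phi> (x \<otimes> U v n) = \<phi> (U v n \<otimes> x)"
    and S: "\<And>e x. x \<in> carrier A \<Longrightarrow> \<phi> (x \<otimes> s e) = complex_of_real rho * \<phi> (s e \<otimes> x)"
  shows "CK_KMS \<phi>"
  unfolding CK_KMS_def
proof (intro conjI allI ballI impI)
  show "state_on A \<phi>" by (rule st)
  show "\<phi> (c \<otimes> (p v \<ominus> range_sum exE A s v) \<otimes> b) = 0"
    if "b \<in> carrier A" "c \<in> carrier A" "v = 1 \<or> v = 2" for v b c using that by (rule CK)
  show "\<phi> (x \<otimes> U v n) = \<phi> (U v n \<otimes> x)" if "x \<in> carrier A" "v = 1 \<or> v = 2" for v n x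
    using that(2,1) by (rule U)
  show "\<phi> (x \<otimes> s e) = complex_of_real rho * \<phi> (s e \<otimes> x)" if "x \<in> carrier A" for e x
    using that by (rule S)
qed

text \<open>Monomials can be moved to the other side of an argument of \<open>\<phi>\<close> at the cost of a constant, so it
  is enough that \<open>\<phi>\<close> kills the right ideal generated by the Cuntz-Krieger differences.\<close>

lemma CK_KMSI:
  assumes gen: "generates A gens" and st: "state_on A \<phi>"
    and U: "\<And>v n x. v = 1 \<or> v = 2 \<Longrightarrow> x \<in> carrier A \<Longrightarrow> \<phi> (x \<otimes> U v n) = \<phi> (U v n \<otimes> x)"
    and S: "\<And>e x. x \<in> carrier A \<Longrightarrow> \<phi> (x \<otimes> s e) = complex_of_real rho * \<phi> (s e \<otimes> x)"
    and CK: "\<And>v x. v = 1 \<or> v = 2 \<Longrightarrow> x \<in> carrier A \<Longrightarrow> \<phi> ((p v \<ominus> range_sum exE A s v) \<otimes> x) = 0"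
  shows "CK_KMS \<phi>"
proof -
  have rho0: "complex_of_real rho \<noteq> 0" using rho_gt_1 by simp
  have star: "\<phi> (adj A (s e) \<otimes> x) = complex_of_real rho * \<phi> (x \<otimes> adj A (s e))" if "x \<in> carrier A" for e x
    using S[of "adj A x" e] state_star[OF st, of "adj A x \<otimes> s e"] state_star[OF st, of "s e \<otimes> adj A x"] that
    by (simp add: star_mult)
  have genk: "\<exists>\<kappa>. \<forall>x\<in>carrier A. \<phi> (y \<otimes> x) = \<kappa> * \<phi> (x \<otimes> y)"
    if y: "g \<in> gens" "y = g \<or> y = adj A g" for g y
  proof -
    from y(1) consider h where "h \<in> exG" "g = u h" | w where "w = 1 \<or> w = 2" "g = U w 0" | e where "g = s e"
      by (auto simp: u_id)
    then consider w n where "w = 1 \<or> w = 2" "g = U w n" | e where "g = s e"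
      by (metis exG_cases)
    then show ?thesis
    proof cases
      case 1
      then have "\<exists>m. y = U w m" using y(2) U_star[of w n] by auto
      then show ?thesis using U[OF 1(1)] by (intro exI[of _ 1]) auto
    next
      case 2
      then consider "y = s e" | "y = adj A (s e)" using y(2) by blast
      then show ?thesis
      proof cases
        case 1
        then show ?thesis using S[of _ e] rho0 by (intro exI[of _ "1 / complex_of_real rho"]) auto
      next
        case 2
        then show ?thesis using star[of _ e] by (intro exI[of _ "complex_of_real rho"]) auto
      qed
    qed
  qed
  have monk: "\<exists>\<kappa>. \<forall>x\<in>carrier A. \<phi> (m \<otimes> x) = \<kappa> * \<phi> (x \<otimes> m)" if "m \<in> mon A gens" for m
  proof -
    have step: "\<exists>\<kappa>. \<forall>x\<in>carrier A. \<phi> (y \<otimes> m \<otimes> x) = \<kappa> * \<phi> (x \<otimes> (y \<otimes> m))"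
      if c: "y \<in> carrier A" "m \<in> carrier A" and ym: "\<exists>\<kappa>. \<forall>x\<in>carrier A. \<phi> (y \<otimes> x) = \<kappa> * \<phi> (x \<otimes> y)"
        "\<exists>\<kappa>. \<forall>x\<in>carrier A. \<phi> (m \<otimes> x) = \<kappa> * \<phi> (x \<otimes> m)" for y m
    proof -
      obtain a b where a: "\<And>x. x \<in> carrier A \<Longrightarrow> \<phi> (y \<otimes> x) = a * \<phi> (x \<otimes> y)"
        and b: "\<And>x. x \<in> carrier A \<Longrightarrow> \<phi> (m \<otimes> x) = b * \<phi> (x \<otimes> m)" using ym by blast
      have "\<phi> (y \<otimes> m \<otimes> x) = (a * b) * \<phi> (x \<otimes> (y \<otimes> m))" if "x \<in> carrier A" for x
        using a[of "m \<otimes> x"] b[of "x \<otimes> y"] that c by (simp add: m_assoc)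
      then show ?thesis by blast
    qed
    from that show ?thesis
    proof (induction m rule: mon.induct)
      case one
      then show ?case by (intro exI[of _ 1]) simp
    next
      case (gen g m)
      have "g \<in> carrier A" "m \<in> carrier A" using gen gens_closed mon_closed[OF gens_closed] by blast+
      then show ?case using genk[OF gen.hyps(1), of g] gen.IH by (intro step) auto
    next
      case (star g m)
      have "g \<in> carrier A" "m \<in> carrier A" using star gens_closed mon_closed[OF gens_closed] by blast+
      then show ?case using genk[OF star.hyps(1), of "adj A g"] star.IH by (intro step) auto
    qed
  qed
  have "\<phi> (c \<otimes> (p v \<ominus> range_sum exE A s v) \<otimes> b) = 0"
    if bc: "b \<in> carrier A" "c \<in> carrier A" and v: "v = 1 \<or> v = 2" for v b c
  proof -
    let ?d = "(p v \<ominus> range_sum exE A s v) \<otimes> b"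
    have d: "?d \<in> carrier A" using bc v by simp
    have "\<phi> (c \<otimes> ?d) = 0"
    proof (rule bdd_fun_eqI[OF gen bdd_fun_right[OF state_bdd[OF st] d], of 0 "\<lambda>_. 0"])
      show "bdd_fun A 0 (\<lambda>_. 0)" by (simp add: bdd_fun_def lin_fun_def)
      show "\<phi> (m \<otimes> ?d) = 0" if m: "m \<in> mon A gens" for m
      proof -
        have mc: "m \<in> carrier A" using m mon_closed[OF gens_closed] by blast
        obtain \<kappa> where "\<phi> (m \<otimes> ?d) = \<kappa> * \<phi> (?d \<otimes> m)" using monk[OF m] d by blast
        also have "?d \<otimes> m = (p v \<ominus> range_sum exE A s v) \<otimes> (b \<otimes> m)" using bc mc v by (simp add: m_assoc)
        also have "\<phi> \<dots> = 0" using CK[OF v] bc mc by simp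
        finally show ?thesis by simp
      qed
    qed (use bc in simp)
    then show ?thesis using bc v by (simp add: m_assoc)
  qed
  then show ?thesis by (intro CK_KMS_intro st U S)
qed

text \<open>Composed with the path representation \<open>h\<close>, the level functionals are
  states, hence bounded by 2 uniformly in the level; this extends their convergence from monomials
  to the whole algebra.\<close>

lemma CK_KMS_exists:
  assumes gen: "generates A gens" and h: "h \<in> star_hom A opalg"
    and hu: "\<And>g. g \<in> exG \<Longrightarrow> h (u g) = uop g" and hp: "\<And>v. v = 1 \<or> v = 2 \<Longrightarrow> h (p v) = pop v"
    and hs: "\<And>e. h (s e) = opS e"
  shows "\<exists>\<phi>. CK_KMS \<phi>"
proof -
  interpret h: star_hom_loc A opalg h
    by (intro star_hom_loc.intro star_hom_loc_axioms.intro nstar_algebra_axioms opalg_nstar h)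
  have ho: "h x \<in> operators" if "x \<in> carrier A" for x using h.h_closed[OF that] by simp
  have hgen: "h g \<in> Op.gens" if "g \<in> gens" for g
    using that hu hp hs by auto
  have hmon: "h m \<in> mon opalg Op.gens" if "m \<in> mon A gens" for m
    using that
  proof (induction m rule: mon.induct)
    case one
    then show ?case using h.h_one mon.one[of opalg] by metis
  next
    case (gen g m)
    have "g \<in> carrier A" "m \<in> carrier A" using gen gens_closed mon_closed[OF gens_closed] by blast+
    then show ?case using mon.gen[OF hgen[OF gen.hyps(1)] gen.IH] by (simp only: h.h_mult)
  next
    case (star g m)
    have c: "g \<in> carrier A" "m \<in> carrier A" using star gens_closed mon_closed[OF gens_closed] by blast+
    then show ?case using mon.star[OF hgen[OF star.hyps(1)] star.IH] by (simp only: h.h_mult h.h_star star_closed)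
  qed
  have st: "state_on A (\<lambda>x. level_trace k (h x))" for k
    unfolding state_on_def lin_fun_def
  proof (intro conjI ballI allI)
    fix y assume y: "y \<in> carrier A"
    have "level_trace k (h (adj A y \<otimes> y)) = level_trace k (adjL (h y) o\<^sub>L h y)" using y by (simp add: h.h_mult h.h_star)
    then show "level_trace k (h (adj A y \<otimes> y)) \<in> \<real>" "0 \<le> Re (level_trace k (h (adj A y \<otimes> y)))"
      using level_trace_positive[OF ho[OF y]] by auto
  qed (simp_all add: h.h_add h.h_scale h.h_one level_trace_add level_trace_scale level_trace_id)
  note bd = state_bdd[OF st]
  have conv: "convergent (\<lambda>k. level_trace k (h x))" if x: "x \<in> carrier A" for x
  proof -
    let ?V = "{x \<in> carrier A. convergent (\<lambda>k. level_trace k (h x))}"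
    have "x \<in> ?V"
    proof (rule generates_induct[OF gen _ _ _ x])
      show "linear_subspace A ?V"
        unfolding linear_subspace_def
        by (auto simp: h.h_add h.h_scale h.h_zero level_trace_add level_trace_scale level_trace_zero
          intro!: convergent_add convergent_mult convergent_const)
      show "mon A gens \<subseteq> ?V"
        using hmon convergent_level_trace_mon mon_closed[OF gens_closed] by auto
      fix x assume x: "x \<in> carrier A" and ap: "\<And>e. e > 0 \<Longrightarrow> \<exists>y\<in>?V. nrm A (x \<ominus> y) < e"
      have "Cauchy (\<lambda>k. level_trace k (h x))"
      proof (rule CauchyI)
        \<comment> \<open>With \<open>e / 8\<close> and the bound 2, replacing \<open>x\<close> by
          \<open>y\<close> costs at most \<open>e / 4\<close> at each of the two levels, which
          leaves \<open>e / 2\<close> for the Cauchy property at \<open>y\<close>.\<close>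
        fix e :: real assume e: "e > 0"
        then obtain y where y: "y \<in> carrier A" "convergent (\<lambda>k. level_trace k (h y))" "nrm A (x \<ominus> y) < e / 8"
          using ap[of "e/8"] by auto
        obtain N where N: "\<And>m n. m \<ge> N \<Longrightarrow> n \<ge> N \<Longrightarrow> norm (level_trace m (h y) - level_trace n (h y)) < e / 2"
          using CauchyD[OF convergent_Cauchy[OF y(2)], of "e/2"] e by auto
        have d: "norm (level_trace k (h x) - level_trace k (h y)) \<le> e / 4" for k
          using bdd_fun_approx[OF bd x y(1,3), of k] by simp
        have "norm (level_trace m (h x) - level_trace n (h x)) < e" if "m \<ge> N" "n \<ge> N" for m n
        proof -
          have tri: "norm (a + b - c) \<le> norm a + norm b + norm c" for a b c :: complex
            using norm_triangle_ineq4[of "a + b" c] norm_triangle_ineq[of a b] by linarith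
          have "norm (level_trace m (h x) - level_trace n (h x))
              \<le> norm (level_trace m (h x) - level_trace m (h y)) + norm (level_trace m (h y) - level_trace n (h y)) + norm (level_trace n (h x) - level_trace n (h y))"
            using tri[of "level_trace m (h x) - level_trace m (h y)" "level_trace m (h y) - level_trace n (h y)" "level_trace n (h x) - level_trace n (h y)"] by simp
          then show ?thesis using d[of m] d[of n] N[OF that] by linarith
        qed
        then show "\<exists>N. \<forall>m\<ge>N. \<forall>n\<ge>N. norm (level_trace m (h x) - level_trace n (h x)) < e" by blast
      qed
      then show "x \<in> ?V" using x by (simp add: Cauchy_convergent)
    qed
    then show ?thesis by simp
  qed
  define \<phi> where "\<phi> = (\<lambda>x. lim (\<lambda>k. level_trace k (h x)))"
  have L: "(\<lambda>k. level_trace k (h x)) \<longlonglongrightarrow> \<phi> x" if "x \<in> carrier A" for x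
    using conv[OF that] by (simp add: \<phi>_def convergent_LIMSEQ_iff)
  have "state_on A \<phi>"
    unfolding state_on_def lin_fun_def
  proof (intro conjI ballI allI)
    show "\<phi> (x \<oplus> y) = \<phi> x + \<phi> y" if "x \<in> carrier A" "y \<in> carrier A" for x y
    proof (rule LIMSEQ_unique)
      show "(\<lambda>k. level_trace k (h (x \<oplus> y))) \<longlonglongrightarrow> \<phi> (x \<oplus> y)" using that by (intro L) auto
      show "(\<lambda>k. level_trace k (h (x \<oplus> y))) \<longlonglongrightarrow> \<phi> x + \<phi> y"
        using tendsto_add[OF L[OF that(1)] L[OF that(2)]] that by (simp add: h.h_add level_trace_add)
    qed
    show "\<phi> (c \<odot> x) = c * \<phi> x" if "x \<in> carrier A" for c x
    proof (rule LIMSEQ_unique)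
      show "(\<lambda>k. level_trace k (h (c \<odot> x))) \<longlonglongrightarrow> \<phi> (c \<odot> x)" using that by (intro L) auto
      show "(\<lambda>k. level_trace k (h (c \<odot> x))) \<longlonglongrightarrow> c * \<phi> x"
        using tendsto_mult_left[OF L[OF that], of c] that by (simp add: h.h_scale level_trace_scale)
    qed
    fix y assume y: "y \<in> carrier A"
    then have l: "(\<lambda>k. level_trace k (h (adj A y \<otimes> y))) \<longlonglongrightarrow> \<phi> (adj A y \<otimes> y)" by (intro L) auto
    have p: "Im (level_trace k (h (adj A y \<otimes> y))) = 0" "0 \<le> Re (level_trace k (h (adj A y \<otimes> y)))" for k
      using st[of k] y by (auto simp: state_on_def complex_is_Real_iff)
    have "Im (\<phi> (adj A y \<otimes> y)) = 0" using tendsto_Im[OF l] LIMSEQ_unique[OF _ tendsto_const] by (simp add: p)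
    then show "\<phi> (adj A y \<otimes> y) \<in> \<real>" by (simp add: complex_is_Real_iff)
    show "0 \<le> Re (\<phi> (adj A y \<otimes> y))" by (rule LIMSEQ_le_const[OF tendsto_Re[OF l]]) (simp add: p)
  next
    have "(\<lambda>k. level_trace k (h \<one>)) \<longlonglongrightarrow> 1" using h.h_one by (simp add: level_trace_id)
    then show "\<phi> \<one> = 1" using LIMSEQ_unique[OF L[OF one_closed]] by blast
  qed
  moreover have "\<phi> (x \<otimes> U v n) = \<phi> (U v n \<otimes> x)" if "v = 1 \<or> v = 2" "x \<in> carrier A" for v n x
  proof -
    have "level_trace k (h (x \<otimes> U v n)) = level_trace k (h (U v n \<otimes> x))" for k
      using that by (simp add: h.h_mult hu uop_gpow level_trace_opU)
    then show ?thesis by (simp add: \<phi>_def)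
  qed
  moreover have "\<phi> (x \<otimes> s e) = complex_of_real rho * \<phi> (s e \<otimes> x)" if x: "x \<in> carrier A" for e x
  proof (rule LIMSEQ_unique)
    show "(\<lambda>k. level_trace k (h (x \<otimes> s e))) \<longlonglongrightarrow> \<phi> (x \<otimes> s e)" using x by (intro L) auto
    \<comment> \<open>The sequences at levels \<open>k\<close> and \<open>Suc k\<close> have the
      same limit, so the change of level disappears.\<close>
    have "(\<lambda>k. complex_of_real rho * level_trace (Suc k) (h (s e \<otimes> x))) \<longlonglongrightarrow> complex_of_real rho * \<phi> (s e \<otimes> x)"
      using x by (intro tendsto_mult_left LIMSEQ_Suc L) auto
    then show "(\<lambda>k. level_trace k (h (x \<otimes> s e))) \<longlonglongrightarrow> complex_of_real rho * \<phi> (s e \<otimes> x)"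
      using x by (simp add: h.h_mult hs level_trace_opS)
  qed
  moreover have "\<phi> ((p v \<ominus> range_sum exE A s v) \<otimes> x) = 0" if v: "v = 1 \<or> v = 2" and x: "x \<in> carrier A" for v x
  proof -
    \<comment> \<open>The Cuntz-Krieger difference is represented by \<open>vac v\<close>, which is
      invisible above level 0.\<close>
    have "h (p v \<ominus> range_sum exE A s v) = pop v \<ominus>\<^bsub>opalg\<^esub> range_sum exE opalg opS v"
      using v by (simp add: h.h_diff h.h_range_sum hp hs)
    also have "\<dots> = vac v"
      using vac_eq[of v] by (subst opalg_minus) (auto simp: range_sum_opS pop_def intro!: sum_in_operators operators_intros)
    finally have "level_trace (Suc k) (h ((p v \<ominus> range_sum exE A s v) \<otimes> x)) = 0" for k
      using v x by (simp add: h.h_mult level_trace_vac)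
    then have "(\<lambda>k. level_trace (Suc k) (h ((p v \<ominus> range_sum exE A s v) \<otimes> x))) \<longlonglongrightarrow> 0" by simp
    moreover have "(\<lambda>k. level_trace (Suc k) (h ((p v \<ominus> range_sum exE A s v) \<otimes> x))) \<longlonglongrightarrow> \<phi> ((p v \<ominus> range_sum exE A s v) \<otimes> x)"
      using v x by (intro LIMSEQ_Suc L) auto
    ultimately show ?thesis using LIMSEQ_unique by blast
  qed
  ultimately have "CK_KMS \<phi>" by (intro CK_KMSI gen)
  then show ?thesis by blast
qed

end

text \<open>The universal property is applied to the matrix copy of the operator algebra, and the
  resulting homomorphism is composed with the inverse of \<open>entries\<close> to land in operators
  again.\<close>

lemma toeplitz_algebra_CK_KMS:
  assumes T: "toeplitz_algebra TYPE(nat \<Rightarrow> nat \<Rightarrow> complex) exE exG T u p s"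
  shows "\<exists>\<phi>. ss_family.CK_KMS T u p s \<phi>"
proof -
  have cs: "cstar_algebra T" and fam: "toeplitz_family exE exG T u p s"
    and gen: "generates T (u ` exG \<union> p ` verts exE \<union> s ` arcs exE)"
    and univ: "\<And>(B :: (nat \<Rightarrow> nat \<Rightarrow> complex) cstar) U P S. cstar_algebra B \<Longrightarrow> toeplitz_family exE exG B U P S \<Longrightarrow>
        (\<exists>\<pi>\<in>star_hom T B. (\<forall>g\<in>exG. \<pi> (u g) = U g) \<and> (\<forall>v\<in>verts exE. \<pi> (p v) = P v) \<and>
           (\<forall>e\<in>arcs exE. \<pi> (s e) = S e))"
    using T unfolding toeplitz_algebra_def by blast+
  interpret T: ss_family T u p s
    by (rule ss_family.intro[OF cs]) (simp add: ss_family_axioms_def fam)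
  let ?O = "opalg :: (vpath ell2 \<Rightarrow>\<^sub>L vpath ell2) cstar"
  interpret tr: cstar_transport ?O entries
    by (intro cstar_transport.intro opalg_cstar cstar_transport_axioms.intro) (simp add: entries_inj)
  interpret e: star_hom_loc ?O tr.B entries
    by (intro star_hom_loc.intro star_hom_loc_axioms.intro opalg_nstar tr.B_nstar tr.f_star_hom)
  obtain \<pi> where \<pi>: "\<pi> \<in> star_hom T tr.B" "\<And>g. g \<in> exG \<Longrightarrow> \<pi> (u g) = entries (uop g)"
    "\<And>v. v \<in> verts exE \<Longrightarrow> \<pi> (p v) = entries (pop v)" "\<And>e. \<pi> (s e) = entries (opS e)"
    using univ[OF tr.B_cstar e.h_family[OF opalg_cstar family_op]] by auto
  interpret p: star_hom_loc T tr.B \<pi>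
    by (intro star_hom_loc.intro star_hom_loc_axioms.intro T.nstar_algebra_axioms tr.B_nstar \<pi>(1))
  interpret r: star_hom_loc tr.B ?O tr.r
    by (intro star_hom_loc.intro star_hom_loc_axioms.intro opalg_nstar tr.B_nstar tr.r_star_hom)
  have "(\<lambda>x. tr.r (\<pi> x)) \<in> star_hom T ?O"
    unfolding star_hom_def mem_Collect_eq
  proof (intro conjI allI ballI ring_hom_memI)
    fix x y c assume x: "x \<in> carrier T"
    show "tr.r (\<pi> x) \<in> carrier ?O" using x by (intro r.h_closed p.h_closed)
    show "tr.r (\<pi> (c \<odot>\<^bsub>T\<^esub> x)) = c \<odot>\<^bsub>?O\<^esub> tr.r (\<pi> x)" using x by (simp only: p.h_scale r.h_scale p.h_closed)
    show "tr.r (\<pi> (adj T x)) = adj ?O (tr.r (\<pi> x))" using x by (simp only: p.h_star r.h_star p.h_closed)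
    assume y: "y \<in> carrier T"
    show "tr.r (\<pi> (x \<otimes>\<^bsub>T\<^esub> y)) = tr.r (\<pi> x) \<otimes>\<^bsub>?O\<^esub> tr.r (\<pi> y)" using x y by (simp only: p.h_mult r.h_mult p.h_closed)
    show "tr.r (\<pi> (x \<oplus>\<^bsub>T\<^esub> y)) = tr.r (\<pi> x) \<oplus>\<^bsub>?O\<^esub> tr.r (\<pi> y)" using x y by (simp only: p.h_add r.h_add p.h_closed)
  next
    show "tr.r (\<pi> \<one>\<^bsub>T\<^esub>) = \<one>\<^bsub>?O\<^esub>" by (simp only: p.h_one r.h_one)
  qed
  then show ?thesis
  proof (rule T.CK_KMS_exists[OF gen])
    show "tr.r (\<pi> (u g)) = uop g" if "g \<in> exG" for g
      using that Op.u_pi(1)[OF that] by (simp only: \<pi>(2) tr.r_f)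
    show "tr.r (\<pi> (p v)) = pop v" if "v = 1 \<or> v = 2" for v
    proof -
      have "v \<in> verts exE" using that by auto
      then show ?thesis using Op.p_closed[OF that] by (simp only: \<pi>(3) tr.r_f)
    qed
    show "tr.r (\<pi> (s e)) = opS e" for e
      using Op.s_pi(1)[of e] by (simp only: \<pi>(4) tr.r_f)
  qed
qed

section \<open>The KMS state of the quotient\<close>

lemma (in nstar_algebra) star_finsum:
  assumes "finite I" "f \<in> I \<rightarrow> carrier A"
  shows "adj A (finsum A f I) = finsum A (\<lambda>i. adj A (f i)) I"
  using assms by (induction I rule: finite_induct) (auto simp: star_add Pi_iff)

text \<open>Supplies the entire extension of the orbit of a homogeneous element.\<close>

lemma (in nstar_algebra) entire_exp:
  assumes a: "a \<in> carrier A" shows "entire A (\<lambda>z. exp (\<i> * (z * of_int k)) \<odot> a)"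
  unfolding entire_def
proof (intro conjI allI)
  show "range (\<lambda>z. exp (\<i> * (z * of_int k)) \<odot> a) \<subseteq> carrier A" using a by auto
  fix z
  let ?e = "\<lambda>z. exp (\<i> * (z * of_int k)) :: complex"
  let ?q = "\<lambda>h. (?e (z + h) - ?e z) / h" and ?d = "?e z * (\<i> * of_int k)"
  have "(?e has_field_derivative ?d) (at z)" by (auto intro!: derivative_eq_intros)
  then have lim: "(?q \<longlongrightarrow> ?d) (at 0)" by (simp add: DERIV_def)
  have eq: "(1 / h) \<odot> (?e (z + h) \<odot> a \<ominus> ?e z \<odot> a) = ?q h \<odot> a" for h
    using a scale_add_left[of a "?e (z + h)" "- ?e z"]
    by (simp add: diff_eq_scale scale_scale flip: scale_add_left)
  have dist: "nrm A (?q h \<odot> a \<ominus> ?d \<odot> a) = cmod (?q h - ?d) * nrm A a" for h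
    using a scale_add_left[of a "?q h" "- ?d"]
    by (simp add: diff_eq_scale scale_scale flip: scale_add_left norm_scale)
  have "limitin (ntop A) (\<lambda>h. ?q h \<odot> a) (?d \<odot> a) (at 0)"
    unfolding limitin_iff
  proof (intro conjI allI impI)
    fix e :: real assume e: "e > 0"
    have "((\<lambda>h. cmod (?q h - ?d) * nrm A a) \<longlongrightarrow> cmod (?d - ?d) * nrm A a) (at 0)"
      by (intro tendsto_intros lim)
    then have "\<forall>\<^sub>F h in at 0. cmod (?q h - ?d) * nrm A a < e"
      using e by (intro order_tendstoD(2)) auto
    then show "\<forall>\<^sub>F h in at 0. ?q h \<odot> a \<in> carrier A \<and> nrm A (?q h \<odot> a \<ominus> ?d \<odot> a) < e"
      unfolding dist using a by simp
  qed (use a in simp)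
  then show "\<exists>D. limitin (ntop A) (\<lambda>h. (1 / h) \<odot> (?e (z + h) \<odot> a \<ominus> ?e z \<odot> a)) D (at 0)"
    unfolding eq by blast
qed

lemma exp_rho: "exp (ln (2 + sqrt 2)) = rho"
  by (simp add: rho_def add_pos_nonneg)

theorem proposition9p5:
  fixes T :: "'a cstar"
    and u :: "(nat, edge) piso \<Rightarrow> 'a" and p :: "nat \<Rightarrow> 'a" and s :: "edge \<Rightarrow> 'a"
    and \<sigma> :: "real \<Rightarrow> 'a set \<Rightarrow> 'a set"
  assumes T: "toeplitz_algebra TYPE(nat \<Rightarrow> nat \<Rightarrow> complex) exE exG T u p s"
    and \<sigma>: "gauge_dynamics exE exG (CK_quot exE T p s)
          (\<lambda>g. CK_map exE T p s (u g)) (\<lambda>v. CK_map exE T p s (p v)) (\<lambda>e. CK_map exE T p s (s e)) \<sigma>"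
  shows "acts_self_similarly exE exG \<and>
    (\<exists>!\<psi>. KMS_state (CK_quot exE T p s) \<sigma> (ln (2 + sqrt 2)) \<psi>) \<and>
    (\<forall>\<psi>. KMS_state (CK_quot exE T p s) \<sigma> (ln (2 + sqrt 2)) \<psi> \<longrightarrow>
       \<psi> (CK_map exE T p s (u (piso_id exE 1))) = complex_of_real (sqrt 2 - 1) \<and>
       \<psi> (CK_map exE T p s (u (piso_id exE 2))) = complex_of_real (2 - sqrt 2) \<and>
       \<psi> (CK_map exE T p s (u fa1)) = complex_of_real (3 - 2 * sqrt 2) \<and>
       \<psi> (CK_map exE T p s (u (piso_inv exE fa1))) = complex_of_real (3 - 2 * sqrt 2) \<and>
       \<psi> (CK_map exE T p s (u fa2)) = complex_of_real (10 - 7 * sqrt 2) \<and>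
       \<psi> (CK_map exE T p s (u (piso_inv exE fa2))) = complex_of_real (10 - 7 * sqrt 2))"
proof -
  define \<beta> where "\<beta> = ln (2 + sqrt 2)"
  define J where "J = CK_ideal exE T p s"
  have cs: "cstar_algebra T" and fam: "toeplitz_family exE exG T u p s"
    and gen: "generates T (u ` exG \<union> p ` verts exE \<union> s ` arcs exE)"
    using T unfolding toeplitz_algebra_def by blast+
  interpret A: ss_family T u p s
    by (rule ss_family.intro[OF cs]) (simp add: ss_family_axioms_def fam)
  let ?D = "\<lambda>v. p v \<ominus>\<^bsub>T\<^esub> range_sum exE T s v"
  have Dc: "?D v \<in> carrier T" if "v = 1 \<or> v = 2" for v using that by simp
  \<comment> \<open>Self-adjoint generators make the closed ideal invariant under the adjoint, which
    the quotient construction presupposes.\<close>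
  have Dsa: "adj T (?D v) = ?D v" if "v = 1 \<or> v = 2" for v
  proof -
    have "adj T (range_sum exE T s v) = range_sum exE T s v"
      unfolding range_sum_def using finite_arcs_into[of v]
      by (subst A.star_finsum) (auto simp: A.star_mult)
    then show ?thesis using that by (simp add: A.star_diff A.p_star)
  qed
  have "cstar_quot_loc T (closed_ideal T (?D ` verts exE))"
    by (rule closed_ideal_star_quot[OF cs]) (use Dc Dsa in auto)
  then have "cstar_quot_loc T J" by (simp add: J_def CK_ideal_def)
  then interpret Q: cstar_quot_loc T J .
  have quot: "CK_quot exE T p s = cstar_quot T J" and map: "CK_map exE T p s = (\<lambda>x. Q.q x)"
    by (auto simp: CK_quot_def CK_map_def J_def)
  have DJ: "?D v \<in> J" if "v = 1 \<or> v = 2" for v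
    using that unfolding J_def CK_ideal_def closed_ideal_def by auto
  have dyn: "dynamics (cstar_quot T J) \<sigma>"
    and gauge: "\<And>t \<mu> \<nu> g. g \<in> exG \<Longrightarrow> is_epath exE \<mu> \<Longrightarrow> is_epath exE \<nu> \<Longrightarrow>
      (let a = path_elem (cstar_quot T J) (\<lambda>v. Q.q (p v)) (\<lambda>e. Q.q (s e)) \<mu> \<otimes>\<^bsub>cstar_quot T J\<^esub> Q.q (u g)
          \<otimes>\<^bsub>cstar_quot T J\<^esub> adj (cstar_quot T J) (path_elem (cstar_quot T J) (\<lambda>v. Q.q (p v)) (\<lambda>e. Q.q (s e)) \<nu>)
       in \<sigma> t a = exp (\<i> * of_real (t * (real (plen \<mu>) - real (plen \<nu>)))) \<odot>\<^bsub>cstar_quot T J\<^esub> a)"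
    using \<sigma> unfolding gauge_dynamics_def quot map by blast+
  interpret S: star_dynamics Q.Q \<sigma>
    by unfold_locales (rule dyn)
  have homU: "homogeneous Q.Q \<sigma> 0 (Q.q (A.U v n))" if v: "v = 1 \<or> v = 2" for v n
  proof -
    have e: "is_epath exE (v, [])" using v by auto
    \<comment> \<open>The dynamics is specified on products with path elements on both sides; the
      path of length 0 at \<open>v\<close> brings the image of \<open>A.U v n\<close> into this form
      without changing it.\<close>
    have "Q.q (p v) \<otimes>\<^bsub>Q.Q\<^esub> Q.q (A.U v n) \<otimes>\<^bsub>Q.Q\<^esub> adj Q.Q (Q.q (p v)) = Q.q (A.U v n)"
      using v A.U_mult[OF v v, of 0 n] A.U_mult[OF v v, of n 0]
      by (simp add: Q.q_mult Q.q_star A.p_star A.u_id)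
    then show ?thesis using gauge[OF gpow_in_exG[OF v, of n] e e] v
      by (simp add: homogeneous_def path_elem_def Let_def)
  qed
  have homS: "homogeneous Q.Q \<sigma> 1 (Q.q (s e))" for e
  proof -
    have v: "edge_s e = 1 \<or> edge_s e = 2" by (rule A.edge_verts)
    have e: "is_epath exE (edge_r e, [e])" "is_epath exE (edge_s e, [])" using v by auto
    \<comment> \<open>\<open>path_elem\<close> of a single edge ends in the unit, which accounts for
      the unit in this product.\<close>
    have "Q.q (s e) \<otimes>\<^bsub>Q.Q\<^esub> \<one>\<^bsub>Q.Q\<^esub> \<otimes>\<^bsub>Q.Q\<^esub> Q.q (A.U (edge_s e) 0) \<otimes>\<^bsub>Q.Q\<^esub> adj Q.Q (Q.q (p (edge_s e))) = Q.q (s e)"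
      using v A.s_p[of e] by (simp add: Q.q_mult Q.q_star Q.q_one A.p_star A.u_id A.m_assoc)
    then show ?thesis using gauge[OF gpow_in_exG[OF v, of 0] e]
      by (simp add: homogeneous_def path_elem_def Let_def)
  qed
  have gens: "(\<exists>v n. (v = 1 \<or> v = 2) \<and> g = A.U v n) \<or> (\<exists>e. g = s e)" if "g \<in> A.gens" for g
    using that
  proof (elim UnE imageE)
    fix h assume "g = u h" "h \<in> exG"
    then show ?thesis by (metis exG_cases)
  next
    fix v assume "g = p v" "v \<in> verts exE"
    then have "(v = 1 \<or> v = 2) \<and> g = A.U v 0" using A.u_id by auto
    then show ?thesis by blast
  qed blast
  have hom_gen: "\<exists>k. homogeneous Q.Q \<sigma> k (Q.q g)" if "g \<in> A.gens" for g
    using gens[OF that] homU homS by blast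
  have hom_mon: "\<exists>k. homogeneous Q.Q \<sigma> k (Q.q m)" if "m \<in> mon T A.gens" for m
    using that
  proof (induction m rule: mon.induct)
    case one
    show ?case using S.homogeneous_one by (auto simp: Q.q_one)
  next
    case (gen g m)
    have c: "g \<in> carrier T" "m \<in> carrier T" using gen A.gens_closed A.mon_closed[OF A.gens_closed] by blast+
    obtain k l where "homogeneous Q.Q \<sigma> k (Q.q g)" "homogeneous Q.Q \<sigma> l (Q.q m)"
      using hom_gen[OF gen.hyps(1)] gen.IH by blast
    from S.homogeneous_mult[OF this] show ?case using c by (auto simp: Q.q_mult)
  next
    case (star g m)
    have c: "g \<in> carrier T" "m \<in> carrier T" using star A.gens_closed A.mon_closed[OF A.gens_closed] by blast+
    obtain k l where "homogeneous Q.Q \<sigma> k (Q.q g)" "homogeneous Q.Q \<sigma> l (Q.q m)"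
      using hom_gen[OF star.hyps(1)] star.IH by blast
    from S.homogeneous_mult[OF S.homogeneous_star[OF this(1)] this(2)] show ?case
      using c by (auto simp: Q.q_mult Q.q_star)
  qed
  let ?M = "Q.q ` mon T A.gens"
  have Mc: "?M \<subseteq> carrier Q.Q" using A.mon_closed[OF A.gens_closed] by auto
  have M_dense: "\<exists>y\<in>linear_span Q.Q ?M. nrm Q.Q (x \<ominus>\<^bsub>Q.Q\<^esub> y) < e" if x: "x \<in> carrier Q.Q" and e: "e > 0" for x e
  proof -
    let ?V = "{x \<in> carrier T. Q.q x \<in> linear_span Q.Q ?M}"
    have L: "linear_subspace Q.Q (linear_span Q.Q ?M)" using Mc by (rule Q.Q.linear_subspace_span)
    have "linear_subspace T ?V"
      using L unfolding linear_subspace_def by (auto simp: Q.q_zero simp flip: Q.q_add Q.q_scale)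
    moreover have "mon T A.gens \<subseteq> ?V"
      using A.mon_closed[OF A.gens_closed] Q.Q.span_superset[of ?M] by auto
    ultimately have "linear_span T (mon T A.gens) \<subseteq> ?V" by (rule A.span_minimal)
    then show ?thesis using Q.Q_dense[OF gen x e] by blast
  qed
  interpret K: KMS_setup Q.Q \<sigma> ?M
    by unfold_locales (use hom_mon M_dense Q.Q_state_bdd in auto)
  \<comment> \<open>The pullback of a KMS state vanishes on \<open>J\<close>, and the KMS relation
    for homogeneous elements gives the remaining conditions with degrees 0 and 1.\<close>
  have CK: "A.CK_KMS (\<lambda>x. \<psi> (Q.q x))" if \<psi>: "KMS_state Q.Q \<sigma> \<beta> \<psi>" for \<psi>
  proof -
    have st: "state_on Q.Q \<psi>"
      using \<psi> cstate_state_on[OF Q.Q.nstar_algebra_axioms] by (auto simp: KMS_state_def)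
    have zero: "\<psi> (Q.q x) = 0" if "x \<in> J" for x
      using that st A.a_rcos_zero[OF Q.ideal_axioms that] Q.q_zero A.a_rcos_zero[OF Q.ideal_axioms, of "\<zero>\<^bsub>T\<^esub>"]
        Q.Q.lin_fun_zero[of \<psi>] by (simp add: state_on_def)
    have "\<psi> (Q.q (c \<otimes>\<^bsub>T\<^esub> ?D v \<otimes>\<^bsub>T\<^esub> b)) = 0"
      if "b \<in> carrier T" "c \<in> carrier T" "v = 1 \<or> v = 2" for v b c
      using that DJ[OF that(3)] by (intro zero Q.I_r_closed Q.I_l_closed)
    moreover have "\<psi> (Q.q (x \<otimes>\<^bsub>T\<^esub> A.U v n)) = \<psi> (Q.q (A.U v n \<otimes>\<^bsub>T\<^esub> x))"
      if "v = 1 \<or> v = 2" "x \<in> carrier T" for v n x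
      using K.KMS_homogeneous[OF \<psi> homU[OF that(1)], of "Q.q x" n] that by (simp add: Q.q_mult)
    moreover have "\<psi> (Q.q (x \<otimes>\<^bsub>T\<^esub> s e)) = complex_of_real rho * \<psi> (Q.q (s e \<otimes>\<^bsub>T\<^esub> x))"
      if "x \<in> carrier T" for e x
      using K.KMS_homogeneous[OF \<psi> homS, of "Q.q x" e] that by (simp add: Q.q_mult \<beta>_def exp_rho)
    ultimately show ?thesis by (intro A.CK_KMS_intro Q.state_on_q[OF st])
  qed
  have vals: "\<psi> (Q.q (u (piso_id exE 1))) = complex_of_real (sqrt 2 - 1) \<and>
       \<psi> (Q.q (u (piso_id exE 2))) = complex_of_real (2 - sqrt 2) \<and>
       \<psi> (Q.q (u fa1)) = complex_of_real (3 - 2 * sqrt 2) \<and>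
       \<psi> (Q.q (u (piso_inv exE fa1))) = complex_of_real (3 - 2 * sqrt 2) \<and>
       \<psi> (Q.q (u fa2)) = complex_of_real (10 - 7 * sqrt 2) \<and>
       \<psi> (Q.q (u (piso_inv exE fa2))) = complex_of_real (10 - 7 * sqrt 2)"
    if "KMS_state Q.Q \<sigma> \<beta> \<psi>" for \<psi>
    using A.kms_U_zero[OF CK[OF that]] A.CK_KMS_values[OF CK[OF that]]
    by (simp add: gpow_zero fa1_gpow fa2_gpow gpow_inv)
  have unique: "\<psi> = \<psi>'" if \<psi>: "KMS_state Q.Q \<sigma> \<beta> \<psi>" "KMS_state Q.Q \<sigma> \<beta> \<psi>'" for \<psi> \<psi>'
  proof (rule extensionalityI)
    show "\<psi> \<in> extensional (carrier Q.Q)" "\<psi>' \<in> extensional (carrier Q.Q)"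
      using \<psi> by (auto simp: KMS_state_def cstate_def)
    show "\<psi> x = \<psi>' x" if "x \<in> carrier Q.Q" for x
      using that A.CK_KMS_unique[OF gen CK[OF \<psi>(1)] CK[OF \<psi>(2)]] by (elim Q.Q_cases) simp
  qed
  have exists: "\<exists>\<psi>. KMS_state Q.Q \<sigma> \<beta> \<psi>"
  proof -
    obtain \<phi> where \<phi>: "A.CK_KMS \<phi>" using toeplitz_algebra_CK_KMS[OF T] by blast
    note st = A.kms_state[OF \<phi>]
    note lin = A.state_lin[OF st]
    \<comment> \<open>The null ideal of \<open>\<phi>\<close> is a closed ideal containing the
      Cuntz-Krieger differences, so it contains \<open>J\<close>; this lets \<open>\<phi>\<close>
      descend to the quotient.\<close>
    have null: "\<phi> x = 0" if x: "x \<in> J" for x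
    proof -
      let ?N = "A.null_ideal {\<phi>}"
      have "ideal ?N T" by (rule A.ideal_null_ideal) (use lin in simp)
      moreover have "closedin (ntop T) ?N"
        unfolding A.closedin_iff
      proof (intro conjI ballI impI)
        show "?N \<subseteq> carrier T" by (auto simp: A.null_ideal_def)
        fix x assume x: "x \<in> carrier T" and ap: "\<forall>e>0. \<exists>y\<in>?N. nrm T (x \<ominus>\<^bsub>T\<^esub> y) < e"
        have "\<phi> (c \<otimes>\<^bsub>T\<^esub> x \<otimes>\<^bsub>T\<^esub> b) = 0" if bc: "b \<in> carrier T" "c \<in> carrier T" for b c
        proof (rule A.bdd_fun_eq_closure[OF A.bdd_fun_left[OF A.bdd_fun_right[OF A.state_bdd[OF st] bc(1)] bc(2)] _ x,
            of 0 "\<lambda>_. 0"])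
          show "bdd_fun T 0 (\<lambda>_. 0)" by (simp add: bdd_fun_def lin_fun_def)
          fix e :: real assume "e > 0"
          then obtain y where y: "y \<in> ?N" "nrm T (x \<ominus>\<^bsub>T\<^esub> y) < e" using ap by blast
          then show "\<exists>y\<in>carrier T. \<phi> (c \<otimes>\<^bsub>T\<^esub> y \<otimes>\<^bsub>T\<^esub> b) = 0 \<and> nrm T (x \<ominus>\<^bsub>T\<^esub> y) < e"
            using bc by (intro bexI[of _ y]) (auto simp: A.null_ideal_def)
        qed
        with x show "x \<in> ?N" by (simp add: A.null_ideal_def)
      qed
      moreover have "?D ` verts exE \<subseteq> ?N"
        using A.kms_CK[OF \<phi>] Dc by (auto simp: A.null_ideal_def)
      ultimately have "J \<subseteq> ?N" unfolding J_def CK_ideal_def closed_ideal_def by blast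
      then show ?thesis using A.null_ideal_zero[of x "{\<phi>}" \<phi>] x by auto
    qed
    \<comment> \<open>The value is that of \<open>\<phi>\<close> at a chosen representative;
      restricting to the carrier provides the extensionality demanded by
      \<open>cstate\<close>.\<close>
    define \<psi> where "\<psi> = (\<lambda>X\<in>carrier Q.Q. \<phi> (SOME x. x \<in> carrier T \<and> Q.q x = X))"
    have \<psi>q: "\<psi> (Q.q x) = \<phi> x" if x: "x \<in> carrier T" for x
    proof -
      define y where "y = (SOME y. y \<in> carrier T \<and> Q.q y = Q.q x)"
      have y: "y \<in> carrier T \<and> Q.q y = Q.q x" unfolding y_def by (rule someI[of _ x]) (simp add: x)
      then have "\<phi> (y \<ominus>\<^bsub>T\<^esub> x) = 0" using x by (intro null) (simp flip: Q.q_eq_iff)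
      then have "\<phi> y = \<phi> x" using x y lin by (simp add: A.lin_fun_diff)
      then show ?thesis using x by (simp add: \<psi>_def y_def)
    qed
    have st\<psi>: "state_on Q.Q \<psi>"
      unfolding state_on_def lin_fun_def
    proof (intro conjI ballI allI)
      show "\<psi> (x \<oplus>\<^bsub>Q.Q\<^esub> y) = \<psi> x + \<psi> y" if "x \<in> carrier Q.Q" "y \<in> carrier Q.Q" for x y
        using that lin by (elim Q.Q_cases) (simp add: Q.q_add \<psi>q A.lin_fun_add)
      show "\<psi> (c \<odot>\<^bsub>Q.Q\<^esub> x) = c * \<psi> x" if "x \<in> carrier Q.Q" for c x
        using that lin by (elim Q.Q_cases) (simp add: Q.q_scale \<psi>q A.lin_fun_scale)
      show "\<psi> (adj Q.Q y \<otimes>\<^bsub>Q.Q\<^esub> y) \<in> \<real>" "0 \<le> Re (\<psi> (adj Q.Q y \<otimes>\<^bsub>Q.Q\<^esub> y))" if "y \<in> carrier Q.Q" for y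
        using that A.state_pos[OF st] by (elim Q.Q_cases; simp add: Q.q_star Q.q_mult \<psi>q)+
      show "\<psi> \<one>\<^bsub>Q.Q\<^esub> = 1" using A.state_one[OF st] by (simp add: Q.q_one \<psi>q)
    qed
    have bd\<psi>: "bdd_fun Q.Q 2 \<psi>" using st\<psi> by (rule Q.Q_state_bdd)
    \<comment> \<open>\<open>P k m\<close> couples the degree of \<open>m\<close> with the exponent
      in its KMS relation; both are additive under products, so they agree on all monomials.\<close>
    define P where "P = (\<lambda>k m. homogeneous Q.Q \<sigma> k (Q.q m) \<and> m \<in> carrier T \<and>
        (\<forall>x\<in>carrier T. \<phi> (x \<otimes>\<^bsub>T\<^esub> m) = exp (of_int k * \<beta>) * \<phi> (m \<otimes>\<^bsub>T\<^esub> x)))"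
    have P_mult: "P (k + l) (m \<otimes>\<^bsub>T\<^esub> n)" if m: "P k m" and n: "P l n" for k l m n
    proof -
      have c: "m \<in> carrier T" "n \<in> carrier T" using m n by (auto simp: P_def)
      have "\<phi> (x \<otimes>\<^bsub>T\<^esub> (m \<otimes>\<^bsub>T\<^esub> n)) = exp (of_int (k + l) * \<beta>) * \<phi> (m \<otimes>\<^bsub>T\<^esub> n \<otimes>\<^bsub>T\<^esub> x)" if x: "x \<in> carrier T" for x
      proof -
        have "\<phi> (x \<otimes>\<^bsub>T\<^esub> (m \<otimes>\<^bsub>T\<^esub> n)) = \<phi> ((x \<otimes>\<^bsub>T\<^esub> m) \<otimes>\<^bsub>T\<^esub> n)" using c x by (simp add: A.m_assoc)
        also have "\<dots> = exp (of_int l * \<beta>) * \<phi> (n \<otimes>\<^bsub>T\<^esub> (x \<otimes>\<^bsub>T\<^esub> m))" using n c x by (simp add: P_def)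
        also have "\<phi> (n \<otimes>\<^bsub>T\<^esub> (x \<otimes>\<^bsub>T\<^esub> m)) = \<phi> ((n \<otimes>\<^bsub>T\<^esub> x) \<otimes>\<^bsub>T\<^esub> m)" using c x by (simp add: A.m_assoc)
        also have "\<dots> = exp (of_int k * \<beta>) * \<phi> (m \<otimes>\<^bsub>T\<^esub> (n \<otimes>\<^bsub>T\<^esub> x))" using m c x by (simp add: P_def)
        finally show ?thesis using c x by (simp add: A.m_assoc exp_add distrib_right)
      qed
      then show ?thesis using m n c Q.q_mult[OF c] S.homogeneous_mult[of k "Q.q m" l "Q.q n"] by (simp add: P_def)
    qed
    have P_U: "P 0 (A.U v n)" if "v = 1 \<or> v = 2" for v n
      using that homU A.kms_U[OF \<phi>] by (simp add: P_def)
    have P_s: "P 1 (s e)" for e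
      using homS A.kms_s[OF \<phi>] by (simp add: P_def \<beta>_def exp_rho)
    have P_s': "P (- 1) (adj T (s e))" for e
    proof -
      have "\<phi> (x \<otimes>\<^bsub>T\<^esub> adj T (s e)) = exp (- \<beta>) * \<phi> (adj T (s e) \<otimes>\<^bsub>T\<^esub> x)" if "x \<in> carrier T" for x
        using A.kms_star_s[OF \<phi> that, of e] rho_gt_1 by (simp add: exp_minus \<beta>_def exp_rho)
      then show ?thesis
        using S.homogeneous_star[OF homS[of e]] by (simp add: P_def Q.q_star)
    qed
    have P_gen: "\<exists>k. P k g" "\<exists>k. P k (adj T g)" if "g \<in> A.gens" for g
      using gens[OF that] P_U P_s P_s' A.U_star by metis+
    have P_mon: "\<exists>k. P k m" if "m \<in> mon T A.gens" for m
      using that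
    proof (induction m rule: mon.induct)
      case one
      have "P 0 \<one>\<^bsub>T\<^esub>" using S.homogeneous_one by (simp add: P_def Q.q_one)
      then show ?case by blast
    next
      case (gen g m)
      obtain k l where "P k g" "P l m" using P_gen(1)[OF gen.hyps(1)] gen.IH by (elim exE)
      from P_mult[OF this] show ?case by (rule exI)
    next
      case (star g m)
      obtain k l where "P k (adj T g)" "P l m" using P_gen(2)[OF star.hyps(1)] star.IH by (elim exE)
      from P_mult[OF this] show ?case by (rule exI)
    qed
    have ext_exp: "entire_extension Q.Q \<sigma> (Q.q m) (\<lambda>z. exp (\<i> * (z * of_int k)) \<odot>\<^bsub>Q.Q\<^esub> Q.q m)"
      if "P k m" for k m
      using that Q.Q.entire_exp[of "Q.q m" k] by (simp add: entire_extension_def P_def homogeneous_def)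
    have "KMS_state Q.Q \<sigma> \<beta> \<psi>"
      unfolding KMS_state_def
    proof (intro conjI exI[of _ ?M] allI ballI impI)
      show "cstate Q.Q \<psi>"
        by (rule state_on_cstate[OF Q.Q.nstar_algebra_axioms st\<psi>]) (simp add: \<psi>_def)
      show "?M \<subseteq> analytic_elements Q.Q \<sigma>"
      proof
        fix x assume "x \<in> ?M"
        then obtain m k where "x = Q.q m" "P k m" using P_mon by blast
        then show "x \<in> analytic_elements Q.Q \<sigma>"
          using ext_exp unfolding analytic_elements_def P_def by auto
      qed
      have "x \<in> ntop Q.Q closure_of linear_span Q.Q ?M" if "x \<in> carrier Q.Q" for x
        using that M_dense Q.Q.closure_iff[OF Q.Q.span_carrier[OF Mc]] by simp
      then show "ntop Q.Q closure_of linear_span Q.Q ?M = carrier Q.Q"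
        using Q.Q.closure_iff[OF Q.Q.span_carrier[OF Mc]] by blast
      show "\<sigma> t ` linear_span Q.Q ?M \<subseteq> linear_span Q.Q ?M" for t
      proof -
        let ?V = "{x \<in> carrier Q.Q. \<sigma> t x \<in> linear_span Q.Q ?M}"
        have L: "linear_subspace Q.Q (linear_span Q.Q ?M)" using Mc by (rule Q.Q.linear_subspace_span)
        have "linear_subspace Q.Q ?V"
          using L unfolding linear_subspace_def by (auto simp: S.dyn_zero S.dyn_add S.dyn_scale)
        moreover have "?M \<subseteq> ?V"
        proof
          fix x assume x: "x \<in> ?M"
          then obtain k where "homogeneous Q.Q \<sigma> k x" using K.M_hom by blast
          then show "x \<in> ?V"
            using L x Q.Q.span_superset[of ?M] by (auto simp: homogeneous_def linear_subspace_def)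
        qed
        ultimately have "linear_span Q.Q ?M \<subseteq> ?V" by (rule Q.Q.span_minimal)
        then show ?thesis by blast
      qed
      fix a b G assume a: "a \<in> ?M" and b: "b \<in> ?M" and G: "entire_extension Q.Q \<sigma> a G"
      obtain m k where m: "a = Q.q m" "P k m" using a P_mon by blast
      obtain n where n: "b = Q.q n" "n \<in> carrier T" using b A.mon_closed[OF A.gens_closed] by blast
      have mc: "m \<in> carrier T" using m by (simp add: P_def)
      have bc: "b \<in> carrier Q.Q" and ac: "a \<in> carrier Q.Q" using m n mc by auto
      \<comment> \<open>\<open>G\<close> is an arbitrary entire extension. After applying the
        functional it is identified with the explicit exponential by agreement on the real line,
        which yields its value at \<open>\<i> * \<beta>\<close>.\<close>
      have "\<psi> (b \<otimes>\<^bsub>Q.Q\<^esub> G (\<i> * complex_of_real \<beta>)) = exp (\<i> * (\<i> * complex_of_real \<beta> * of_int k)) * \<psi> (b \<otimes>\<^bsub>Q.Q\<^esub> a)"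
      proof (rule entire_eq_on_reals[of "\<lambda>z. \<psi> (b \<otimes>\<^bsub>Q.Q\<^esub> G z)" "\<lambda>z. exp (\<i> * (z * of_int k)) * \<psi> (b \<otimes>\<^bsub>Q.Q\<^esub> a)"])
        show "(\<lambda>z. \<psi> (b \<otimes>\<^bsub>Q.Q\<^esub> G z)) holomorphic_on UNIV"
          using Q.Q.bdd_fun_entire[OF Q.Q.bdd_fun_left[OF bd\<psi> bc]] G by (simp add: entire_extension_def)
        show "(\<lambda>z. exp (\<i> * (z * of_int k)) * \<psi> (b \<otimes>\<^bsub>Q.Q\<^esub> a)) holomorphic_on UNIV"
          by (intro holomorphic_intros)
        fix t :: real
        have "G (complex_of_real t) = exp (\<i> * of_real (t * of_int k)) \<odot>\<^bsub>Q.Q\<^esub> a"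
          using G m by (simp add: entire_extension_def P_def homogeneous_def)
        then show "\<psi> (b \<otimes>\<^bsub>Q.Q\<^esub> G (complex_of_real t)) = exp (\<i> * (complex_of_real t * of_int k)) * \<psi> (b \<otimes>\<^bsub>Q.Q\<^esub> a)"
          using ac bc st\<psi> by (simp add: Q.Q.scale_mult_right Q.Q.lin_fun_scale state_on_def)
      qed
      also have "exp (\<i> * (\<i> * complex_of_real \<beta> * of_int k)) = complex_of_real (exp (- (of_int k * \<beta>)))"
      proof -
        have "\<i> * (\<i> * complex_of_real \<beta> * of_int k) = complex_of_real (- (of_int k * \<beta>))"
          by (simp add: complex_eq_iff)
        then show ?thesis by (simp only: exp_of_real)
      qed
      also have "\<psi> (b \<otimes>\<^bsub>Q.Q\<^esub> a) = exp (of_int k * \<beta>) * \<psi> (a \<otimes>\<^bsub>Q.Q\<^esub> b)"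
        using m n mc by (simp add: Q.q_mult \<psi>q P_def)
      finally show "\<psi> (a \<otimes>\<^bsub>Q.Q\<^esub> b) = \<psi> (b \<otimes>\<^bsub>Q.Q\<^esub> G (\<i> * complex_of_real \<beta>))"
        by (simp add: exp_minus)
    qed
    then show ?thesis by blast
  qed
  obtain \<psi> where \<psi>: "KMS_state Q.Q \<sigma> \<beta> \<psi>" using exists by (rule exE)
  show ?thesis
    unfolding quot map \<beta>_def[symmetric]
  proof (rule conjI[OF exG_acts_self_similarly], rule conjI)
    show "\<exists>!\<psi>. KMS_state Q.Q \<sigma> \<beta> \<psi>"
    proof (rule ex1I)
      show "KMS_state Q.Q \<sigma> \<beta> \<psi>" by (rule \<psi>)
      show "\<psi>' = \<psi>" if "KMS_state Q.Q \<sigma> \<beta> \<psi>'" for \<psi>' using that \<psi> by (rule unique)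
    qed
  qed (intro allI impI vals)
qed

end
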